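(* Let $\alpha$ be a real number with $0\le\alpha<1/2$. Then the equality $$\int_{0}^{\infty}\frac{\arg\bigl(\zeta(1/2+\alpha+it)\,(-1/2+\alpha+it)\bigr)}{\bigl((1/2-\alpha)^2+t^2\bigr)^{3/2}}\,dt+\int_{1/2+\alpha}^{1}\frac{\ln\bigl(\zeta(\sigma)(\sigma-1)\bigr)}{(1-\sigma)^{3/2}(\sigma-2\alpha)^{3/2}}\,d\sigma=0$$ holds if and only if the Riemann zeta function $\zeta$ has no zeros $\sigma+it$ with $\sigma>1/2+\alpha$. In particular, for $\alpha=0$ this equality is equivalent to the Riemann hypothesis.
   Context: $\zeta$ denotes the Riemann zeta function. For real $\sigma\in(1/2+\alpha,1)$, $\zeta(\sigma)(\sigma-1)>0$ and $\ln$ is the real logarithm. For $s=\sigma+it$ with $t>0$, $\arg(\zeta(s)(s-1))$ denotes the imaginary part of the branch of $\ln(\zeta(s)(s-1))$ obtained by continuous variation along the horizontal line $\operatorname{Im}s=t$ starting from real values of $s$ far to the right, the branch being real on the real half-line $\sigma>1/2+\alpha$; if a zero of $\zeta$ lies on the path, the value is taken as the limit from above. The Riemann hypothesis is the statement that $\zeta$ has no zeros with real part $>1/2$. *)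

theory Defs
  imports "HOL-Complex_Analysis.Complex_Analysis"
begin

text \<open>The Riemann zeta function: the (unique, by the identity theorem) holomorphic
  function on the complex plane minus the pole at 1 which agrees with the Dirichlet
  series of n^(-s) on the half-plane Re s > 1.  Its value at the pole is irrelevant.\<close>
definition zeta :: "complex \<Rightarrow> complex" where
  "zeta = (SOME f. f holomorphic_on (UNIV - {1}) \<and>
      (\<forall>s. 1 < Re s \<longrightarrow> f s = (\<Sum>n. inverse (of_nat (Suc n) powr s))))"

text \<open>g is a continuous logarithm of zeta(s)(s-1) along the horizontal half-line
  {x + i t : x \<ge> \<sigma>0}, normalized so that its imaginary part tends to 0 as x goes
  to +infinity (i.e. obtained by continuous variation from real values far to the right).\<close>
definition cont_log_along :: "real \<Rightarrow> real \<Rightarrow> (real \<Rightarrow> complex) \<Rightarrow> bool" where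
  "cont_log_along \<sigma>0 t g \<longleftrightarrow>
     continuous_on {\<sigma>0..} g \<and>
     (\<forall>x\<ge>\<sigma>0. exp (g x) = zeta (Complex x t) * (Complex x t - 1)) \<and>
     ((\<lambda>x. Im (g x)) \<longlongrightarrow> 0) at_top"

definition arg_raw :: "real \<Rightarrow> real \<Rightarrow> real" where
  "arg_raw \<sigma>0 t = Im ((SOME g. cont_log_along \<sigma>0 t g) \<sigma>0)"

text \<open>arg(zeta(s)(s-1)) at s = \<sigma>0 + i t; if a zero lies on the path, the limit from above.\<close>
definition zeta_arg :: "real \<Rightarrow> real \<Rightarrow> real" where
  "zeta_arg \<sigma>0 t =
     (if \<exists>g. cont_log_along \<sigma>0 t g then arg_raw \<sigma>0 t
      else Lim (at_right t) (arg_raw \<sigma>0))"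

end

theory Submission
  imports Defs
begin

text \<open>
  Let \<open>a = 1/2 + \<alpha>\<close>, \<open>b = 1/2 - \<alpha>\<close> and integrate \<open>log (\<zeta>(s) (s - 1)) \<sqdot> (b\<^sup>2 - (s - a)\<^sup>2)\<^sup>-\<^sup>3\<^sup>/\<^sup>2\<close>
  around the box with lower left corner \<open>a\<close> in the upper half-plane. Here the logarithm is continued
  along horizontals from the right, so it has a cut running left from every zero. On the left
  side the weight is real and the real part of the integral is the integral of the argument; on the
  real axis the weight is real up to the branch point \<open>1\<close> and purely imaginary beyond it; the other
  two sides tend to 0 because the logarithm grows at most linearly in the mean. What remains are the
  jumps across the cuts. A zero \<open>\<beta> + i \<gamma>\<close> contributes \<open>2 \<pi>\<close> times the integral of the imaginary part of
  the weight over \<open>[a, \<beta>] + i \<gamma>\<close>, which is positive as \<open>\<beta> \<le> 1\<close>. Hence the total vanishes exactly if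
  there is no zero to the right of the line.
\<close>

section \<open>Analytic continuation of the zeta function\<close>

text \<open>The difficulty is the exponent 3/2: at the branch point 1 the weight alone is not
  integrable. It is compensated by \<open>zeta(s) (s - 1)\<close> having the value 1 there, so that
  its logarithm vanishes and the product is only of order |s - 1| to the power -1/2. For the same
  reason the logarithm attached to each zero is normalised separately to vanish at 1. For \<alpha> =
  0 the left side of the box is the critical line and carries zeros. They are harmless: their
  logarithmic singularity is integrable and their cuts leave the box. The heights of zeros form a
  countable, hence null, set, so the limit from above in the definition of the argument is never
  evaluated. Crude growth bounds suffice: on the two far sides of a box of height T the weight is at
  most T^-3, against a logarithm and a length of order T, which leaves an error of order 1/T.
  Bochner integrals of non-integrable functions are 0 by convention, so the statements about
  rectangles carry integrability along with the values.\<close>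

lemma norm_of_nat_powr_le:
  assumes "n \<ge> 1"
  shows "norm (of_nat n powr s :: complex) = real n powr Re s"
  using assms by (subst norm_powr_real_powr) auto

text \<open>Taylor expansion of z^(1 - s) at n, evaluated at n + 1. If Re s + J >= 0, the modulus of
  the derivative of order J + 1 does not increase along the segment, so its value at n bounds the
  remainder; the factorial is dropped.\<close>

lemma powr_succ_taylor_bound:
  fixes s :: complex
  assumes n: "n \<ge> 1" and s: "Re s + real J \<ge> 0"
  shows "norm (of_nat (Suc n) powr (1 - s) - (\<Sum>i\<le>J. ((1 - s) gchoose i) * of_nat n powr (1 - s - of_nat i)))
     \<le> norm (\<Prod>i<Suc J. 1 - s - of_nat i) * real n powr (- (Re s + real J))"
proof -
  define f where "f = (\<lambda>(i::nat) (z::complex). (\<Prod>k<i. 1 - s - of_nat k) * z powr (1 - s - of_nat i))"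
  define S where "S = closed_segment (of_nat n) (of_nat (Suc n) :: complex)"
  have S: "\<exists>x. z = of_real x \<and> real n \<le> x" if "z \<in> S" for z
  proof -
    have "z \<in> complex_of_real ` closed_segment (real n) (real (Suc n))"
      using that unfolding S_def by (metis closed_segment_of_real of_real_of_nat_eq)
    then show ?thesis by (auto simp: closed_segment_eq_real_ivl)
  qed
  have nR: "z \<notin> \<real>\<^sub>\<le>\<^sub>0" if "z \<in> S" for z
    using S[OF that] n by auto
  have "norm (f 0 (of_nat (Suc n)) - (\<Sum>i\<le>J. f i (of_nat n) * (of_nat (Suc n) - of_nat n) ^ i / fact i))
     \<le> (norm (\<Prod>i<Suc J. 1 - s - of_nat i) * real n powr (- (Re s + real J))) * norm (of_nat (Suc n) - of_nat n :: complex) ^ Suc J / fact J"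
  proof (rule complex_Taylor[where S = S])
    show "convex S" by (simp add: S_def)
    show "of_nat n \<in> S" "of_nat (Suc n) \<in> S" by (auto simp: S_def)
    show "(f i has_field_derivative f (Suc i) x) (at x within S)" if "x \<in> S" "i \<le> J" for i x
      unfolding f_def using nR[OF that(1)]
      by (auto intro!: derivative_eq_intros simp: algebra_simps)
    show "norm (f (Suc J) x) \<le> norm (\<Prod>i<Suc J. 1 - s - of_nat i) * real n powr (- (Re s + real J))" if "x \<in> S" for x
    proof -
      obtain y where y: "x = of_real y" "real n \<le> y" using S[OF \<open>x \<in> S\<close>] by blast
      have "norm (f (Suc J) x) = norm (\<Prod>i<Suc J. 1 - s - of_nat i) * y powr (Re (1 - s - of_nat (Suc J)))"
        unfolding f_def norm_mult using y n by (subst norm_powr_real_powr) auto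
      also have "\<dots> = norm (\<Prod>i<Suc J. 1 - s - of_nat i) * y powr (- (Re s + real J))"
        by (simp add: algebra_simps)
      also have "\<dots> \<le> norm (\<Prod>i<Suc J. 1 - s - of_nat i) * real n powr (- (Re s + real J))"
        using y n s by (intro mult_left_mono powr_mono2') auto
      finally show ?thesis .
    qed
  qed
  moreover have "f i (of_nat n) * (of_nat (Suc n) - of_nat n) ^ i / fact i
      = ((1 - s) gchoose i) * of_nat n powr (1 - s - of_nat i)" for i
    by (simp add: f_def gbinomial_prod_rev lessThan_atLeast0)
  moreover have "norm (\<Prod>i<Suc J. 1 - s - of_nat i) * real n powr (- (Re s + real J)) / fact J
     \<le> norm (\<Prod>i<Suc J. 1 - s - of_nat i) * real n powr (- (Re s + real J))"
    using divide_left_mono[OF fact_ge_1, of "norm (\<Prod>i<Suc J. 1 - s - of_nat i) * real n powr (- (Re s + real J))" J] by simp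
  ultimately show ?thesis
    by (simp add: f_def)
qed

text \<open>The Taylor remainder with base point n + 1, so that summation over all naturals starts
  at 1. Summed over n, its Taylor terms become values of the Dirichlet series at shifted arguments,
  while the remainder itself converges further to the left.\<close>

definition powr_rem :: "nat \<Rightarrow> nat \<Rightarrow> complex \<Rightarrow> complex" where
  "powr_rem J n s = of_nat (Suc (Suc n)) powr (1 - s)
     - (\<Sum>i\<le>J. ((1 - s) gchoose i) * of_nat (Suc n) powr (1 - s - of_nat i))"

lemma norm_powr_rem_le:
  assumes "Re s + real J \<ge> 0"
  shows "norm (powr_rem J n s) \<le> norm (\<Prod>i<Suc J. 1 - s - of_nat i) * real (Suc n) powr (- (Re s + real J))"
  using powr_succ_taylor_bound[of "Suc n" s J] assms by (simp add: powr_rem_def)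

lemma summable_Suc_powr_iff: "summable (\<lambda>n. real (Suc n) powr x) \<longleftrightarrow> x < -1"
  by (subst summable_Suc_iff) (rule summable_real_powr_iff)

lemma summable_Suc_cpowr:
  assumes "Re s < -1"
  shows "summable (\<lambda>n. of_nat (Suc n) powr s :: complex)"
  by (rule summable_norm_cancel, rule summable_comparison_test[of _ "\<lambda>n. real (Suc n) powr Re s"])
     (use assms summable_Suc_powr_iff in \<open>auto simp: norm_of_nat_powr_le simp del: of_nat_Suc\<close>)

lemma gbinomial_eq_prod:
  "(x::complex) gchoose i = (\<Prod>k<i. x - of_nat k) / fact i"
  by (simp add: gbinomial_prod_rev lessThan_atLeast0)

lemma powr_rem_suminf:
  assumes "Re s + real J > 1"
  shows "summable (\<lambda>n. powr_rem J n s)"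
    and "norm (\<Sum>n. powr_rem J n s)
     \<le> norm (\<Prod>i<Suc J. 1 - s - of_nat i) * (\<Sum>n. real (Suc n) powr (- (Re s + real J)))"
proof -
  have sm: "summable (\<lambda>n. real (Suc n) powr (- (Re s + real J)))"
    using assms summable_Suc_powr_iff by simp
  let ?g = "\<lambda>n. norm (\<Prod>i<Suc J. 1 - s - of_nat i) * real (Suc n) powr (- (Re s + real J))"
  have smg: "summable ?g" by (rule summable_mult[OF sm])
  have le: "norm (powr_rem J n s) \<le> ?g n" for n
    by (rule norm_powr_rem_le) (use assms in auto)
  show "summable (\<lambda>n. powr_rem J n s)"
    by (rule summable_comparison_test'[OF smg le])
  have "norm (\<Sum>n. powr_rem J n s) \<le> (\<Sum>n. ?g n)"
    by (rule norm_suminf_le[OF le smg])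
  also have "\<dots> = norm (\<Prod>i<Suc J. 1 - s - of_nat i) * (\<Sum>n. real (Suc n) powr (- (Re s + real J)))"
    by (rule suminf_mult[OF sm])
  finally show "norm (\<Sum>n. powr_rem J n s) \<le> \<dots>" .
qed

lemma powr_rem_holomorphic: "powr_rem J n holomorphic_on A"
  unfolding powr_rem_def gbinomial_eq_prod
  by (intro holomorphic_intros) auto

lemma suminf_powr_rem_holomorphic:
  "(\<lambda>s. \<Sum>n. powr_rem J n s) holomorphic_on {s. Re s > 1 - real J}"
proof -
  let ?S = "{s. Re s > 1 - real J}"
  have op: "open ?S" by (rule open_halfspace_Re_gt)
  have 1: "powr_rem J n field_differentiable at x" for n x
    using powr_rem_holomorphic[of J n UNIV] by (simp add: holomorphic_on_def)
  obtain g where g: "\<forall>x\<in>?S. (\<lambda>n. powr_rem J n x) sums g x \<and> g field_differentiable at x"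
  proof (rule series_differentiable_comparison_complex[OF op 1])
    fix x assume x: "x \<in> ?S"
    \<comment> \<open>Half the distance from x to the boundary line: on the ball of radius d about x
      the exponent satisfies Re y + J >= 1 + d, which gives one summable majorant.\<close>
    define d where "d = (Re x - (1 - real J)) / 2"
    have d: "d > 0" using x by (simp add: d_def)
    have "compact ((\<lambda>s. norm (\<Prod>i<Suc J. 1 - s - of_nat i)) ` cball x d)"
      by (intro compact_continuous_image continuous_intros) auto
    then obtain C where C: "\<And>y. y \<in> cball x d \<Longrightarrow> norm (\<Prod>i<Suc J. 1 - y - of_nat i) \<le> C"
      by (meson bounded_imp_bdd_above bdd_above.unfold compact_imp_bounded image_eqI)
    have C0: "C \<ge> 0" using C[of x] d by (meson centre_in_cball less_imp_le norm_ge_zero order_trans)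
    let ?h = "\<lambda>n. complex_of_real (C * real (Suc n) powr (- (1 + d)))"
    have "summable (\<lambda>n. C * real (Suc n) powr (- (1 + d)))"
      by (rule summable_mult) (use d summable_Suc_powr_iff in simp)
    hence "summable ?h" by (rule summable_of_real)
    moreover have "range ?h \<subseteq> \<real>\<^sub>\<ge>\<^sub>0" using C0 by auto
    moreover have "cmod (powr_rem J n y) \<le> cmod (?h n)" if y: "y \<in> ball x d \<inter> ?S" for n y
    proof -
      have "\<bar>Re (x - y)\<bar> < d" using y abs_Re_le_cmod[of "x - y"] by (simp add: dist_norm)
      moreover have "Re x + real J = 1 + 2 * d" by (simp add: d_def field_simps)
      ultimately have yr: "Re y + real J \<ge> 1 + d" by simp
      have "cmod (powr_rem J n y) \<le> norm (\<Prod>i<Suc J. 1 - y - of_nat i) * real (Suc n) powr (- (Re y + real J))"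
        by (rule norm_powr_rem_le) (use yr d in auto)
      also have "\<dots> \<le> C * real (Suc n) powr (- (1 + d))"
        by (intro mult_mono C powr_mono) (use y yr d C0 in auto)
      also have "\<dots> = cmod (?h n)" using C0 by (simp add: norm_mult del: of_real_mult)
      finally show ?thesis .
    qed
    ultimately show "\<exists>d h. 0 < d \<and> summable h \<and> range h \<subseteq> \<real>\<^sub>\<ge>\<^sub>0 \<and>
         (\<forall>\<^sub>F n in sequentially. \<forall>y\<in>ball x d \<inter> ?S. cmod (powr_rem J n y) \<le> cmod (h n))"
      using d by (intro exI[of _ d] exI[of _ ?h]) auto
  qed
  have "(\<Sum>n. powr_rem J n x) = g x" if "x \<in> ?S" for x
    using g that by (metis sums_unique)
  moreover have "g holomorphic_on ?S"
    using g by (auto simp: holomorphic_on_def intro: field_differentiable_at_within)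
  ultimately show ?thesis by (subst holomorphic_cong[OF refl]) auto
qed

definition zeta_series :: "complex \<Rightarrow> complex" where
  "zeta_series s = (\<Sum>n. of_nat (Suc n) powr (- s))"

lemma zeta_series_sums: "Re s > 1 \<Longrightarrow> (\<lambda>n. of_nat (Suc n) powr (- s)) sums zeta_series s"
  unfolding zeta_series_def by (rule summable_sums, rule summable_Suc_cpowr) simp

lemma zeta_series_alt: "zeta_series s = (\<Sum>n. inverse (of_nat (Suc n) powr s))"
  by (simp add: zeta_series_def powr_minus)

text \<open>The binomial coefficient \<open>(1 - s) gchoose i\<close> with its last factor 1 - s -
  (i - 1) = -(s + i - 2) taken out. That factor cancels the pole of zeta(s + i - 1), so the
  recurrence involves only the pole-free products (w - 1) zeta(w).\<close>

definition recurrence_coeff :: "nat \<Rightarrow> complex \<Rightarrow> complex" where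
  "recurrence_coeff i s = - (\<Prod>k<i - 1. 1 - s - of_nat k) / fact i"

text \<open>Sum \<open>powr_rem J n s\<close> over n. The leading difference telescopes to -1, the
  term i = 1 yields (1 - s) zeta(s), and the terms i >= 2 yield zeta at points shifted to the right
  by i - 1. Solving for the term i = 1 gives the formula.\<close>

lemma zeta_series_recurrence:
  assumes s: "Re s > 1" and J: "J \<ge> 1"
  shows "(s - 1) * zeta_series s = 1 + (\<Sum>i=2..J. recurrence_coeff i s * ((s + of_nat i - 2) * zeta_series (s + of_nat i - 1)))
            + (\<Sum>n. powr_rem J n s)"
proof -
  have "(\<lambda>n. of_nat (Suc n) powr (1 - s) :: complex) \<longlonglongrightarrow> 0"
  proof (rule tendsto_norm_zero_cancel)
    have "(\<lambda>n. real (Suc n) powr (1 - Re s)) \<longlonglongrightarrow> 0"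
      using s by real_asymp
    thus "(\<lambda>n. norm (of_nat (Suc n) powr (1 - s) :: complex)) \<longlonglongrightarrow> 0"
      by (subst norm_of_nat_powr_le) auto
  qed
  hence 1: "(\<lambda>n. of_nat (Suc (Suc n)) powr (1 - s) - of_nat (Suc n) powr (1 - s) :: complex) sums (-1)"
    using telescope_sums[of "\<lambda>n. of_nat (Suc n) powr (1 - s) :: complex" 0] by simp
  have 2: "(\<lambda>n. ((1 - s) gchoose i) * of_nat (Suc n) powr (1 - s - of_nat i)) sums
      (((1 - s) gchoose i) * zeta_series (s + of_nat i - 1))" if "i \<ge> 1" for i
    using sums_mult[OF zeta_series_sums[of "s + of_nat i - 1"]] s that
    by (simp add: algebra_simps)
  have eq: "powr_rem J n s = (of_nat (Suc (Suc n)) powr (1 - s) - of_nat (Suc n) powr (1 - s))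
     - (\<Sum>i=1..J. ((1 - s) gchoose i) * of_nat (Suc n) powr (1 - s - of_nat i))" for n
  proof -
    have "{..J} = insert 0 {1..J}" by auto
    thus ?thesis unfolding powr_rem_def by (simp add: algebra_simps)
  qed
  have "(\<lambda>n. powr_rem J n s) sums (-1 - (\<Sum>i=1..J. ((1 - s) gchoose i) * zeta_series (s + of_nat i - 1)))"
    unfolding eq by (intro sums_diff 1 sums_sum 2) auto
  hence "(\<Sum>n. powr_rem J n s) = -1 - (\<Sum>i=1..J. ((1 - s) gchoose i) * zeta_series (s + of_nat i - 1))"
    by (rule sums_unique[symmetric])
  also have "{1..J} = insert 1 {2..J}" using J by auto
  also have "(\<Sum>i\<in>insert 1 {2..J}. ((1 - s) gchoose i) * zeta_series (s + of_nat i - 1))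
     = (1 - s) * zeta_series s + (\<Sum>i=2..J. ((1 - s) gchoose i) * zeta_series (s + of_nat i - 1))"
    by (subst sum.insert) auto
  also have "(\<Sum>i=2..J. ((1 - s) gchoose i) * zeta_series (s + of_nat i - 1))
    = (\<Sum>i=2..J. recurrence_coeff i s * ((s + of_nat i - 2) * zeta_series (s + of_nat i - 1)))"
  proof (rule sum.cong[OF refl])
    fix i assume i: "i \<in> {2..J}"
    then obtain k where k: "i = Suc (Suc k)" by (metis Suc_le_D atLeastAtMost_iff numeral_2_eq_2 Suc_le_mono)
    show "((1 - s) gchoose i) * zeta_series (s + of_nat i - 1) = recurrence_coeff i s * ((s + of_nat i - 2) * zeta_series (s + of_nat i - 1))"
      unfolding gbinomial_eq_prod recurrence_coeff_def k by (simp add: field_simps)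
  qed
  finally show ?thesis by (simp add: algebra_simps)
qed

text \<open>At order J + 2 the recurrence uses only values at least one unit to the right of s,
  where the induction hypothesis applies, and a remainder series that converges for Re s > -(J + 1).
  Each step gains a strip of width 1.\<close>

lemma zeta_series_continuation_step:
  "\<exists>E. E holomorphic_on {s. Re s > - real J} \<and> (\<forall>s. Re s > 1 \<longrightarrow> E s = (s - 1) * zeta_series s)"
proof (induction J)
  case 0
  let ?E = "\<lambda>s. 1 + (\<Sum>n. powr_rem 1 n s)"
  have "?E holomorphic_on {s. Re s > - real 0}"
    using suminf_powr_rem_holomorphic[of 1] by (intro holomorphic_intros) auto
  moreover have "?E s = (s - 1) * zeta_series s" if "Re s > 1" for s
    using zeta_series_recurrence[of s 1] that by simp
  ultimately show ?case by blast
next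
  case (Suc J)
  then obtain F where F: "F holomorphic_on {s. Re s > - real J}"
    "\<And>s. Re s > 1 \<Longrightarrow> F s = (s - 1) * zeta_series s" by blast
  let ?E = "\<lambda>s. 1 + (\<Sum>i=2..J+2. recurrence_coeff i s * F (s + of_nat i - 1)) + (\<Sum>n. powr_rem (J+2) n s)"
  have "(F \<circ> (\<lambda>s. s + of_nat i - 1)) holomorphic_on {s. Re s > - real (Suc J)}" if "i \<ge> 2" for i
    by (rule holomorphic_on_compose_gen[OF _ F(1)]) (use that in \<open>auto intro!: holomorphic_intros\<close>)
  hence "?E holomorphic_on {s. Re s > - real (Suc J)}"
    using suminf_powr_rem_holomorphic[of "J+2"] unfolding recurrence_coeff_def
    by (intro holomorphic_intros) (auto simp: o_def)
  moreover have "?E s = (s - 1) * zeta_series s" if s: "Re s > 1" for s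
  proof -
    have "(\<Sum>i=2..J+2. recurrence_coeff i s * F (s + of_nat i - 1))
       = (\<Sum>i=2..J+2. recurrence_coeff i s * ((s + of_nat i - 2) * zeta_series (s + of_nat i - 1)))"
      by (rule sum.cong[OF refl], subst F(2)) (use s in auto)
    thus ?thesis using zeta_series_recurrence[of s "J+2"] s by simp
  qed
  ultimately show ?case by blast
qed

lemma zeta_series_continuation:
  obtains F where "F holomorphic_on UNIV" "\<And>s. Re s > 1 \<Longrightarrow> F s = (s - 1) * zeta_series s"
proof -
  obtain E where E: "\<And>J. E J holomorphic_on {s. Re s > - real J}"
    "\<And>J s. Re s > 1 \<Longrightarrow> E J s = (s - 1) * zeta_series s"
    using zeta_series_continuation_step by metis
  have eq: "E J s = E K s" if "J \<le> K" "Re s > - real J" for J K s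
  proof (rule analytic_continuation_open[of "{s. Re s > 1}" "{s. Re s > - real J}" "E J" "E K"])
    show "open {s. 1 < Re s}" "open {s. - real J < Re s}" by (rule open_halfspace_Re_gt)+
    show "connected {s. - real J < Re s}" by (intro convex_connected convex_halfspace_Re_gt)
    show "{s. 1 < Re s} \<noteq> {}" by (auto intro: exI[of _ 2])
    show "E K holomorphic_on {s. - real J < Re s}"
      by (rule holomorphic_on_subset[OF E(1)]) (use that in auto)
  qed (use E that in auto)
  \<comment> \<open>Any index whose half-plane contains s would do, since the continuations agree;
    this one always does.\<close>
  define F where "F = (\<lambda>s. E (nat \<lceil>\<bar>Re s\<bar>\<rceil> + 1) s)"
  have F: "F s = E J s" if "Re s > - real J" for s J
  proof -
    have "Re s > - real (nat \<lceil>\<bar>Re s\<bar>\<rceil> + 1)" by linarith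
    thus ?thesis unfolding F_def using eq that by (metis nat_le_linear)
  qed
  have "F field_differentiable at s" for s
  proof -
    define J where "J = nat \<lceil>\<bar>Re s\<bar>\<rceil> + 1"
    have s: "s \<in> {s. Re s > - real J}" unfolding J_def by auto linarith
    have op: "open {s. Re s > - real J}" by (rule open_halfspace_Re_gt)
    have "F holomorphic_on {s. Re s > - real J}"
      using E(1)[of J] by (subst holomorphic_cong[OF refl F]) auto
    thus ?thesis using s op holomorphic_on_imp_differentiable_at by blast
  qed
  hence "F holomorphic_on UNIV" by (simp add: holomorphic_on_def)
  moreover have "F s = (s - 1) * zeta_series s" if "Re s > 1" for s
    using E(2) that by (simp add: F_def)
  ultimately show ?thesis using that by blast
qed

lemma zeta_holomorphic: "zeta holomorphic_on (UNIV - {1})"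
  and zeta_eq_series: "Re s > 1 \<Longrightarrow> zeta s = zeta_series s"
proof -
  obtain F where F: "F holomorphic_on UNIV" "\<And>s. Re s > 1 \<Longrightarrow> F s = (s - 1) * zeta_series s"
    using zeta_series_continuation by blast
  \<comment> \<open>A witness for the choice operator in the definition of \<open>zeta\<close>;
    without it nothing is known about the chosen function.\<close>
  have "(\<lambda>s. F s / (s - 1)) holomorphic_on UNIV - {1} \<and>
     (\<forall>s. 1 < Re s \<longrightarrow> F s / (s - 1) = (\<Sum>n. inverse (of_nat (Suc n) powr s)))"
    using F(2) by (auto intro!: holomorphic_intros holomorphic_on_subset[OF F(1)]
      simp: zeta_series_alt simp del: of_nat_Suc)
  hence "\<exists>f. f holomorphic_on UNIV - {1} \<and>
     (\<forall>s. 1 < Re s \<longrightarrow> f s = (\<Sum>n. inverse (of_nat (Suc n) powr s)))" by fast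
  from someI_ex[OF this, folded zeta_def]
  show "zeta holomorphic_on (UNIV - {1})" "Re s > 1 \<Longrightarrow> zeta s = zeta_series s"
    by (auto simp: zeta_series_alt simp del: of_nat_Suc)
qed

section \<open>The entire function (s - 1) zeta(s): symmetry, positivity, growth\<close>

definition zeta_reg :: "complex \<Rightarrow> complex" where
  "zeta_reg s = (if s = 1 then 1 else zeta s * (s - 1))"

text \<open>The recurrence of order 1, carried over to Re s > 0 by the identity theorem. It confirms
  that 1 is the right value at the removed pole, and its explicit form yields conjugation symmetry,
  positivity on the real axis and polynomial growth.\<close>

lemma zeta_reg_eq_suminf:
  assumes "Re s > 0"
  shows "zeta_reg s = 1 + (\<Sum>n. powr_rem 1 n s)"
proof (cases "s = 1")
  case True
  have "powr_rem 1 n 1 = 0" for n by (simp add: powr_rem_def del: of_nat_Suc)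
  thus ?thesis using True by (simp add: zeta_reg_def)
next
  case False
  let ?S = "{s. Re s > 0} - {1}"
  have "zeta s * (s - 1) = 1 + (\<Sum>n. powr_rem 1 n s)"
  proof (rule analytic_continuation_open[of "{s. Re s > 1}" ?S "\<lambda>s. zeta s * (s - 1)"])
    show "open {s. 1 < Re s}" by (rule open_halfspace_Re_gt)
    show "open ?S" by (intro open_delete open_halfspace_Re_gt)
    show "connected ?S"
      by (intro connected_open_delete convex_connected convex_halfspace_Re_gt open_halfspace_Re_gt) simp
    show "{s. 1 < Re s} \<noteq> {}" by (auto intro: exI[of _ 2])
    show "(\<lambda>s. zeta s * (s - 1)) holomorphic_on ?S"
      by (intro holomorphic_intros holomorphic_on_subset[OF zeta_holomorphic]) auto
    show "(\<lambda>s. 1 + (\<Sum>n. powr_rem 1 n s)) holomorphic_on ?S"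
      by (intro holomorphic_intros holomorphic_on_subset[OF suminf_powr_rem_holomorphic]) auto
    show "zeta z * (z - 1) = 1 + (\<Sum>n. powr_rem 1 n z)" if "z \<in> {s. 1 < Re s}" for z
      using zeta_series_recurrence[of z 1] zeta_eq_series[of z] that by (simp add: mult.commute)
  qed (use False assms in auto)
  thus ?thesis using False by (simp add: zeta_reg_def)
qed

lemma zeta_reg_holomorphic: "zeta_reg holomorphic_on A"
proof -
  have op: "open {s. Re s > 0}" "open (UNIV - {1::complex})"
    by (simp_all add: open_halfspace_Re_gt open_delete)
  have "zeta_reg holomorphic_on {s. Re s > 0}"
    using suminf_powr_rem_holomorphic[of 1]
    by (subst holomorphic_cong[OF refl zeta_reg_eq_suminf]) (auto intro!: holomorphic_intros)
  moreover have "zeta_reg holomorphic_on (UNIV - {1})"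
    by (rule holomorphic_transform[of "\<lambda>s. zeta s * (s - 1)"])
       (auto simp: zeta_reg_def intro!: holomorphic_intros zeta_holomorphic)
  ultimately have "zeta_reg holomorphic_on ({s. Re s > 0} \<union> (UNIV - {1}))"
    using op by (rule holomorphic_on_Un)
  moreover have "{s. Re s > 0} \<union> (UNIV - {1}) = (UNIV :: complex set)" by auto
  ultimately show ?thesis by (metis holomorphic_on_subset top_greatest)
qed

lemma zeta_reg_continuous [continuous_intros]:
  "continuous_on A f \<Longrightarrow> continuous_on A (\<lambda>x. zeta_reg (f x))"
  by (rule continuous_on_compose2[OF holomorphic_on_imp_continuous_on[OF zeta_reg_holomorphic[of UNIV]]]) auto

lemma zeta_reg_cnj:
  assumes "Re s > 0"
  shows "zeta_reg (cnj s) = cnj (zeta_reg s)"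
proof -
  have 1: "cnj (of_nat (Suc n) powr z) = of_nat (Suc n) powr cnj z" for n z
    by (subst cnj_powr) (auto simp: complex_nonpos_Reals_iff)
  have "powr_rem 1 n (cnj s) = cnj (powr_rem 1 n s)" for n
    by (simp add: powr_rem_def 1 del: of_nat_Suc)
  moreover have "cnj (\<Sum>n. powr_rem 1 n s) = (\<Sum>n. cnj (powr_rem 1 n s))"
    using powr_rem_suminf(1)[of s 1] assms by (simp add: bounded_linear.suminf[OF bounded_linear_cnj])
  ultimately show ?thesis
    using assms by (simp add: zeta_reg_eq_suminf)
qed

lemma powr_rem_1:
  "powr_rem (Suc 0) n s = of_nat (Suc (Suc n)) powr (1 - s) - of_nat (Suc n) powr (1 - s)
     - (1 - s) * of_nat (Suc n) powr (- s)"
  by (simp add: powr_rem_def)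

text \<open>For x > 1 the Dirichlet series is positive. For x <= 1 the value is 1 plus the sum of
  \<open>d n\<close>; the mean value theorem bounds \<open>d n\<close> from below by a telescoping
  term, and these terms add up to -(1 - x). What is left is at least x > 0.\<close>

lemma zeta_reg_real_pos:
  assumes "x > 0"
  obtains y where "y > 0" "zeta_reg (of_real x) = of_real y"
proof (cases "x > 1")
  case True
  have 1: "of_nat (Suc n) powr (- complex_of_real x) = of_real (real (Suc n) powr (- x))" for n
    by (subst powr_of_real[symmetric]) auto
  have sm: "summable (\<lambda>n. real (Suc n) powr (- x))"
    using True summable_Suc_powr_iff by simp
  have "zeta (of_real x) = of_real (\<Sum>n. real (Suc n) powr (- x))"
    using True by (subst zeta_eq_series) (simp_all add: zeta_series_def 1 suminf_of_real[OF sm] del: of_nat_Suc)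
  hence "zeta_reg (of_real x) = of_real ((\<Sum>n. real (Suc n) powr (- x)) * (x - 1))"
    using True by (simp add: zeta_reg_def)
  moreover have "(\<Sum>n. real (Suc n) powr (- x)) > 0"
    by (rule suminf_pos[OF sm]) auto
  ultimately show ?thesis using True that by (metis diff_gt_0_iff_gt mult_pos_pos)
next
  case False
  define d where "d = (\<lambda>n. real (Suc (Suc n)) powr (1 - x) - real (Suc n) powr (1 - x) - (1 - x) * real (Suc n) powr (- x))"
  have d: "powr_rem 1 n (of_real x) = of_real (d n)" for n
  proof -
    have "of_nat m powr (of_real z) = complex_of_real (real m powr z)" for m z
      by (subst powr_of_real[symmetric]) auto
    note this[of _ "1 - x", simplified] this[of _ "- x", simplified]
    thus ?thesis by (simp add: powr_rem_1 d_def del: of_nat_Suc)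
  qed
  have sd: "summable d"
    using powr_rem_suminf(1)[of "of_real x" 1] assms by (simp only: d summable_complex_of_real) simp
  have tel: "(\<lambda>n. (1 - x) * (real (Suc (Suc n)) powr (- x) - real (Suc n) powr (- x))) sums ((1 - x) * (0 - real (Suc 0) powr (- x)))"
  proof (rule sums_mult, rule telescope_sums)
    show "(\<lambda>n. real (Suc n) powr (- x)) \<longlonglongrightarrow> 0" using assms by real_asymp
  qed
  have le: "(1 - x) * (real (Suc (Suc n)) powr (- x) - real (Suc n) powr (- x)) \<le> d n" for n
  proof -
    have "\<exists>z>real (Suc n). z < real (Suc (Suc n)) \<and>
      real (Suc (Suc n)) powr (1 - x) - real (Suc n) powr (1 - x) = (real (Suc (Suc n)) - real (Suc n)) * ((1 - x) * z powr (1 - x - 1))"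
      by (rule MVT2) (auto intro!: derivative_eq_intros)
    then obtain z where z: "real (Suc n) < z" "z < real (Suc (Suc n))"
      "real (Suc (Suc n)) powr (1 - x) - real (Suc n) powr (1 - x) = (real (Suc (Suc n)) - real (Suc n)) * ((1 - x) * z powr (1 - x - 1))"
      by blast
    have "(1 - x) * real (Suc (Suc n)) powr (- x) \<le> (1 - x) * z powr (- x)"
      using z False assms by (intro mult_left_mono powr_mono2') auto
    thus ?thesis using z by (simp add: d_def algebra_simps)
  qed
  have "(1 - x) * (0 - real (Suc 0) powr (- x)) \<le> suminf d"
    using suminf_le[OF le sums_summable[OF tel] sd] unfolding sums_unique[OF tel, symmetric] .
  hence "1 + suminf d > 0" using assms by simp
  moreover have "zeta_reg (of_real x) = of_real (1 + suminf d)"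
    using assms by (simp only: zeta_reg_eq_suminf Re_complex_of_real d suminf_of_real[OF sd] of_real_add of_real_1)
  ultimately show ?thesis using that by blast
qed

text \<open>At order 1 the remainder carries the factor (1 - s)(-s), hence the quadratic growth. The
  abscissa 1/4 is the leftmost one reached by the discs of radius 11/4 about 3 + it on which the
  bound is applied later.\<close>

lemma norm_zeta_reg_le:
  obtains C where "C > 0" "\<And>s. Re s \<ge> 1/4 \<Longrightarrow> norm (zeta_reg s) \<le> C * (1 + norm s)\<^sup>2"
proof -
  define Z where "Z = (\<Sum>n. real (Suc n) powr (-(5/4)))"
  have sm: "summable (\<lambda>n. real (Suc n) powr (-(5/4)))" using summable_Suc_powr_iff by simp
  have Z: "Z \<ge> 0" unfolding Z_def by (rule suminf_nonneg[OF sm]) auto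
  have "norm (zeta_reg s) \<le> (1 + Z) * (1 + norm s)\<^sup>2" if s: "Re s \<ge> 1/4" for s
  proof -
    have "norm (zeta_reg s) \<le> 1 + norm (\<Sum>n. powr_rem 1 n s)"
      using s zeta_reg_eq_suminf[of s] norm_triangle_ineq[of 1 "\<Sum>n. powr_rem 1 n s"] by simp
    also have "norm (\<Sum>n. powr_rem 1 n s) \<le> norm (\<Prod>i<Suc 1. 1 - s - of_nat i) * (\<Sum>n. real (Suc n) powr (- (Re s + real 1)))"
      using s by (intro powr_rem_suminf(2)) auto
    also have "\<dots> \<le> norm (\<Prod>i<Suc 1. 1 - s - of_nat i) * Z"
      unfolding Z_def using s summable_Suc_powr_iff
      by (intro mult_left_mono suminf_le powr_mono) auto
    also have "norm (\<Prod>i<Suc 1. 1 - s - of_nat i) \<le> (1 + norm s) * (1 + norm s)"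
      using norm_triangle_ineq4[of 1 s] by (auto simp: norm_mult intro!: mult_mono)
    finally have "norm (zeta_reg s) \<le> 1 + (1 + norm s)\<^sup>2 * Z"
      using Z by (simp add: mult_right_mono power2_eq_square)
    also have "\<dots> \<le> (1 + norm s)\<^sup>2 + (1 + norm s)\<^sup>2 * Z"
      using one_le_power[of "1 + norm s" 2] by simp
    finally show ?thesis by (simp add: algebra_simps)
  qed
  thus ?thesis using that[of "1 + Z"] Z by auto
qed

text \<open>Split the exponent as (Re s - 2) + 2. The first part is largest at base 2, which gives
  the factor 4 * 2^(-Re s); the squares that remain are summed by telescoping. The decay in Re s
  drives the argument to 0 far to the right.\<close>

lemma norm_zeta_minus_1_le:
  assumes s: "Re s \<ge> 2"
  shows "norm (zeta s - 1) \<le> 4 * 2 powr (- Re s)"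
proof -
  have "(\<lambda>n. of_nat (Suc n) powr (- s)) sums zeta s"
    using zeta_series_sums[of s] s by (simp add: zeta_eq_series)
  hence 1: "(\<lambda>n. of_nat (Suc (Suc n)) powr (- s)) sums (zeta s - 1)"
    using sums_Suc_iff[of "\<lambda>n. of_nat (Suc n) powr (- s)" "zeta s - 1"] by simp
  have tel: "(\<lambda>n. 4 * 2 powr (- Re s) * (inverse (real (Suc n)) - inverse (real (Suc (Suc n))))) sums (4 * 2 powr (- Re s) * (inverse (real (Suc 0)) - 0))"
    by (rule sums_mult, rule telescope_sums', rule LIMSEQ_inverse_real_of_nat)
  have le: "norm (of_nat (Suc (Suc n)) powr (- s) :: complex) \<le> 4 * 2 powr (- Re s) * (inverse (real (Suc n)) - inverse (real (Suc (Suc n))))" for n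
  proof -
    have "norm (of_nat (Suc (Suc n)) powr (- s) :: complex) = real (Suc (Suc n)) powr (- (Re s - 2)) * real (Suc (Suc n)) powr (-2)"
      by (subst norm_of_nat_powr_le) (auto simp: powr_add[symmetric])
    also have "\<dots> \<le> 2 powr (- (Re s - 2)) * real (Suc (Suc n)) powr (-2)"
      using s by (intro mult_right_mono powr_mono2') auto
    also have "2 powr (- (Re s - 2)) = 4 * 2 powr (- Re s)"
      by (simp add: powr_diff powr_minus field_simps)
    also have "real (Suc (Suc n)) powr (-2) \<le> inverse (real (Suc n)) - inverse (real (Suc (Suc n)))"
      by (auto simp: powr_minus field_simps power2_eq_square intro!: frac_le add_pos_nonneg)
    finally show ?thesis by (simp add: mult_left_mono)
  qed
  have "norm (\<Sum>n. of_nat (Suc (Suc n)) powr (- s) :: complex) \<le> (\<Sum>n. 4 * 2 powr (- Re s) * (inverse (real (Suc n)) - inverse (real (Suc (Suc n)))))"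
    by (rule norm_suminf_le[OF le]) (use tel in \<open>simp add: sums_iff\<close>)
  thus ?thesis using 1 tel by (simp add: sums_iff)
qed

section \<open>Nonvanishing to the right of 1\<close>

definition rough :: "nat set \<Rightarrow> nat set" where
  "rough P = {n. n \<ge> 1 \<and> (\<forall>p\<in>P. \<not> p dvd n)}"

lemma zeta_series_has_sum:
  assumes s: "Re s > 1"
  shows "(\<lambda>n. norm (of_nat n powr (- s) :: complex)) summable_on {1..}"
    and "((\<lambda>n. of_nat n powr (- s)) has_sum zeta_series s) {1..}"
proof -
  have sm: "summable (\<lambda>n. norm (of_nat (Suc n) powr (- s) :: complex))"
    using summable_Suc_powr_iff[of "- Re s"] s by (subst norm_of_nat_powr_le) auto
  have bij: "bij_betw Suc UNIV {1..}"
    by (rule bij_betw_byWitness[where f' = "\<lambda>n. n - 1"]) auto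
  have "(\<lambda>n. norm (of_nat (Suc n) powr (- s) :: complex)) summable_on UNIV"
    using sm by (subst summable_on_UNIV_nonneg_real_iff) auto
  thus "(\<lambda>n. norm (of_nat n powr (- s) :: complex)) summable_on {1..}"
    using summable_on_reindex_bij_betw[OF bij, of "\<lambda>n. norm (of_nat n powr (- s) :: complex)"] by simp
  have "((\<lambda>n. of_nat (Suc n) powr (- s)) has_sum zeta_series s) UNIV"
    by (rule norm_summable_imp_has_sum[OF sm zeta_series_sums[OF s]])
  thus "((\<lambda>n. of_nat n powr (- s)) has_sum zeta_series s) {1..}"
    using has_sum_reindex_bij_betw[OF bij, of "\<lambda>n. of_nat n powr (- s)"] by simp
qed

text \<open>Sieving by one more prime multiplies the sum by a factor, so if the full sum vanishes,
  so does every sieved one.\<close>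
lemma rough_sum_zero:
  assumes s: "Re s > 1" and z: "zeta_series s = 0" and P: "finite P" "\<And>p. p \<in> P \<Longrightarrow> prime p"
  shows "((\<lambda>n. of_nat n powr (- s)) has_sum 0) (rough P)"
  using P
proof (induction P rule: finite_induct)
  case empty
  have "rough {} = {1..}" by (auto simp: rough_def)
  thus ?case using zeta_series_has_sum(2)[OF s] z by simp
next
  case (insert q P)
  have q: "prime q" "q > 0" using insert.prems by (auto simp: prime_gt_0_nat)
  have IH: "((\<lambda>n. of_nat n powr (- s)) has_sum 0) (rough P)" using insert by auto
  have inj: "inj_on ((*) q) (rough P)" using q by (auto simp: inj_on_def)
  have "((\<lambda>n. of_nat q powr (- s) * of_nat n powr (- s)) has_sum (of_nat q powr (- s) * 0)) (rough P)"
    by (rule has_sum_cmult_right[OF IH])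
  moreover have "of_nat (q * n) powr (- s) = of_nat q powr (- s) * of_nat n powr (- s)" for n
    unfolding of_nat_mult by (rule powr_times_real) auto
  ultimately have "((\<lambda>n. of_nat n powr (- s)) \<circ> (*) q has_sum 0) (rough P)"
    by (simp add: o_def del: of_nat_mult)
  hence q_sum: "((\<lambda>n. of_nat n powr (- s)) has_sum 0) ((*) q ` rough P)"
    by (simp add: has_sum_reindex[OF inj])
  have sub: "(*) q ` rough P \<subseteq> rough P"
  proof
    fix m assume "m \<in> (*) q ` rough P"
    then obtain n where n: "n \<in> rough P" "m = q * n" by auto
    have "\<not> p dvd m" if "p \<in> P" for p
    proof
      assume "p dvd m"
      moreover have "prime p" "p \<noteq> q" using insert that by auto
      moreover have "\<not> p dvd q" using \<open>prime p\<close> \<open>p \<noteq> q\<close> q(1) primes_dvd_imp_eq by blast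
      ultimately show False using n that by (auto simp: prime_dvd_mult_iff rough_def)
    qed
    thus "m \<in> rough P" using n q by (auto simp: rough_def)
  qed
  \<comment> \<open>The survivors divisible by q are exactly the multiples by q of survivors, and
    their sum has just been shown to vanish.\<close>
  have "rough (insert q P) = rough P - (*) q ` rough P"
  proof (intro equalityI subsetI)
    fix n assume "n \<in> rough P - (*) q ` rough P"
    moreover have "n \<in> (*) q ` rough P" if "n \<in> rough P" "q dvd n"
    proof -
      obtain k where k: "n = q * k" using \<open>q dvd n\<close> by blast
      have "k \<in> rough P" using that k by (auto simp: rough_def)
      thus ?thesis using k by auto
    qed
    ultimately show "n \<in> rough (insert q P)" by (auto simp: rough_def)
  qed (auto simp: rough_def)
  thus ?case using has_sum_Diff[OF IH q_sum sub] by simp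
qed

text \<open>If zeta vanished at s, the sum over the integers without prime factor up to N would be 0
  as well. These integers are 1 and numbers beyond N, and for large N the tail is smaller than 1/2
  in modulus, so it cannot cancel the term 1.\<close>

lemma zeta_nonzero_Re_gt_1:
  assumes s: "Re s > 1"
  shows "zeta s \<noteq> 0"
proof
  assume "zeta s = 0"
  hence z: "zeta_series s = 0" using zeta_eq_series[OF s] by simp
  let ?f = "\<lambda>n. of_nat n powr (- s) :: complex"
  note abs = zeta_series_has_sum(1)[OF s]
    have "((\<lambda>G. \<Sum>n\<in>G. norm (?f n)) \<longlongrightarrow> (\<Sum>\<^sub>\<infinity>n\<in>{1..}. norm (?f n))) (finite_subsets_at_top {1..})"
      using has_sum_infsum[OF abs] unfolding has_sum_def .
    hence "\<forall>\<^sub>F G in finite_subsets_at_top {1..}. dist (\<Sum>n\<in>G. norm (?f n)) (\<Sum>\<^sub>\<infinity>n\<in>{1..}. norm (?f n)) < 1/2"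
      by (rule tendstoD) simp
    hence "\<exists>F. finite F \<and> F \<subseteq> {1..} \<and> (\<forall>G. finite G \<and> F \<subseteq> G \<and> G \<subseteq> {1..} \<longrightarrow> dist (\<Sum>n\<in>G. norm (?f n)) (\<Sum>\<^sub>\<infinity>n\<in>{1..}. norm (?f n)) < 1/2)"
      unfolding eventually_finite_subsets_at_top .
    then obtain F where F: "finite F \<and> F \<subseteq> {1..} \<and> (\<forall>G. finite G \<and> F \<subseteq> G \<and> G \<subseteq> {1..} \<longrightarrow> dist (\<Sum>n\<in>G. norm (?f n)) (\<Sum>\<^sub>\<infinity>n\<in>{1..}. norm (?f n)) < 1/2)"
    by (rule exE)
  \<comment> \<open>With F contained in {1..N}, the partial sum up to N is within 1/2 of the full
    sum of moduli. Inserting 1 gives the maximum a non-empty set and N >= 1.\<close>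
  define N where "N = Max (insert 1 F)"
  have N: "N \<ge> 1" "F \<subseteq> {1..N}" using F by (auto simp: N_def)
  define P where "P = {p. prime p \<and> p \<le> N}"
  have P: "finite P" by (rule finite_subset[of _ "{..N}"]) (auto simp: P_def)
  define R where "R = rough P - {1}"
  have one: "1 \<in> rough P" by (auto simp: rough_def P_def)
  have R: "R \<subseteq> {N<..}"
  proof
    fix n assume n: "n \<in> R"
    then obtain p where p: "prime p" "p dvd n" using prime_factor_nat[of n] by (auto simp: R_def)
    have "n \<ge> 1" "p \<notin> P" using n p by (auto simp: R_def rough_def)
    thus "n \<in> {N<..}" using p dvd_imp_le[of p n] by (auto simp: P_def)
  qed
  have "(?f has_sum 0) (rough P)"
    by (rule rough_sum_zero[OF s z P]) (auto simp: P_def)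
  hence "(?f has_sum (0 - 1)) R"
    unfolding R_def by (rule has_sum_Diff) (use one has_sum_finite[of "{1}" ?f] in auto)
  hence "infsum ?f R = -1" by (simp add: infsumI)
  moreover have "norm (infsum ?f R) \<le> infsum (\<lambda>n. norm (?f n)) R"
    by (rule norm_infsum_bound) (rule summable_on_subset_banach[OF abs], use R in force)
  moreover have "infsum (\<lambda>n. norm (?f n)) R \<le> infsum (\<lambda>n. norm (?f n)) {N<..}"
    by (rule infsum_mono_neutral)
       (use R N in \<open>auto intro!: summable_on_subset_banach[OF abs]\<close>)
  moreover have "infsum (\<lambda>n. norm (?f n)) {N<..} = infsum (\<lambda>n. norm (?f n)) {1..} - infsum (\<lambda>n. norm (?f n)) {1..N}"
  proof -
    have eq: "{N<..} = {1..} - {1..N}" using N by auto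
    show ?thesis unfolding eq by (rule infsum_Diff[OF abs]) auto
  qed
  moreover have "dist (\<Sum>n\<in>{1..N}. norm (?f n)) (\<Sum>\<^sub>\<infinity>n\<in>{1..}. norm (?f n)) < 1/2"
    using F N by auto
  ultimately show False by (auto simp: dist_real_def)
qed

section \<open>Zeros and logarithms of holomorphic functions\<close>

text \<open>The list records zeros with multiplicity. The finitely many zeros in K are removed one
  point at a time, each with its full order, which keeps the cofactor non-zero at all points treated
  so far.\<close>

lemma factor_out_zeros:
  fixes f :: "complex \<Rightarrow> complex"
  assumes f: "f holomorphic_on S" "open S" "connected S" and K: "compact K" "K \<subseteq> S"
    and nc: "\<exists>z\<in>S. f z \<noteq> 0"
  obtains zs h where "set zs \<subseteq> K" "\<And>\<rho>. \<rho> \<in> set zs \<longleftrightarrow> \<rho> \<in> K \<and> f \<rho> = 0"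
    "h holomorphic_on S" "\<And>z. z \<in> S \<Longrightarrow> f z = h z * (\<Prod>\<rho>\<leftarrow>zs. z - \<rho>)" "\<And>z. z \<in> K \<Longrightarrow> h z \<noteq> 0"
proof (cases "f constant_on S")
  case True
  then obtain c where c: "\<And>z. z \<in> S \<Longrightarrow> f z = c" by (auto simp: constant_on_def)
  with nc have "c \<noteq> 0" by auto
  thus ?thesis using c K f(1) by (intro that[of "[]" f]) auto
next
  case nconst: False
  define Z where "Z = {z\<in>K. f z = 0}"
  have finZ: "finite Z"
    unfolding Z_def by (rule holomorphic_compact_finite_zeros[OF f K nconst])
  have "\<exists>zs h. set zs = A \<and> h holomorphic_on S \<and> (\<forall>z\<in>S. f z = h z * (\<Prod>\<rho>\<leftarrow>zs. z - \<rho>)) \<and> (\<forall>z\<in>A. h z \<noteq> 0)" if "finite A" "A \<subseteq> Z" for A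
    using that
  proof (induction A rule: finite_induct)
    case empty
    show ?case by (rule exI[of _ "[]"], rule exI[of _ f]) (use f in auto)
  next
    case (insert w A)
    then obtain zs h where h: "set zs = A" "h holomorphic_on S"
      "\<And>z. z \<in> S \<Longrightarrow> f z = h z * (\<Prod>\<rho>\<leftarrow>zs. z - \<rho>)" "\<And>z. z \<in> A \<Longrightarrow> h z \<noteq> 0" by auto
    have w: "w \<in> S" "f w = 0" using insert.prems K by (auto simp: Z_def)
    have "(\<Prod>\<rho>\<leftarrow>zs. w - \<rho>) \<noteq> 0" using insert.hyps h(1) by (auto simp: prod_list_zero_iff)
    hence hw: "h w = 0" using h(3)[OF w(1)] w(2) by simp
    have nch: "\<not> h constant_on S"
    proof
      assume "h constant_on S"
      hence "h z = 0" if "z \<in> S" for z using hw w(1) that by (metis constant_on_def)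
      thus False using nc h(3) by auto
    qed
    obtain n r g where g: "0 < n" "0 < r" "ball w r \<subseteq> S" "g holomorphic_on ball w r"
      "\<And>z. z \<in> ball w r \<Longrightarrow> h z = (z - w) ^ n * g z" "\<And>z. z \<in> ball w r \<Longrightarrow> g z \<noteq> 0"
      by (rule holomorphic_factor_zero_nonconstant[OF h(2) f(2,3) w(1) hw nch]) (rule that, assumption+)
    \<comment> \<open>The quotient by (z - w)^n, with the removable singularity at w filled in by
      the local cofactor g.\<close>
    define k where "k = (\<lambda>z. if z = w then g w else h z / (z - w) ^ n)"
    have k_ball: "k z = g z" if "z \<in> ball w r" for z
      using g(5)[OF that] by (auto simp: k_def)
    have "k holomorphic_on ball w r"
      using g(4) by (subst holomorphic_cong[OF refl k_ball]) auto
    moreover have "k holomorphic_on (S - {w})"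
      by (rule holomorphic_transform[of "\<lambda>z. h z / (z - w) ^ n"])
         (auto simp: k_def intro!: holomorphic_intros holomorphic_on_subset[OF h(2)])
    ultimately have "k holomorphic_on (ball w r \<union> (S - {w}))"
      by (rule holomorphic_on_Un) (use f(2) in auto)
    moreover have "ball w r \<union> (S - {w}) = S" using g(2,3) w by auto
    ultimately have kS: "k holomorphic_on S" by simp
    have hk: "h z = k z * (z - w) ^ n" for z
      using hw g(1) by (auto simp: k_def)
    have "set (replicate n w @ zs) = insert w A" using h(1) g(1) by auto
    moreover have "f z = k z * (\<Prod>\<rho>\<leftarrow>replicate n w @ zs. z - \<rho>)" if "z \<in> S" for z
      using h(3)[OF that] hk by (simp add: prod_list_replicate)
    moreover have "k z \<noteq> 0" if "z \<in> insert w A" for z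
    proof (cases "z = w")
      case True thus ?thesis using g(2,6) by (simp add: k_def)
    next
      case False thus ?thesis using h(4)[of z] that hk[of z] by auto
    qed
    ultimately show ?case using kS by blast
  qed
  from this[OF finZ order_refl] obtain zs h where h: "set zs = Z" "h holomorphic_on S"
      "\<And>z. z \<in> S \<Longrightarrow> f z = h z * (\<Prod>\<rho>\<leftarrow>zs. z - \<rho>)" "\<And>z. z \<in> Z \<Longrightarrow> h z \<noteq> 0" by auto
  show ?thesis
  proof (rule that[of zs h])
    show "h z \<noteq> 0" if "z \<in> K" for z
      using h(3)[of z] h(4)[of z] K that by (auto simp: Z_def)
  qed (use h in \<open>auto simp: Z_def\<close>)
qed

text \<open>Re u < A means that u is closer to 0 than to 2A, so u / (2A - u) lies in the unit disc.
  The Schwarz lemma, applied to this quotient on the rescaled disc, is then solved for g z.\<close>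

lemma Borel_Caratheodory:
  assumes g: "g holomorphic_on ball 0 r" "g 0 = 0" and A: "A > 0" "\<And>z. norm z < r \<Longrightarrow> Re (g z) < A"
    and z: "norm z \<le> r1" "r1 < r"
  shows "norm (g z) \<le> 2 * A * r1 / (r - r1)"
proof -
  have r: "r > 0" "r1 \<ge> 0" using z norm_ge_zero[of z] by linarith+
  define \<phi> where "\<phi> = (\<lambda>w. g (of_real r * w) / (2 * of_real A - g (of_real r * w)))"
  have in_ball: "norm (of_real r * w) < r" if "norm w < 1" for w :: complex
    using that r by (simp add: norm_mult)
  have nz: "2 * of_real A - g (of_real r * w) \<noteq> 0" if "norm w < 1" for w
  proof
    assume "2 * of_real A - g (of_real r * w) = 0"
    hence "g (of_real r * w) = of_real (2 * A)" by (simp add: algebra_simps)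
    hence "Re (g (of_real r * w)) = 2 * A" by (simp only: Re_complex_of_real)
    thus False using A(2)[OF in_ball[OF that]] A(1) by simp
  qed
  have "(g \<circ> (\<lambda>w. of_real r * w)) holomorphic_on ball 0 1"
    by (rule holomorphic_on_compose_gen[OF _ g(1)]) (use in_ball in \<open>auto intro!: holomorphic_intros\<close>)
  hence hol: "\<phi> holomorphic_on ball 0 1"
    unfolding \<phi>_def using nz by (intro holomorphic_intros) (auto simp: o_def)
  have lt: "norm (\<phi> w) < 1" if w: "norm w < 1" for w
  proof -
    define u where "u = g (of_real r * w)"
    have "Re u < A" using A(2)[OF in_ball[OF w]] by (simp add: u_def)
    have "(norm u)\<^sup>2 < (norm (2 * of_real A - u))\<^sup>2"
    proof -
      have "(norm (2 * of_real A - u))\<^sup>2 = (norm u)\<^sup>2 + 4 * A * (A - Re u)"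
        unfolding cmod_power2 by (simp add: power2_eq_square algebra_simps)
      thus ?thesis using A(1) \<open>Re u < A\<close> by simp
    qed
    hence "norm u < norm (2 * of_real A - u)" by (rule power2_less_imp_less) simp
    thus ?thesis using nz[OF w] unfolding \<phi>_def u_def by (simp add: norm_divide divide_less_eq)
  qed
  define w where "w = z / of_real r"
  have w: "norm w \<le> r1 / r" "norm w < 1" "of_real r * w = z"
    using z r by (auto simp: w_def norm_divide divide_right_mono)
  have "norm (\<phi> w) \<le> norm w"
    by (rule Schwarz_Lemma(1)[OF hol _ lt w(2)]) (use g in \<open>simp_all add: \<phi>_def\<close>)
  hence 1: "norm (\<phi> w) \<le> r1 / r" using w by simp
  have "g z = \<phi> w * (2 * of_real A - g z)" using nz[OF w(2)] w(3) by (simp add: \<phi>_def)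
  hence "norm (g z) = norm (\<phi> w) * norm (2 * of_real A - g z)" by (metis norm_mult)
  also have "\<dots> \<le> (r1 / r) * (2 * A + norm (g z))"
    using 1 A norm_triangle_ineq4[of "2 * of_real A" "g z"] r by (intro mult_mono) (auto simp: norm_mult)
  finally show ?thesis using r z by (simp add: field_simps)
qed

text \<open>The difference takes values in the multiples of 2 pi i, which are 2 pi apart, and is
  therefore constant. This is the device that identifies logarithms of different origin: principal
  branches, sums of cut logarithms, and the branch chosen in the definition of the argument.\<close>

lemma continuous_log_unique:
  fixes g h :: "'a::topological_space \<Rightarrow> complex"
  assumes S: "connected S" and g: "continuous_on S g" and h: "continuous_on S h"
    and eq: "\<And>x. x \<in> S \<Longrightarrow> exp (g x) = exp (h x)"
    and xy: "x \<in> S" "y \<in> S"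
  shows "g x - h x = g y - h y"
proof -
  have "(\<lambda>x. g x - h x) constant_on S"
  proof (rule continuous_discrete_range_constant[OF S])
    show "continuous_on S (\<lambda>x. g x - h x)" by (intro continuous_intros g h)
    fix x assume x: "x \<in> S"
    have "2 * pi \<le> norm ((g y - h y) - (g x - h x))" if y: "y \<in> S" and ne: "g y - h y \<noteq> g x - h x" for y
    proof -
      have "exp ((g y - h y) - (g x - h x)) = 1" using eq[OF x] eq[OF y] by (simp add: exp_diff)
      then obtain n :: int where n: "Re ((g y - h y) - (g x - h x)) = 0" "Im ((g y - h y) - (g x - h x)) = of_int (2 * n) * pi"
        by (auto simp: exp_eq_1)
      have "n \<noteq> 0" using n ne by (auto simp: complex_eq_iff)
      hence "1 \<le> \<bar>real_of_int n\<bar>" by linarith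
      hence "2 * pi \<le> \<bar>of_int (2 * n) * pi\<bar>" by (simp add: abs_mult)
      also have "\<dots> \<le> norm ((g y - h y) - (g x - h x))" using abs_Im_le_cmod n(2) by metis
      finally show ?thesis .
    qed
    thus "\<exists>e>0. \<forall>y. y \<in> S \<and> g y - h y \<noteq> g x - h x \<longrightarrow> e \<le> norm ((g y - h y) - (g x - h x))"
      by (intro exI[of _ "2 * pi"]) auto
  qed
  thus ?thesis using xy by (auto simp: constant_on_def)
qed

lemma norm_prod_list_map: "norm (\<Prod>x\<leftarrow>xs. f x :: complex) = (\<Prod>x\<leftarrow>xs. norm (f x))"
  by (induction xs) (auto simp: norm_mult)

lemma norm_prod_list_le_power:
  assumes "\<And>x. x \<in> set xs \<Longrightarrow> norm (f x :: complex) \<le> c" "c \<ge> 0"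
  shows "norm (\<Prod>x\<leftarrow>xs. f x) \<le> c ^ length xs"
  using assms by (induction xs) (auto simp: norm_mult intro!: mult_mono)

lemma prod_list_mult_distrib:
  "(\<Prod>x\<leftarrow>xs. f x * g x) = (\<Prod>x\<leftarrow>xs. f x) * (\<Prod>x\<leftarrow>xs. g x :: 'a::comm_monoid_mult)"
  by (induction xs) (auto simp: ac_simps)

lemma exp_sum_list: "exp (\<Sum>x\<leftarrow>xs. f x :: complex) = (\<Prod>x\<leftarrow>xs. exp (f x))"
  by (induction xs) (auto simp: exp_add)

lemma abs_sum_list_le:
  assumes "\<And>x. x \<in> set xs \<Longrightarrow> \<bar>f x :: real\<bar> \<le> g x"
  shows "\<bar>\<Sum>x\<leftarrow>xs. f x\<bar> \<le> (\<Sum>x\<leftarrow>xs. g x)"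
  using assms by (induction xs) (auto intro: order_trans[OF abs_triangle_ineq] add_mono)

lemma continuous_on_sum_list:
  fixes f :: "'a \<Rightarrow> 'b::topological_space \<Rightarrow> 'c::topological_monoid_add"
  assumes "\<And>x. x \<in> set xs \<Longrightarrow> continuous_on S (f x)"
  shows "continuous_on S (\<lambda>y. \<Sum>x\<leftarrow>xs. f x y)"
  using assms by (induction xs) (auto intro!: continuous_intros)

lemma holomorphic_on_prod_list:
  assumes "\<And>x. x \<in> set xs \<Longrightarrow> f x holomorphic_on S"
  shows "(\<lambda>y. \<Prod>x\<leftarrow>xs. f x y) holomorphic_on S"
  using assms by (induction xs) (auto intro!: holomorphic_intros)

text \<open>Near 0, apply ln y <= y - 1 to y = x^(-1/2). This trades the logarithm for a power that
  is still integrable.\<close>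

lemma abs_ln_le:
  fixes x :: real
  assumes "x > 0"
  shows "\<bar>ln x\<bar> \<le> x + 2 * x powr (-1/2)"
proof (cases "x \<ge> 1")
  case True
  thus ?thesis using ln_le_minus_one[of x] by (auto simp: intro: add_increasing2)
next
  case False
  have "- ln x = 2 * ln (x powr (-1/2))" using assms by (simp add: ln_powr)
  also have "\<dots> \<le> 2 * (x powr (-1/2) - 1)" using assms by (intro mult_left_mono ln_le_minus_one) auto
  finally show ?thesis using assms False by auto
qed

text \<open>One majorant for both kinds of singularity: logarithms at zeros, and the product of a
  vanishing logarithm with the weight at the branch point.\<close>

abbreviation isq :: "real \<Rightarrow> real" where
  "isq x \<equiv> \<bar>x\<bar> powr (-1/2)"

text \<open>The singular part is measured by Re z alone, so one function of the abscissa dominates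
  it at all heights at once.\<close>

lemma abs_ln_norm_le:
  assumes "Re z \<noteq> 0"
  shows "\<bar>ln (norm z)\<bar> \<le> norm z + 2 * isq (Re z)"
proof -
  have "norm z powr (-1/2) \<le> isq (Re z)"
    using assms abs_Re_le_cmod[of z] by (intro powr_mono2') auto
  moreover have "\<bar>ln (norm z)\<bar> \<le> norm z + 2 * norm z powr (-1/2)"
    using assms by (intro abs_ln_le) auto
  ultimately show ?thesis by simp
qed

text \<open>Within distance 1 of c the integral is at most 2 + 2, and elsewhere the integrand is at
  most 1. The bound does not involve c, so the position of a zero never matters.\<close>

lemma abs_powr_neg_half_integrable:
  fixes u v c :: real
  assumes "u \<le> v"
  shows "set_integrable lborel {u..v} (\<lambda>x. isq (x - c))"
    and "(LBINT x:{u..v}. isq (x - c)) \<le> 4 + (v - u)"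
proof -
  let ?h = "\<lambda>x::real. indicator {0..1} x *\<^sub>R (x powr (-1/2))"
  have "((\<lambda>x. x powr (-1/2)) has_integral (1 powr (-1/2+1) / (-1/2+1))) {0..1::real}"
    by (rule has_integral_powr_from_0) auto
  hence hi: "((\<lambda>x. x powr (-1/2)) has_integral 2) {0..1::real}" by simp
  have "set_integrable lebesgue {0..1} (\<lambda>x::real. x powr (-1/2))"
    using hi by (intro nonnegative_absolutely_integrable_1) (auto simp: integrable_on_def)
  hence si: "set_integrable lborel {0..1} (\<lambda>x::real. x powr (-1/2))"
    unfolding set_integrable_def by (subst (asm) integrable_completion) auto
  have "(LBINT x:{0..1}. x powr (-1/2)) = integral {0..1} (\<lambda>x::real. x powr (-1/2))"
    by (rule set_borel_integral_eq_integral(2)[OF si])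
  hence hb: "has_bochner_integral lborel ?h 2"
    using si hi by (simp add: has_bochner_integral_iff set_integrable_def set_lebesgue_integral_def integral_unique)
  have 1: "has_bochner_integral lborel (\<lambda>x. ?h (- c + 1 * x)) 2"
    using lborel_has_bochner_integral_real_affine_iff[of 1 ?h 2 "-c"] hb by simp
  have 2: "has_bochner_integral lborel (\<lambda>x. ?h (c + (- 1) * x)) 2"
    using lborel_has_bochner_integral_real_affine_iff[of "-1" ?h 2 c] hb by simp
  have 3: "has_bochner_integral lborel (\<lambda>x. indicator {u..v} x :: real) (v - u)"
    using assms by (auto simp: has_bochner_integral_iff)
  let ?g = "\<lambda>x::real. ?h (- c + 1 * x) + ?h (c + (- 1) * x) + indicator {u..v} x"
  have g: "has_bochner_integral lborel ?g (2 + 2 + (v - u))"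
    by (intro has_bochner_integral_add 1 2 3)
  hence gi: "integrable lborel ?g" by (rule integrable.intros)
  have le: "norm (indicator {u..v} x *\<^sub>R isq (x - c)) \<le> ?g x" for x
  proof -
    have "isq (x - c) \<le> 1" if "\<bar>x - c\<bar> > 1"
      using that powr_mono2'[of "-1/2" 1 "\<bar>x - c\<bar>"] by simp
    thus ?thesis by (cases "x \<le> c"; cases "\<bar>x - c\<bar> > 1") (auto simp: indicator_def abs_if)
  qed
  have int: "integrable lborel (\<lambda>x. indicator {u..v} x *\<^sub>R isq (x - c))"
    by (rule Bochner_Integration.integrable_bound[OF gi])
       (use le in \<open>auto intro!: AE_I2 intro: order_trans abs_ge_self\<close>)
  thus "set_integrable lborel {u..v} (\<lambda>x. isq (x - c))" by (simp add: set_integrable_def)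
  have "(LBINT x:{u..v}. isq (x - c)) \<le> integral\<^sup>L lborel ?g"
    unfolding set_lebesgue_integral_def
    by (rule integral_mono[OF int gi]) (use le in \<open>auto simp: abs_le_iff\<close>)
  also have "\<dots> = 4 + (v - u)" using has_bochner_integral_integral_eq[OF g] by simp
  finally show "(LBINT x:{u..v}. isq (x - c)) \<le> 4 + (v - u)" .
qed

text \<open>The exceptional points are the real parts of nearby zeros of \<open>exp \<circ> G\<close>.\<close>
definition log_variation_le :: "real \<Rightarrow> real \<Rightarrow> real \<Rightarrow> (real \<Rightarrow> complex) \<Rightarrow> bool" where
  "log_variation_le u v B G \<longleftrightarrow> (\<forall>x\<in>{u..v}. \<bar>Im (G x - G v)\<bar> \<le> B) \<and>
     (\<exists>bs. real (length bs) \<le> B \<and>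
       (\<forall>x\<in>{u..v} - set bs. norm (G x - G v) \<le> B + (\<Sum>\<beta>\<leftarrow>bs. 2 * isq (x - \<beta>))))"

text \<open>Multiplying by the Blaschke-type factors \<open>(R\<^sup>2 - cnj \<rho> z) / (R (z - \<rho>))\<close>, which are unimodular
  on the circle of radius \<open>R\<close>, removes the zeros without spoiling the bound \<open>M\<close>; this controls both
  the number of zeros (as in Jensen's formula) and, by Borel-Caratheodory, the zero-free part.\<close>
lemma log_variation_bound:
  assumes r: "0 < r1" "r1 < r" "r < R"
  obtains C where "C > 0" "\<And>f M G. \<lbrakk>f holomorphic_on UNIV; \<And>z. norm z \<le> R \<Longrightarrow> norm (f z) \<le> M;
      \<And>x. -r1 \<le> x \<Longrightarrow> x \<le> R \<Longrightarrow> f (of_real x) \<noteq> 0;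
      continuous_on {-r1..0} G; \<And>x. x \<in> {-r1..0} \<Longrightarrow> exp (G x) = f (of_real x)\<rbrakk> \<Longrightarrow>
      log_variation_le (-r1) 0 (C * (ln (M / norm (f 0)) + 1)) G"
proof -
  \<comment> \<open>Bounds the logarithm of |q w x|, as q will satisfy R - r^2/R <= |q w x| <=
    2R.\<close>
  define Cq where "Cq = 2 * R + 2 * (R - r\<^sup>2 / R) powr (-1/2)"
  define C1 where "C1 = 2 * r1 / (r - r1)"
  define C2 where "C2 = 1 / ln (R / r)"
  define C where "C = 2 * C1 + 1 + (8 * pi + 2 * R + Cq) * C2 + C2"
  have R: "R > 0" "R / r > 1" using r by auto
  have "r * r < R * R" using r by (intro mult_strict_mono) auto
  hence rR: "R - r\<^sup>2 / R > 0" using R by (simp add: power2_eq_square field_simps)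
  have pos: "Cq > 0" "C1 > 0" "C2 > 0" using r R rR by (auto simp: Cq_def C1_def C2_def add_pos_nonneg)
  have C: "C > 0" unfolding C_def using pos R pi_gt_zero by (intro add_pos_pos mult_pos_pos) auto
  show ?thesis
  proof (rule that[OF C])
    fix f :: "complex \<Rightarrow> complex" and M :: real and G :: "real \<Rightarrow> complex"
    assume f: "f holomorphic_on UNIV" and M: "\<And>z. norm z \<le> R \<Longrightarrow> norm (f z) \<le> M"
      and nz: "\<And>x. -r1 \<le> x \<Longrightarrow> x \<le> R \<Longrightarrow> f (of_real x) \<noteq> 0"
      and G: "continuous_on {-r1..0} G" "\<And>x. x \<in> {-r1..0} \<Longrightarrow> exp (G x) = f (of_real x)"
    have f0: "f 0 \<noteq> 0" using nz[of 0] r by simp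
    \<comment> \<open>The summand 1 keeps A positive and makes the inequality Re g < A strict, as
      Borel-Caratheodory demands.\<close>
    define A where "A = ln (M / norm (f 0)) + 1"
    have Mf: "norm (f 0) \<le> M" using M[of 0] R by simp
    hence M0: "M > 0" using f0 by (metis less_le_trans zero_less_norm_iff)
    have A: "A \<ge> 1" using Mf f0 by (simp add: A_def)
    obtain zs h where h: "\<And>w. w \<in> set zs \<longleftrightarrow> w \<in> cball 0 r \<and> f w = 0"
      "h holomorphic_on UNIV" "\<And>z. f z = h z * (\<Prod>w\<leftarrow>zs. z - w)" "\<And>z. z \<in> cball 0 r \<Longrightarrow> h z \<noteq> 0"
      by (rule factor_out_zeros[of f UNIV "cball 0 r"]) (use f f0 in auto)
    define q where "q = (\<lambda>w z. (of_real (R\<^sup>2) - cnj w * z) / of_real R)"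
    define B where "B = (\<lambda>z. h z * (\<Prod>w\<leftarrow>zs. q w z))"
    define n where "n = length zs"
    have qRe: "Re (q w z) \<ge> R - r\<^sup>2 / R" if "norm w \<le> r" "norm z \<le> r" for w z
    proof -
      have "Re (cnj w * z) \<le> norm (cnj w * z)" by (rule complex_Re_le_cmod)
      also have "\<dots> \<le> r * r" using that r by (simp add: norm_mult mult_mono)
      finally have "R\<^sup>2 - r\<^sup>2 \<le> Re (of_real (R\<^sup>2) - cnj w * z)" by (simp add: power2_eq_square)
      hence "(R\<^sup>2 - r\<^sup>2) / R \<le> Re (of_real (R\<^sup>2) - cnj w * z) / R" using R by (intro divide_right_mono) auto
      thus ?thesis using R by (simp add: q_def diff_divide_distrib power2_eq_square)
    qed
    have Bhol: "B holomorphic_on UNIV"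
      unfolding B_def q_def using R by (intro holomorphic_intros holomorphic_on_prod_list h(2)) auto
    have Ble: "norm (B z) \<le> M" if "norm z \<le> R" for z
    proof (rule maximum_modulus_frontier[of B "cball 0 R"])
      show "B holomorphic_on interior (cball 0 R)" using Bhol by (rule holomorphic_on_subset) auto
      show "continuous_on (closure (cball 0 R)) B"
        using Bhol by (meson holomorphic_on_imp_continuous_on holomorphic_on_subset top_greatest)
      show "norm (B z) \<le> M" if "z \<in> frontier (cball 0 R)" for z
      proof -
        have z: "norm z = R" using that R by (simp add: frontier_def)
        have "norm (q w z) = norm (z - w)" for w
        proof -
          have "of_real (R\<^sup>2) - cnj w * z = z * cnj (z - w)"
            using complex_norm_square[of z] z by (simp add: algebra_simps)
          hence "norm (of_real (R\<^sup>2) - cnj w * z) = R * norm (z - w)"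
            using z by (metis complex_mod_cnj norm_mult)
          thus ?thesis using R by (simp add: q_def norm_divide)
        qed
        hence "norm (B z) = norm (f z)"
          by (simp add: B_def h(3) norm_mult norm_prod_list_map)
        thus ?thesis using M[of z] z by simp
      qed
    qed (use that in auto)
    have "norm (B 0) = norm (h 0) * R ^ n"
    proof -
      have "q w 0 = of_real R" for w using R by (simp add: q_def power2_eq_square)
      thus ?thesis using R by (simp add: B_def norm_mult norm_power n_def map_replicate_const)
    qed
    moreover have "norm (f 0) \<le> norm (h 0) * r ^ n"
    proof -
      have "norm (\<Prod>w\<leftarrow>zs. 0 - w) \<le> r ^ n" unfolding n_def
        by (rule norm_prod_list_le_power) (use h(1) r in auto)
      thus ?thesis unfolding h(3)[of 0] norm_mult by (rule mult_left_mono) auto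
    qed
    \<comment> \<open>Every zero in the disc of radius r raises |B 0| over |f 0| by a factor of at
      least R / r, while |B 0| stays below M. This limits the number n of zeros.\<close>
    ultimately have B0: "norm (f 0) * (R / r) ^ n \<le> norm (B 0)"
      using r R by (simp add: power_divide field_simps)
    hence B0f: "norm (f 0) \<le> norm (B 0)"
      using one_le_power[of "R / r" n] R mult_left_mono[of 1 "(R / r) ^ n" "norm (f 0)"] by simp
    have "(R / r) ^ n \<le> M / norm (f 0)"
      using B0 Ble[of 0] R f0 by (simp add: field_simps)
    hence "ln ((R / r) ^ n) \<le> ln (M / norm (f 0))"
      using R f0 M0 by (subst ln_le_cancel_iff) (auto intro!: divide_pos_pos)
    hence "real n * ln (R / r) \<le> A" using R by (simp add: ln_realpow A_def)
    hence nA: "real n \<le> C2 * A" using R by (simp add: C2_def field_simps)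
    have Bnz: "B z \<noteq> 0" if "norm z \<le> r" for z
    proof -
      have "q w z \<noteq> 0" if "w \<in> set zs" for w
        using qRe[of w z] h(1)[of w] that \<open>norm z \<le> r\<close> rR by auto
      thus ?thesis using h(4)[of z] that by (auto simp: B_def prod_list_zero_iff)
    qed
    have "B holomorphic_on ball 0 r" using Bhol by (rule holomorphic_on_subset) auto
    moreover have "contractible (ball (0::complex) r)" by (intro convex_imp_contractible convex_ball)
    moreover have "B z \<noteq> 0" if "z \<in> ball 0 r" for z using Bnz[of z] that by simp
    ultimately obtain Lb where Lb: "Lb holomorphic_on ball 0 r" "\<And>z. z \<in> ball 0 r \<Longrightarrow> B z = exp (Lb z)"
      using contractible_imp_holomorphic_log by metis
    define g where "g = (\<lambda>z. Lb z - Lb 0)"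
    have Lbn: "Re (Lb z) = ln (norm (B z))" if "norm z < r" for z
      using Lb(2)[of z] that by simp
    have g_le: "norm (g z) \<le> C1 * A" if "norm z \<le> r1" for z
    proof -
      have "norm (g z) \<le> 2 * A * r1 / (r - r1)"
      proof (rule Borel_Caratheodory[OF _ _ _ _ that r(2)])
        show "g holomorphic_on ball 0 r" unfolding g_def by (intro holomorphic_intros Lb)
        show "Re (g z) < A" if z: "norm z < r" for z
        proof -
          have "ln (norm (B z)) \<le> ln M" using Ble[of z] z r Bnz[of z] M0 by (subst ln_le_cancel_iff) auto
          moreover have "ln (norm (f 0)) \<le> ln (norm (B 0))" using B0f f0 Bnz[of 0] r by (subst ln_le_cancel_iff) auto
          ultimately show ?thesis using Lbn[OF z] Lbn[of 0] r f0 M0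
            by (simp add: g_def A_def ln_div)
        qed
      qed (use A in \<open>auto simp: g_def\<close>)
      thus ?thesis by (simp add: C1_def mult.commute mult.left_commute)
    qed
    \<comment> \<open>An explicit logarithm of f on the segment, read off from f = B * prod (z - w)
      / q w z. Principal branches are continuous here: x - w meets the negative axis or 0 only for a
      real zero w >= x, which is excluded, and q w has positive real part.\<close>
    define H where "H = (\<lambda>x::real. Lb (of_real x) + (\<Sum>w\<leftarrow>zs. Ln (of_real x - w) - Ln (q w (of_real x))))"
    have nRle: "complex_of_real x - w \<notin> \<real>\<^sub>\<le>\<^sub>0" if "x \<in> {-r1..0}" "w \<in> set zs" for x w
    proof
      assume "complex_of_real x - w \<in> \<real>\<^sub>\<le>\<^sub>0"
      hence w: "w = of_real (Re w)" "x \<le> Re w" by (auto simp: complex_nonpos_Reals_iff complex_eq_iff)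
      have "Re w \<le> norm w" by (rule complex_Re_le_cmod)
      hence "Re w \<le> R" using h(1)[of w] that r by auto
      moreover have "-r1 \<le> Re w" using w that by auto
      ultimately have "f (of_real (Re w)) \<noteq> 0" by (intro nz) auto
      thus False using h(1)[of w] that w by simp
    qed
    have nqle: "q w (of_real x) \<notin> \<real>\<^sub>\<le>\<^sub>0" if "x \<in> {-r1..0}" "w \<in> set zs" for x w
      using qRe[of w "of_real x"] h(1)[of w] that rR r by (auto simp: complex_nonpos_Reals_iff)
    have contH: "continuous_on {-r1..0} H"
      unfolding H_def
    proof (intro continuous_intros continuous_on_sum_list)
      show "continuous_on {- r1..0} (\<lambda>x. Lb (complex_of_real x))"
        by (rule continuous_on_compose2[OF holomorphic_on_imp_continuous_on[OF Lb(1)]])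
           (use r in \<open>auto intro!: continuous_intros\<close>)
      show "continuous_on {- r1..0} (\<lambda>x. q w (complex_of_real x))" for w
        unfolding q_def using R by (intro continuous_intros) auto
    qed (use nRle nqle in auto)
    have expH: "exp (H x) = f (of_real x)" if x: "x \<in> {-r1..0}" for x
    proof -
      have "exp (H x) = B (of_real x) * (\<Prod>w\<leftarrow>zs. exp (Ln (of_real x - w) - Ln (q w (of_real x))))"
        using Lb(2)[of "of_real x"] x r by (simp add: H_def exp_add exp_sum_list)
      also have "map (\<lambda>w. exp (Ln (of_real x - w) - Ln (q w (of_real x)))) zs = map (\<lambda>w. (of_real x - w) / q w (of_real x)) zs"
      proof (rule map_cong[OF refl])
        fix w assume w: "w \<in> set zs"
        show "exp (Ln (of_real x - w) - Ln (q w (of_real x))) = (of_real x - w) / q w (of_real x)"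
          using nRle[OF x w] nqle[OF x w] by (subst exp_diff, subst (1 2) exp_Ln) auto
      qed
      also have "B (of_real x) * prod_list \<dots> = h (of_real x) * (\<Prod>w\<leftarrow>zs. q w (of_real x) * ((of_real x - w) / q w (of_real x)))"
        by (simp only: B_def prod_list_mult_distrib mult.assoc)
      also have "map (\<lambda>w. q w (of_real x) * ((of_real x - w) / q w (of_real x))) zs = map (\<lambda>w. of_real x - w) zs"
      proof (rule map_cong[OF refl])
        fix w assume w: "w \<in> set zs"
        have "q w (of_real x) \<noteq> 0" using nqle[OF x w] by auto
        thus "q w (of_real x) * ((of_real x - w) / q w (of_real x)) = of_real x - w" by simp
      qed
      finally show ?thesis by (simp add: h(3))
    qed
    have GH: "G x - G 0 = H x - H 0" if "x \<in> {-r1..0}" for x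
      using continuous_log_unique[of "{-r1..0}" G H x 0] G contH expH that r by (simp add: algebra_simps)
    \<comment> \<open>A principal logarithm has imaginary part at most pi, so nearby zeros affect
      the argument only through their number; no singular terms arise as they do for the real
      part.\<close>
    have Im: "\<bar>Im (G x - G 0)\<bar> \<le> C1 * A + 4 * pi * n" if x: "x \<in> {-r1..0}" for x
    proof -
      define s where "s = (\<lambda>x. \<Sum>w\<leftarrow>zs. Ln (of_real x - w) - Ln (q w (of_real x)))"
      have s: "\<bar>Im (s x)\<bar> \<le> 2 * pi * n" if x: "x \<in> {-r1..0}" for x
      proof -
        have ImLn: "\<bar>Im (Ln z)\<bar> \<le> pi" if "z \<notin> \<real>\<^sub>\<le>\<^sub>0" for z
          using Im_Ln_le_pi[of z] mpi_less_Im_Ln[of z] that by (cases "z = 0") (auto simp: abs_le_iff)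
        have "\<bar>\<Sum>w\<leftarrow>zs. Im (Ln (of_real x - w) - Ln (q w (of_real x)))\<bar> \<le> (\<Sum>w\<leftarrow>zs. 2 * pi)"
        proof (rule abs_sum_list_le)
          fix w assume w: "w \<in> set zs"
          show "\<bar>Im (Ln (of_real x - w) - Ln (q w (of_real x)))\<bar> \<le> 2 * pi"
            using ImLn[OF nRle[OF x w]] ImLn[OF nqle[OF x w]] by (simp add: abs_le_iff)
        qed
        moreover have "Im (s x) = (\<Sum>w\<leftarrow>zs. Im (Ln (of_real x - w) - Ln (q w (of_real x))))"
          unfolding s_def by (induction zs) auto
        ultimately show ?thesis by (simp add: sum_list_triv n_def mult.commute)
      qed
      have "Im (G x - G 0) = Im (g (of_real x)) + Im (s x) - Im (s 0)"
        using GH[OF x] by (simp add: H_def g_def s_def)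
      moreover have "\<bar>Im (g (of_real x))\<bar> \<le> C1 * A"
        using g_le[of "of_real x"] abs_Im_le_cmod[of "g (of_real x)"] x by auto
      ultimately show ?thesis using s[OF x] s[of 0] r by auto
    qed
    have Re: "\<bar>Re (G x - G 0)\<bar> \<le> C1 * A + A + (2 * R + Cq) * n + (\<Sum>\<beta>\<leftarrow>map Re zs. 2 * isq (x - \<beta>))"
      if x: "x \<in> {-r1..0} - set (map Re zs)" for x
    proof -
      define s where "s = (\<Sum>w\<leftarrow>zs. ln (norm (of_real x - w)) - ln (norm (q w (of_real x))))"
      have ReG: "Re (G y) = ln (norm (f (of_real y)))" if "y \<in> {-r1..0}" for y
        using G(2)[OF that] by (metis norm_exp_eq_Re ln_exp)
      have s: "\<bar>s\<bar> \<le> (\<Sum>w\<leftarrow>zs. (2 * R + Cq) + 2 * isq (x - Re w))"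
        unfolding s_def
      proof (rule abs_sum_list_le)
        fix w assume w: "w \<in> set zs"
        have nw: "norm w \<le> r" using h(1)[of w] w by auto
        have "norm (of_real x - w) \<le> norm (complex_of_real x) + norm w" by (rule norm_triangle_ineq4)
        also have "\<dots> \<le> 2 * R" using x nw r by auto
        finally have "norm (of_real x - w) \<le> 2 * R" .
        moreover have "\<bar>ln (norm (of_real x - w))\<bar> \<le> norm (of_real x - w) + 2 * isq (Re (of_real x - w))"
          by (rule abs_ln_norm_le) (use x w in auto)
        moreover have "\<bar>ln (norm (q w (of_real x)))\<bar> \<le> Cq"
        proof -
          have lo: "R - r\<^sup>2 / R \<le> norm (q w (of_real x))"
            using qRe[OF nw, of "of_real x"] complex_Re_le_cmod[of "q w (of_real x)"] x r by auto
          have "norm (of_real (R\<^sup>2) - cnj w * of_real x) \<le> norm (complex_of_real (R\<^sup>2)) + norm (cnj w * of_real x)"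
            by (rule norm_triangle_ineq4)
          also have "\<dots> = R\<^sup>2 + norm w * \<bar>x\<bar>" by (simp add: norm_mult del: of_real_power)
          also have "\<dots> \<le> R\<^sup>2 + R * R" using nw x r by (intro add_left_mono mult_mono) auto
          finally have hi: "norm (q w (of_real x)) \<le> 2 * R" using R by (simp add: q_def norm_divide power2_eq_square field_simps)
          have "\<bar>ln (norm (q w (of_real x)))\<bar> \<le> norm (q w (of_real x)) + 2 * norm (q w (of_real x)) powr (-1/2)"
            using lo rR by (intro abs_ln_le) auto
          also have "\<dots> \<le> Cq" unfolding Cq_def
            using lo hi rR by (intro add_mono mult_left_mono powr_mono2') auto
          finally show ?thesis .
        qed
        ultimately show "\<bar>ln (norm (of_real x - w)) - ln (norm (q w (of_real x)))\<bar> \<le> (2 * R + Cq) + 2 * isq (x - Re w)"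
          by simp
      qed
      have "ln (norm (f (of_real x))) = ln (norm (B (of_real x))) + s"
      proof -
        have "Re (H x) = ln (norm (B (of_real x))) + s"
        proof -
          have "Re (\<Sum>w\<leftarrow>zs. Ln (of_real x - w) - Ln (q w (of_real x))) = (\<Sum>w\<leftarrow>zs. Re (Ln (of_real x - w) - Ln (q w (of_real x))))"
            by (induction zs) auto
          also have "\<dots> = s" unfolding s_def
          proof (intro arg_cong[where f = sum_list] map_cong refl)
            fix w assume w: "w \<in> set zs"
            have "of_real x - w \<noteq> 0" "q w (of_real x) \<noteq> 0" using nRle[of x w] nqle[of x w] x w by auto
            thus "Re (Ln (of_real x - w) - Ln (q w (of_real x))) = ln (norm (of_real x - w)) - ln (norm (q w (of_real x)))"
              by simp
          qed
          finally show ?thesis using Lbn[of "of_real x"] x r by (simp add: H_def)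
        qed
        thus ?thesis using expH[of x] x by (metis DiffD1 norm_exp_eq_Re ln_exp)
      qed
      hence "Re (G x - G 0) = Re (g (of_real x)) + (ln (norm (B 0)) - ln (norm (f 0))) + s"
        using ReG[of x] ReG[of 0] x r Lbn[of "of_real x"] Lbn[of 0] by (simp add: g_def)
      moreover have "\<bar>Re (g (of_real x))\<bar> \<le> C1 * A"
        using g_le[of "of_real x"] abs_Re_le_cmod[of "g (of_real x)"] x by auto
      moreover have "0 \<le> ln (norm (B 0)) - ln (norm (f 0))"
        using B0f f0 Bnz[of 0] r by (simp add: ln_le_cancel_iff)
      moreover have "ln (norm (B 0)) - ln (norm (f 0)) \<le> A"
        using Ble[of 0] R f0 Bnz[of 0] r M0 by (simp add: A_def ln_div ln_le_cancel_iff add_increasing2)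
      moreover have "(\<Sum>w\<leftarrow>zs. (2 * R + Cq) + 2 * isq (x - Re w)) = (2 * R + Cq) * n + (\<Sum>\<beta>\<leftarrow>map Re zs. 2 * isq (x - \<beta>))"
        by (simp add: sum_list_addf sum_list_triv n_def o_def algebra_simps)
      ultimately show ?thesis using s by linarith
    qed
    have nC: "k * real n \<le> k * (C2 * A)" if "k \<ge> 0" for k :: real using nA that by (rule mult_left_mono)
    have CA: "C * A = 2 * (C1 * A) + A + (4 * pi * (C2 * A) + 4 * pi * (C2 * A)) + (2 * R + Cq) * (C2 * A) + C2 * A"
      by (simp add: C_def algebra_simps)
    have p: "0 \<le> C1 * A" "0 \<le> C2 * A" "0 \<le> (2 * R + Cq) * (C2 * A)" "0 \<le> 4 * pi * (C2 * A)" "4 * pi * n \<le> 4 * pi * (C2 * A)" "(2 * R + Cq) * n \<le> (2 * R + Cq) * (C2 * A)"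
      using pos A R nC[of "4 * pi"] nC[of "2 * R + Cq"] by (auto intro!: mult_nonneg_nonneg)
    have "\<bar>Im (G x - G 0)\<bar> \<le> C * A" if "x \<in> {-r1..0}" for x
      using Im[OF that] p A unfolding CA by linarith
    moreover have "norm (G x - G 0) \<le> C * A + (\<Sum>\<beta>\<leftarrow>map Re zs. 2 * isq (x - \<beta>))"
      if x: "x \<in> {-r1..0} - set (map Re zs)" for x
    proof -
      have "norm (G x - G 0) \<le> \<bar>Re (G x - G 0)\<bar> + \<bar>Im (G x - G 0)\<bar>" by (rule cmod_le)
      moreover have "\<bar>Im (G x - G 0)\<bar> \<le> C1 * A + 4 * pi * n" using Im[of x] x by blast
      ultimately show ?thesis using Re[OF x] p A unfolding CA by linarith
    qed
    moreover have "real (length (map Re zs)) \<le> C * A"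
      using nA p A unfolding CA n_def length_map by linarith
    ultimately show "log_variation_le (-r1) 0 (C * (ln (M / norm (f 0)) + 1)) G"
      unfolding log_variation_le_def A_def[symmetric] by blast
  qed
qed

section \<open>Cauchy's theorem on rectangles with cuts\<close>

text \<open>Dominated convergence for boundary values, which are known only as limits and only off a
  countable set. Measurability of f is therefore derived: after resetting everything to 0 on N the
  convergence holds everywhere.\<close>

lemma integral_limit_off_countable:
  fixes s :: "nat \<Rightarrow> real \<Rightarrow> 'a::{banach, second_countable_topology}"
  assumes N: "countable N" and s: "\<And>n. s n \<in> borel_measurable borel" and w: "integrable lborel w"
    and bound: "\<And>n x. x \<notin> N \<Longrightarrow> norm (s n x) \<le> w x" and lim: "\<And>x. x \<notin> N \<Longrightarrow> (\<lambda>n. s n x) \<longlonglongrightarrow> f x"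
  shows "integrable lborel f \<and> (\<lambda>n. integral\<^sup>L lborel (s n)) \<longlonglongrightarrow> integral\<^sup>L lborel f"
proof -
  have "(\<lambda>x. if x \<in> N then 0 else f x) \<in> borel_measurable borel"
  proof (rule borel_measurable_LIMSEQ_metric)
    show "(\<lambda>x. if x \<in> N then 0 else s n x) \<in> borel_measurable borel" for n
      by (rule measurable_discrete_difference[OF s N]) auto
    show "(\<lambda>n. if x \<in> N then 0 else s n x) \<longlonglongrightarrow> (if x \<in> N then 0 else f x)" for x
      using lim[of x] by auto
  qed
  hence f: "f \<in> borel_measurable borel"
    by (rule measurable_discrete_difference[OF _ N]) auto
  have "AE x in lborel. x \<notin> N" using countable_imp_null_set_lborel[OF N] by (rule AE_not_in)
  hence AE: "AE x in lborel. (\<lambda>n. s n x) \<longlonglongrightarrow> f x" "\<And>n. AE x in lborel. norm (s n x) \<le> w x"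
    using lim bound by (auto elim!: eventually_mono)
  show ?thesis
    by (intro conjI integrable_dominated_convergence[OF _ _ w AE] integral_dominated_convergence[OF _ _ w AE])
       (use f s in auto)
qed

text \<open>A constant velocity d covers horizontal sides (d = 1) and vertical sides (d = \<i>)
  together.\<close>

lemma LBINT_eq_primitive_diff:
  fixes \<psi> \<Psi> :: "complex \<Rightarrow> complex"
  assumes Q: "open Q" "\<And>z. z \<in> Q \<Longrightarrow> (\<Psi> has_field_derivative \<psi> z) (at z)" "continuous_on Q \<psi>"
    and le: "u \<le> v" and p: "\<And>x. x \<in> {u..v} \<Longrightarrow> p x \<in> Q" "\<And>x. (p has_vector_derivative d) (at x)"
  shows "d * (LBINT x:{u..v}. \<psi> (p x)) = \<Psi> (p v) - \<Psi> (p u)"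
proof -
  have cp: "continuous_on {u..v} p"
    using p(2) by (meson has_vector_derivative_continuous continuous_at_imp_continuous_on)
  have "(LBINT x:{u..v}. d * \<psi> (p x)) = \<Psi> (p v) - \<Psi> (p u)"
    unfolding set_lebesgue_integral_def
  proof (rule integral_FTC_atLeastAtMost[OF le])
    show "((\<lambda>x. \<Psi> (p x)) has_vector_derivative d * \<psi> (p x)) (at x within {u..v})" if "u \<le> x" "x \<le> v" for x
      using field_vector_diff_chain_at[OF p(2) Q(2)[OF p(1)], of x] that
      by (simp add: o_def has_vector_derivative_at_within)
    show "continuous_on {u..v} (\<lambda>x. d * \<psi> (p x))"
      by (intro continuous_intros continuous_on_compose2[OF Q(3) cp]) (use p in auto)
  qed
  thus ?thesis by (simp add: set_integral_mult_right)
qed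

text \<open>\<open>I\<close> and \<open>J\<close> are the coordinate intervals of a rectangle; the functions are the integrands on its
  bottom, right, top and left side.\<close>
definition rect_int :: "real set \<Rightarrow> real set \<Rightarrow> (real \<Rightarrow> complex) \<Rightarrow> (real \<Rightarrow> complex) \<Rightarrow>
    (real \<Rightarrow> complex) \<Rightarrow> (real \<Rightarrow> complex) \<Rightarrow> complex \<Rightarrow> bool" where
  "rect_int I J p r q l v \<longleftrightarrow>
     set_integrable lborel I p \<and> set_integrable lborel I q \<and> set_integrable lborel J l \<and> set_integrable lborel J r \<and>
     (LBINT x:I. p x) + \<i> * (LBINT t:J. r t) - (LBINT x:I. q x) - \<i> * (LBINT t:J. l t) = v"

lemma rect_intD:
  assumes "rect_int I J p r q l v"
  shows "set_integrable lborel I p" "set_integrable lborel I q" "set_integrable lborel J l" "set_integrable lborel J r"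
    "(LBINT x:I. p x) + \<i> * (LBINT t:J. r t) - (LBINT x:I. q x) - \<i> * (LBINT t:J. l t) = v"
  using assms unfolding rect_int_def by blast+

text \<open>Cauchy's theorem for a rectangle whose horizontal sides may carry boundary values that
  differ from the function itself, e.g. along a branch cut.\<close>
lemma strip_integral:
  fixes \<psi> :: "complex \<Rightarrow> complex" and \<psi>a \<psi>c :: "real \<Rightarrow> complex"
  assumes x01: "x0 \<le> x1" and ac: "a < c"
    and Q: "open Q" "convex Q" "\<psi> holomorphic_on Q" "\<And>x t. x \<in> {x0..x1} \<Longrightarrow> t \<in> {a<..<c} \<Longrightarrow> Complex x t \<in> Q"
    and N: "countable N" and D: "set_integrable lborel {x0..x1} D"
       "\<And>x t. x \<in> {x0..x1} - N \<Longrightarrow> t \<in> {a<..<c} \<Longrightarrow> norm (\<psi> (Complex x t)) \<le> D x"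
    and lima: "\<And>x. x \<in> {x0..x1} - N \<Longrightarrow> ((\<lambda>t. \<psi> (Complex x t)) \<longlongrightarrow> \<psi>a x) (at_right a)"
    and limc: "\<And>x. x \<in> {x0..x1} - N \<Longrightarrow> ((\<lambda>t. \<psi> (Complex x t)) \<longlongrightarrow> \<psi>c x) (at_left c)"
    and V: "set_integrable lborel {a<..<c} V"
       "\<And>x t. x \<in> {x0, x1} \<Longrightarrow> t \<in> {a<..<c} \<Longrightarrow> norm (\<psi> (Complex x t)) \<le> V t"
  shows "rect_int {x0..x1} {a<..<c} \<psi>a (\<lambda>t. \<psi> (Complex x1 t)) \<psi>c (\<lambda>t. \<psi> (Complex x0 t)) 0"
proof -
  \<comment> \<open>On the convex set Q a primitive exists, so for inner rectangles Cauchy's theorem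
    is the cancellation of its values at the corners. The boundary values enter only in the
    limit.\<close>
  have "\<exists>\<Psi>. \<forall>z\<in>Q. (\<Psi> has_field_derivative \<psi> z) (at z)"
    by (rule holomorphic_convex_primitive'[OF Q(2,1,3)])
       (rule exI, rule ballI, simp add: at_within_open[OF _ Q(1)])
  then obtain \<Psi> where \<Psi>: "\<And>z. z \<in> Q \<Longrightarrow> (\<Psi> has_field_derivative \<psi> z) (at z)"
    by (elim exE) (rule that, rule bspec)
  have cont: "continuous_on Q \<psi>" using Q(3) by (rule holomorphic_on_imp_continuous_on)
  \<comment> \<open>The inner rectangles stay at distance \<open>e n\<close> from bottom and top.
    The summand 3 guarantees \<open>s n \<le> t n\<close> already for n = 0.\<close>
  define e where "e = (\<lambda>n::nat. (c - a) / (real n + 3))"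
  define s where "s = (\<lambda>n. a + e n)"
  define t where "t = (\<lambda>n. c - e n)"
  have frac: "0 < e n" "3 * e n \<le> c - a" for n
    using ac by (auto simp: e_def field_simps intro: mult_right_mono)
  have st: "a < s n" "s n \<le> t n" "t n < c" "s n < c" "a < t n" for n
    unfolding s_def t_def by (use frac[of n] ac in linarith)+
  have "e \<longlonglongrightarrow> 0" unfolding e_def by real_asymp
  hence sl: "s \<longlonglongrightarrow> a" and tl: "t \<longlonglongrightarrow> c" unfolding s_def t_def by (auto intro!: tendsto_eq_intros)
  have sl': "filterlim s (at_right a) sequentially"
    using sl st by (intro tendsto_imp_filterlim_at_right) auto
  have tl': "filterlim t (at_left c) sequentially"
    using tl st by (intro tendsto_imp_filterlim_at_left) auto
  have hor: "continuous_on {x0..x1} (\<lambda>x. \<psi> (Complex x y))" if "y \<in> {a<..<c}" for y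
    by (rule continuous_on_compose2[OF cont]) (use Q(4) that in \<open>auto intro!: continuous_intros\<close>)
  have hor_int: "1 * (LBINT x:{x0..x1}. \<psi> (Complex x y)) = \<Psi> (Complex x1 y) - \<Psi> (Complex x0 y)" if "y \<in> {a<..<c}" for y
    by (rule LBINT_eq_primitive_diff[OF Q(1) \<Psi> cont x01])
       (use Q(4) that in \<open>auto simp: Complex_eq intro!: derivative_eq_intros\<close>)
  have ver_int: "\<i> * (LBINT y:{s n..t n}. \<psi> (Complex x y)) = \<Psi> (Complex x (t n)) - \<Psi> (Complex x (s n))" if "x \<in> {x0..x1}" for x n
    by (rule LBINT_eq_primitive_diff[OF Q(1) \<Psi> cont st(2)])
       (use Q(4) that st[of n] in \<open>auto simp: Complex_eq intro!: derivative_eq_intros\<close>)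
  have hor_lim: "set_integrable lborel {x0..x1} \<psi>' \<and>
     (\<lambda>n. LBINT x:{x0..x1}. \<psi> (Complex x (r n))) \<longlonglongrightarrow> (LBINT x:{x0..x1}. \<psi>' x)"
    if r: "filterlim r F sequentially" "\<And>n. r n \<in> {a<..<c}" and lim: "\<And>x. x \<in> {x0..x1} - N \<Longrightarrow> ((\<lambda>t. \<psi> (Complex x t)) \<longlongrightarrow> \<psi>' x) F"
    for r \<psi>' F
    unfolding set_integrable_def set_lebesgue_integral_def
  proof (intro integral_limit_off_countable[OF N _ D(1)[unfolded set_integrable_def]])
    show "(\<lambda>x. indicator {x0..x1} x *\<^sub>R \<psi> (Complex x (r n))) \<in> borel_measurable borel" for n
      by (rule borel_measurable_continuous_on_indicator) (use hor r in auto)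
    show "norm (indicator {x0..x1} x *\<^sub>R \<psi> (Complex x (r n))) \<le> indicator {x0..x1} x *\<^sub>R D x" if "x \<notin> N" for x n
      using D(2)[of x "r n"] r(2)[of n] that by (auto simp: indicator_def)
    show "(\<lambda>n. indicator {x0..x1} x *\<^sub>R \<psi> (Complex x (r n))) \<longlonglongrightarrow> indicator {x0..x1} x *\<^sub>R \<psi>' x" if "x \<notin> N" for x
      using filterlim_compose[OF lim r(1)] that by (auto simp: indicator_def)
  qed
  have ver: "continuous_on {a<..<c} (\<lambda>t. \<psi> (Complex x t))" if "x \<in> {x0..x1}" for x
    by (rule continuous_on_compose2[OF cont]) (use Q(4) that in \<open>auto intro!: continuous_intros\<close>)
  have ver_lim: "set_integrable lborel {a<..<c} (\<lambda>t. \<psi> (Complex x t)) \<and>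
     (\<lambda>n. LBINT y:{s n..t n}. \<psi> (Complex x y)) \<longlonglongrightarrow> (LBINT y:{a<..<c}. \<psi> (Complex x y))"
    if x: "x \<in> {x0, x1}" for x
    unfolding set_integrable_def set_lebesgue_integral_def
  proof (intro integral_limit_off_countable[OF countable_empty _ V(1)[unfolded set_integrable_def]])
    show "(\<lambda>y. indicator {s n..t n} y *\<^sub>R \<psi> (Complex x y)) \<in> borel_measurable borel" for n
      by (rule borel_measurable_continuous_on_indicator)
         (use x x01 st[of n] in \<open>auto intro!: continuous_on_subset[OF ver]\<close>)
    show "norm (indicator {s n..t n} y *\<^sub>R \<psi> (Complex x y)) \<le> indicator {a<..<c} y *\<^sub>R V y" for y n
      using V(2)[OF x, of y] st[of n] order_trans[OF norm_ge_zero V(2)[OF x, of y]] by (auto simp: indicator_def)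
    show "(\<lambda>n. indicator {s n..t n} y *\<^sub>R \<psi> (Complex x y)) \<longlonglongrightarrow> indicator {a<..<c} y *\<^sub>R \<psi> (Complex x y)" for y
    proof (cases "y \<in> {a<..<c}")
      case True
      have "eventually (\<lambda>n. s n < y) sequentially" "eventually (\<lambda>n. t n > y) sequentially"
        using order_tendstoD(2)[OF sl, of y] order_tendstoD(1)[OF tl, of y] True by auto
      hence "eventually (\<lambda>n. indicator {a<..<c} y *\<^sub>R \<psi> (Complex x y) = indicator {s n..t n} y *\<^sub>R \<psi> (Complex x y)) sequentially"
        by eventually_elim (use True in \<open>auto simp: indicator_def\<close>)
      thus ?thesis by (rule Lim_transform_eventually[OF tendsto_const])
    next
      case False
      hence "indicator {s n..t n} y = (0::real)" for n using st[of n] by (auto simp: indicator_def)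
      thus ?thesis using False by simp
    qed
  qed
  note La = hor_lim[OF sl' _ lima] and Lc = hor_lim[OF tl' _ limc]
  have "(\<lambda>n. (LBINT x:{x0..x1}. \<psi> (Complex x (s n))) + \<i> * (LBINT y:{s n..t n}. \<psi> (Complex x1 y))
       - (LBINT x:{x0..x1}. \<psi> (Complex x (t n))) - \<i> * (LBINT y:{s n..t n}. \<psi> (Complex x0 y))) \<longlonglongrightarrow>
    (LBINT x:{x0..x1}. \<psi>a x) + \<i> * (LBINT t:{a<..<c}. \<psi> (Complex x1 t))
       - (LBINT x:{x0..x1}. \<psi>c x) - \<i> * (LBINT t:{a<..<c}. \<psi> (Complex x0 t))"
    using La Lc ver_lim[of x0] ver_lim[of x1] st by (intro tendsto_intros) auto
  moreover have "(LBINT x:{x0..x1}. \<psi> (Complex x (s n))) + \<i> * (LBINT y:{s n..t n}. \<psi> (Complex x1 y))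
       - (LBINT x:{x0..x1}. \<psi> (Complex x (t n))) - \<i> * (LBINT y:{s n..t n}. \<psi> (Complex x0 y)) = 0" for n
    using hor_int[of "s n"] hor_int[of "t n"] ver_int[of x0 n] ver_int[of x1 n] st[of n] x01 by simp
  ultimately show ?thesis
    unfolding rect_int_def using La Lc ver_lim[of x0] ver_lim[of x1] st by (auto simp: LIMSEQ_const_iff)
qed

section \<open>The weight function\<close>

text \<open>The principal branch of (b^2 - (z - a)^2)^(-3/2), with branch points a + b and a -
  b.\<close>

definition wt :: "real \<Rightarrow> real \<Rightarrow> complex \<Rightarrow> complex" where
  "wt a b z = exp (- (3/2) * Ln ((of_real b)\<^sup>2 - (z - of_real a)\<^sup>2))"

text \<open>The limit of \<open>wt\<close> on the real axis, from above; beyond the branch point \<open>a + b\<close> it is purely imaginary.\<close>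
definition wt_real :: "real \<Rightarrow> real \<Rightarrow> real \<Rightarrow> complex" where
  "wt_real a b x = (if x < a + b then of_real ((b\<^sup>2 - (x - a)\<^sup>2) powr (-3/2))
     else - \<i> * of_real (((x - a)\<^sup>2 - b\<^sup>2) powr (-3/2)))"

lemma exp_neg_three_halves_ln:
  assumes "u > 0"
  shows "exp (- (3/2) * complex_of_real (ln u)) = of_real (u powr (-3/2))"
proof -
  have "- (3/2) * complex_of_real (ln u) = of_real (- (3/2) * ln u)" by simp
  thus ?thesis using assms by (simp only: exp_of_real) (simp add: powr_def)
qed

lemma wt_base_parts:
  "Re ((of_real b)\<^sup>2 - (Complex x y - of_real a)\<^sup>2) = b\<^sup>2 - (x - a)\<^sup>2 + y\<^sup>2"
  "Im ((of_real b)\<^sup>2 - (Complex x y - of_real a)\<^sup>2) = - 2 * (x - a) * y"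
  by (simp_all add: power2_eq_square algebra_simps)

text \<open>The imaginary part -2 (x - a) y vanishes in the upper half-plane only on the line x = a,
  and there the real part is b^2 + y^2 > 0.\<close>

lemma wt_base_not_nonpos:
  assumes "Im z > 0"
  shows "(of_real b)\<^sup>2 - (z - of_real a)\<^sup>2 \<notin> \<real>\<^sub>\<le>\<^sub>0"
proof -
  obtain x y where z: "z = Complex x y" by (cases z)
  have "y\<^sup>2 > 0" using assms z by auto
  moreover have "b\<^sup>2 \<ge> 0" by simp
  ultimately have "b\<^sup>2 + y\<^sup>2 > 0" by linarith
  thus ?thesis unfolding z complex_nonpos_Reals_iff wt_base_parts using assms z by auto
qed

lemma wt_holomorphic: "wt a b holomorphic_on {z. Im z > 0}"
  unfolding wt_def by (intro holomorphic_intros) (use wt_base_not_nonpos in auto)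

lemma norm_wt:
  assumes "(of_real b)\<^sup>2 - (z - of_real a)\<^sup>2 \<noteq> (0::complex)"
  shows "norm (wt a b z) = norm (z - of_real (a + b)) powr (-3/2) * norm (z - of_real (a - b)) powr (-3/2)"
proof -
  let ?u = "(of_real b)\<^sup>2 - (z - of_real a)\<^sup>2"
  have "norm (wt a b z) = norm ?u powr (-3/2)"
    using assms by (simp add: wt_def powr_def)
  also have "?u = - ((z - of_real (a + b)) * (z - of_real (a - b)))"
    by (simp add: power2_eq_square algebra_simps)
  finally show ?thesis by (simp add: norm_mult powr_mult)
qed

lemma wt_left:
  assumes "y > 0"
  shows "wt a b (Complex a y) = of_real ((b\<^sup>2 + y\<^sup>2) powr (-3/2))"
proof -
  have "(of_real b)\<^sup>2 - (Complex a y - of_real a)\<^sup>2 = complex_of_real (b\<^sup>2 + y\<^sup>2)"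
    by (simp add: complex_eq_iff power2_eq_square)
  moreover have "b\<^sup>2 + y\<^sup>2 > 0" using assms by (intro add_nonneg_pos) auto
  ultimately show ?thesis
    unfolding wt_def by (simp only: Ln_of_real exp_neg_three_halves_ln)
qed

text \<open>The base lies in the open fourth quadrant, so its argument is in (-pi/2, 0), and
  multiplication by -3/2 moves it into (0, 3 pi/4). The condition x <= a + b keeps the real part of
  the base positive; this is where the location of zeros in Re s <= 1 enters.\<close>

lemma Im_wt_pos:
  assumes "a < x" "x \<le> a + b" "y > 0"
  shows "Im (wt a b (Complex x y)) > 0"
proof -
  define u where "u = (of_real b)\<^sup>2 - (Complex x y - of_real a)\<^sup>2"
  have "(x - a)\<^sup>2 \<le> b\<^sup>2" using assms by (intro power_mono) auto
  moreover have "y\<^sup>2 > 0" using assms by auto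
  ultimately have re: "Re u > 0" unfolding u_def wt_base_parts by linarith
  have im: "Im u < 0" unfolding u_def wt_base_parts using assms by (intro mult_neg_pos) auto
  have u0: "u \<noteq> 0" using re by auto
  have "\<bar>Im (Ln u)\<bar> < pi / 2" using Re_Ln_pos_lt[OF u0] re by simp
  moreover have "Im (Ln u) < 0" using Im_Ln_pos_le[OF u0] Im_Ln_le_pi[OF u0] im by linarith
  ultimately have "0 < sin (- (3/2) * Im (Ln u))"
    by (intro sin_gt_zero) auto
  thus ?thesis unfolding wt_def u_def[symmetric] by (simp add: Im_exp mult_pos_neg)
qed

text \<open>Below the negative axis Ln w = Ln (-w) - \<i> pi, and -w stays near the positive axis,
  where Ln is continuous.\<close>

lemma tendsto_Ln_lower:
  assumes f: "(f \<longlongrightarrow> - of_real c) F" and c: "c > 0" and im: "eventually (\<lambda>t. Im (f t) < 0) F"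
  shows "((\<lambda>t. Ln (f t)) \<longlongrightarrow> of_real (ln c) - \<i> * pi) F"
proof -
  have "((\<lambda>t. Ln (- f t) - \<i> * pi) \<longlongrightarrow> Ln (- (- of_real c)) - \<i> * pi) F"
    using c by (intro tendsto_intros f) auto
  moreover have "eventually (\<lambda>t. Ln (- f t) - \<i> * pi = Ln (f t)) F"
    using im by eventually_elim (subst Ln_minus, auto)
  ultimately have "((\<lambda>t. Ln (f t)) \<longlongrightarrow> Ln (- (- of_real c)) - \<i> * pi) F"
    by (rule Lim_transform_eventually)
  thus ?thesis using c by (simp add: Ln_of_real)
qed

lemma tendsto_Ln_upper:
  assumes f: "(f \<longlongrightarrow> - of_real c) F" and c: "c > 0" and im: "eventually (\<lambda>t. Im (f t) > 0) F"
  shows "((\<lambda>t. Ln (f t)) \<longlongrightarrow> of_real (ln c) + \<i> * pi) F"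
proof -
  have "((\<lambda>t. Ln (- f t) + \<i> * pi) \<longlongrightarrow> Ln (- (- of_real c)) + \<i> * pi) F"
    using c by (intro tendsto_intros f) auto
  moreover have "eventually (\<lambda>t. Ln (- f t) + \<i> * pi = Ln (f t)) F"
    using im by eventually_elim (subst Ln_minus, auto)
  ultimately have "((\<lambda>t. Ln (f t)) \<longlongrightarrow> Ln (- (- of_real c)) + \<i> * pi) F"
    by (rule Lim_transform_eventually)
  thus ?thesis using c by (simp add: Ln_of_real)
qed

lemma tendsto_wt_real:
  assumes b: "b > 0" and x: "x \<ge> a" "x \<noteq> a + b"
  shows "((\<lambda>t. wt a b (Complex x t)) \<longlongrightarrow> wt_real a b x) (at_right 0)"
proof -
  let ?u = "\<lambda>t. (of_real b)\<^sup>2 - (Complex x t - of_real a)\<^sup>2"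
  have "((\<lambda>t. Complex x t) \<longlongrightarrow> Complex x 0) (at_right 0)"
    by (intro tendsto_intros)
  hence lim: "(?u \<longlongrightarrow> (of_real b)\<^sup>2 - (Complex x 0 - of_real a)\<^sup>2) (at_right 0)"
    by (intro tendsto_intros)
  have eq: "(of_real b)\<^sup>2 - (Complex x 0 - of_real a)\<^sup>2 = complex_of_real (b\<^sup>2 - (x - a)\<^sup>2)"
    by (simp add: complex_eq_iff power2_eq_square)
  show ?thesis
  proof (cases "x < a + b")
    case True
    have "(x - a)\<^sup>2 < b\<^sup>2" using True x by (intro power_strict_mono) auto
    hence pos: "b\<^sup>2 - (x - a)\<^sup>2 > 0" by simp
    have "complex_of_real (b\<^sup>2 - (x - a)\<^sup>2) \<notin> \<real>\<^sub>\<le>\<^sub>0"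
      using pos by (simp only: nonpos_Reals_of_real_iff not_le)
    from tendsto_Ln[OF lim[unfolded eq] this]
    have "((\<lambda>t. wt a b (Complex x t)) \<longlongrightarrow> exp (- (3/2) * of_real (ln (b\<^sup>2 - (x - a)\<^sup>2)))) (at_right 0)"
      unfolding wt_def Ln_of_real[OF pos] by (intro tendsto_intros)
    thus ?thesis unfolding wt_real_def exp_neg_three_halves_ln[OF pos] using True by simp
  next
    case False
    have "b\<^sup>2 < (x - a)\<^sup>2" using False x b by (intro power_strict_mono) auto
    hence pos: "(x - a)\<^sup>2 - b\<^sup>2 > 0" by simp
    \<comment> \<open>Beyond the branch point the base approaches the negative axis from below, so
      its argument tends to -pi. The exponent -3/2 turns this into 3 pi/2, the origin of the factor
      -\<i>.\<close>
    have "((\<lambda>t. Ln (?u t)) \<longlongrightarrow> of_real (ln ((x - a)\<^sup>2 - b\<^sup>2)) - \<i> * pi) (at_right 0)"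
    proof (rule tendsto_Ln_lower[OF _ pos])
      show "(?u \<longlongrightarrow> - of_real ((x - a)\<^sup>2 - b\<^sup>2)) (at_right 0)" using lim unfolding eq by simp
      show "eventually (\<lambda>t. Im (?u t) < 0) (at_right 0)"
        unfolding wt_base_parts using eventually_at_right_less[of 0]
        by eventually_elim (use False b x in \<open>auto simp: mult_pos_pos mult_neg_pos\<close>)
    qed
    hence "((\<lambda>t. wt a b (Complex x t)) \<longlongrightarrow> exp (- (3/2) * (of_real (ln ((x - a)\<^sup>2 - b\<^sup>2)) - \<i> * pi))) (at_right 0)"
      unfolding wt_def by (intro tendsto_intros)
    also have "exp (- (3/2) * (of_real (ln ((x - a)\<^sup>2 - b\<^sup>2)) - \<i> * pi)) = exp (- (3/2) * of_real (ln ((x - a)\<^sup>2 - b\<^sup>2))) * exp (\<i> * of_real (3/2 * pi))"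
      by (simp add: exp_add[symmetric] algebra_simps)
    also have "exp (\<i> * of_real (3/2 * pi)) = - \<i>"
      unfolding cis_conv_exp[symmetric] unfolding complex_eq_iff cis.sel cos_3over2_pi sin_3over2_pi by simp
    finally show ?thesis unfolding wt_real_def exp_neg_three_halves_ln[OF pos] using False by (simp add: mult.commute)
  qed
qed

section \<open>Weighted integrals around a box standing on the real axis\<close>

abbreviation weighted :: "real \<Rightarrow> real \<Rightarrow> (complex \<Rightarrow> complex) \<Rightarrow> real \<Rightarrow> real \<Rightarrow> complex" where
  "weighted a b \<phi> x y \<equiv> \<phi> (Complex x y) * wt a b (Complex x y)"

text \<open>The bottom side uses \<open>wt_real\<close> instead of \<open>wt\<close>: beyond a + b
  the principal value on the axis has the opposite sign to the limit from above.\<close>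

definition box_int :: "real \<Rightarrow> real \<Rightarrow> real \<Rightarrow> real \<Rightarrow> (complex \<Rightarrow> complex) \<Rightarrow> complex \<Rightarrow> bool" where
  "box_int a b X T \<phi> v \<longleftrightarrow>
     rect_int {a..X} {0<..<T} (\<lambda>x. \<phi> (of_real x) * wt_real a b x) (\<lambda>t. weighted a b \<phi> X t)
       (\<lambda>x. weighted a b \<phi> x T) (\<lambda>t. weighted a b \<phi> a t) v"

lemma box_int_add:
  assumes "box_int a b X T \<phi> v" "box_int a b X T \<phi>' v'"
  shows "box_int a b X T (\<lambda>z. \<phi> z + \<phi>' z) (v + v')"
  using assms unfolding box_int_def rect_int_def
  by (auto simp: distrib_right set_integral_add algebra_simps)

lemma box_int_sum_list:
  assumes "\<And>\<rho>. \<rho> \<in> set zs \<Longrightarrow> box_int a b X T (\<phi> \<rho>) (v \<rho>)" "box_int a b X T \<phi>' v'"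
  shows "box_int a b X T (\<lambda>z. (\<Sum>\<rho>\<leftarrow>zs. \<phi> \<rho> z) + \<phi>' z) ((\<Sum>\<rho>\<leftarrow>zs. v \<rho>) + v')"
  using assms
proof (induction zs)
  case (Cons \<rho> zs)
  have "box_int a b X T (\<lambda>z. \<phi> \<rho> z + ((\<Sum>\<rho>\<leftarrow>zs. \<phi> \<rho> z) + \<phi>' z)) (v \<rho> + ((\<Sum>\<rho>\<leftarrow>zs. v \<rho>) + v'))"
    by (intro box_int_add Cons) (use Cons.prems in auto)
  thus ?case by (simp add: add.assoc)
qed auto

lemma set_integrable_three_bound:
  fixes u v c d :: real
  assumes "u \<le> v"
  shows "set_integrable lborel {u..v} (\<lambda>x. C * (isq (x - c) + isq (x - d) + 1))"
  by (intro set_integral_mult_right set_integrable_mult_right set_integral_add abs_powr_neg_half_integrable(1) assms)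
     (use assms in \<open>auto simp: set_integrable_def intro!: integrable_real_indicator\<close>)

text \<open>The majorants allow one singularity at the branch point p and one at the abscissa
  \<beta> of a zero, and on the vertical sides one at its height \<gamma>. The last is counted twice
  only to give both majorants the same shape.\<close>

lemma strip_integral_wt:
  assumes aX: "a \<le> X" and st: "0 \<le> s" "s < t"
    and Q: "open Q" "convex Q" "\<phi> holomorphic_on Q" "\<And>x y. x \<in> {a..X} \<Longrightarrow> y \<in> {s<..<t} \<Longrightarrow> Complex x y \<in> Q"
    and D: "\<And>x y. x \<in> {a..X} - {p, \<beta>} \<Longrightarrow> y \<in> {s<..<t} \<Longrightarrow>
      norm (weighted a b \<phi> x y) \<le> C * (isq (x - p) + isq (x - \<beta>) + 1)"
    and V: "\<And>x y. x \<in> {a, X} \<Longrightarrow> y \<in> {s<..<t} \<Longrightarrow>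
      norm (weighted a b \<phi> x y) \<le> C * (isq (y - \<gamma>) + isq (y - \<gamma>) + 1)"
    and lims: "\<And>x. x \<in> {a..X} - {p, \<beta>} \<Longrightarrow> ((\<lambda>y. weighted a b \<phi> x y) \<longlongrightarrow> \<psi>s x) (at_right s)"
    and limt: "\<And>x. x \<in> {a..X} - {p, \<beta>} \<Longrightarrow> ((\<lambda>y. weighted a b \<phi> x y) \<longlongrightarrow> \<psi>t x) (at_left t)"
  shows "rect_int {a..X} {s<..<t} \<psi>s (\<lambda>y. weighted a b \<phi> X y) \<psi>t (\<lambda>y. weighted a b \<phi> a y) 0"
proof -
  have Q': "open (Q \<inter> {z. Im z > 0})" "convex (Q \<inter> {z. Im z > 0})"
    by (intro open_Int convex_Int Q open_halfspace_Im_gt convex_halfspace_Im_gt)+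
  have hol: "(\<lambda>z. \<phi> z * wt a b z) holomorphic_on (Q \<inter> {z. Im z > 0})"
    by (intro holomorphic_intros holomorphic_on_subset[OF Q(3)] holomorphic_on_subset[OF wt_holomorphic]) auto
  have inQ: "Complex x y \<in> Q \<inter> {z. Im z > 0}" if "x \<in> {a..X}" "y \<in> {s<..<t}" for x y
    using Q(4)[OF that] that st by auto
  have N: "countable {p, \<beta>}" by simp
  have Vi: "set_integrable lborel {s<..<t} (\<lambda>y. C * (isq (y - \<gamma>) + isq (y - \<gamma>) + 1))"
    by (rule set_integrable_subset[OF set_integrable_three_bound[of s t]]) (use st in auto)
  note S = strip_integral[where \<psi> = "\<lambda>z. \<phi> z * wt a b z" and \<psi>a = \<psi>s and \<psi>c = \<psi>t
    and V = "\<lambda>y. C * (isq (y - \<gamma>) + isq (y - \<gamma>) + 1)", OF aX st(2) Q' hol inQ N set_integrable_three_bound[OF aX] D lims limt Vi V]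
  show ?thesis by (rule S; assumption)
qed

text \<open>To the right of a the other branch point a - b is at distance at least b, so only a + b
  matters.\<close>

lemma norm_wt_le:
  assumes b: "b > 0" and z: "Im z > 0" "Re z \<ge> a" and d: "d > 0" "d \<le> norm (z - of_real (a + b))"
  shows "norm (wt a b z) \<le> d powr (-3/2) * b powr (-3/2)"
proof -
  have "(of_real b)\<^sup>2 - (z - of_real a)\<^sup>2 \<noteq> (0::complex)"
    using wt_base_not_nonpos[OF z(1), of b a] by (metis nonpos_Reals_zero_I)
  moreover have "b \<le> norm (z - of_real (a - b))"
    using z b complex_Re_le_cmod[of "z - of_real (a - b)"] by simp
  ultimately show ?thesis
    using b d by (subst norm_wt) (auto intro!: mult_mono powr_mono2')
qed

text \<open>Both branch points are real, hence at distance at least Im z. This cubic decay disposes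
  of the top side.\<close>

lemma norm_wt_le_Im:
  assumes z: "Im z > 0"
  shows "norm (wt a b z) \<le> Im z powr (-3)"
proof -
  have "(of_real b)\<^sup>2 - (z - of_real a)\<^sup>2 \<noteq> (0::complex)"
    using wt_base_not_nonpos[OF z(1), of b a] by (metis nonpos_Reals_zero_I)
  moreover have "Im z \<le> norm (z - of_real c)" for c
    using abs_Im_le_cmod[of "z - of_real c"] by simp
  ultimately have "norm (wt a b z) \<le> Im z powr (-3/2) * Im z powr (-3/2)"
    using z by (subst norm_wt) (auto intro!: mult_mono powr_mono2' simp del: of_real_add of_real_diff)
  thus ?thesis by (simp add: powr_add[symmetric])
qed

text \<open>A simple zero of \<open>\<phi>\<close> at the branch point makes \<open>\<phi> wt\<close> integrable there.\<close>
lemma norm_mult_wt_le: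
  assumes b: "b > 0" and z: "Im z > 0" "Re z \<ge> a" and x: "Re z \<noteq> a + b"
    and \<phi>: "norm \<phi> \<le> C * norm (z - of_real (a + b))"
  shows "norm (\<phi> * wt a b z) \<le> C * b powr (-3/2) * isq (Re z - (a + b))"
proof -
  define d where "d = norm (z - of_real (a + b))"
  have d: "\<bar>Re z - (a + b)\<bar> \<le> d" using abs_Re_le_cmod[of "z - of_real (a + b)"] by (simp add: d_def)
  hence d0: "d > 0" using x by linarith
  have "0 \<le> C * d" using order_trans[OF norm_ge_zero \<phi>] unfolding d_def .
  hence C: "C \<ge> 0" using d0 by (simp add: zero_le_mult_iff)
  have "norm (\<phi> * wt a b z) \<le> (C * d) * (d powr (-3/2) * b powr (-3/2))"
    unfolding norm_mult using \<phi> C d0 by (intro mult_mono norm_wt_le b z) (auto simp: d_def)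
  also have "\<dots> = C * b powr (-3/2) * (d powr 1 * d powr (-3/2))" using d0 by simp
  also have "d powr 1 * d powr (-3/2) = d powr (-1/2)" by (simp only: powr_add[symmetric]) simp
  also have "\<dots> \<le> isq (Re z - (a + b))" using d x by (intro powr_mono2') auto
  finally show ?thesis using C by (simp add: mult_left_mono)
qed

lemma wt_isCont: "Im z > 0 \<Longrightarrow> isCont (wt a b) z"
  using holomorphic_on_imp_continuous_on[OF wt_holomorphic, of a b]
  by (simp add: continuous_on_eq_continuous_at open_halfspace_Im_gt)

lemma tendsto_wt_vertical: "t > 0 \<Longrightarrow> F \<le> at t \<Longrightarrow> ((\<lambda>y. wt a b (Complex x y)) \<longlongrightarrow> wt a b (Complex x t)) F"
  by (rule tendsto_mono[of F "at t"], assumption, rule isCont_tendsto_compose[OF wt_isCont]) (auto intro!: tendsto_intros)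

text \<open>The derivative of \<phi> is bounded on the compact box, so the zero at the branch point
  makes |\<phi> z| at most a multiple of the distance to it, and \<open>norm_mult_wt_le\<close>
  supplies an integrable majorant.\<close>

lemma box_int_holomorphic:
  assumes b: "b > 0" and X: "a + b < X" and T: "T > 0"
    and Q: "open Q" "convex Q" "\<phi> holomorphic_on Q" "\<And>x y. x \<in> {a..X} \<Longrightarrow> y \<in> {0..T} \<Longrightarrow> Complex x y \<in> Q"
    and \<phi>0: "\<phi> (of_real (a + b)) = 0"
  shows "box_int a b X T \<phi> 0"
proof -
  define K where "K = cbox (Complex a 0) (Complex X T)"
  have K: "z \<in> K \<longleftrightarrow> Re z \<in> {a..X} \<and> Im z \<in> {0..T}" for z
    by (auto simp: K_def in_cbox_complex_iff)
  have KQ: "K \<subseteq> Q"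
  proof
    fix z assume "z \<in> K"
    thus "z \<in> Q" using Q(4)[of "Re z" "Im z"] by (simp add: K)
  qed
  have contd: "continuous_on K (deriv \<phi>)"
    by (intro holomorphic_on_imp_continuous_on holomorphic_on_subset[OF holomorphic_deriv[OF Q(3,1)] KQ])
  have cpt: "compact K" "convex K" by (simp_all add: K_def)
  have "bounded (deriv \<phi> ` K)"
    by (intro compact_imp_bounded compact_continuous_image contd cpt)
  then obtain C where C: "C > 0" "\<forall>w\<in>deriv \<phi> ` K. norm w \<le> C"
    unfolding bounded_pos by (elim exE conjE) (rule that)
  have C2: "norm (deriv \<phi> z) \<le> C" if "z \<in> K" for z using C(2) that by simp
  have pK: "complex_of_real (a + b) \<in> K" using b X T by (simp add: K)
  have lip: "norm (\<phi> z) \<le> C * norm (z - of_real (a + b))" if "z \<in> K" for z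
  proof -
    have "norm (\<phi> z - \<phi> (of_real (a + b))) \<le> C * norm (z - of_real (a + b))"
    proof (rule field_differentiable_bound[OF cpt(2)])
      show "(\<phi> has_field_derivative deriv \<phi> w) (at w within K)" if "w \<in> K" for w
        by (rule holomorphic_derivI[OF Q(3,1)]) (use KQ that in auto)
    qed (use C2 pK that in auto)
    thus ?thesis using \<phi>0 by simp
  qed
  \<comment> \<open>The last two summands are the values of \<open>isq (x - (a + b))\<close> on the
    vertical sides x = a and x = X.\<close>
  define M where "M = C * b powr (-3/2) * (1 + b powr (-1/2) + (X - (a + b)) powr (-1/2))"
  have M: "C * b powr (-3/2) \<le> M" "C * b powr (-3/2) * b powr (-1/2) \<le> M" "C * b powr (-3/2) * (X - (a + b)) powr (-1/2) \<le> M"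
    unfolding M_def using C(1) by (auto simp: algebra_simps add_increasing)
  have Cb: "C * b powr (-3/2) \<ge> 0" using C(1) by simp
  have bnd: "norm (weighted a b \<phi> x y) \<le> C * b powr (-3/2) * isq (x - (a + b))"
    if "x \<in> {a..X}" "x \<noteq> a + b" "y \<in> {0<..<T}" for x y
    using norm_mult_wt_le[OF b, of "Complex x y" a "\<phi> (Complex x y)" C] lip[of "Complex x y"] that by (auto simp: K)
  have cont: "isCont \<phi> (Complex x y)" if "x \<in> {a..X}" "y \<in> {0..T}" for x y
    using holomorphic_on_imp_continuous_on[OF Q(3)] Q(1) Q(4)[OF that] by (simp add: continuous_on_eq_continuous_at)
  have lim\<phi>: "((\<lambda>y. \<phi> (Complex x y)) \<longlongrightarrow> \<phi> (Complex x t)) F" if "x \<in> {a..X}" "t \<in> {0..T}" "F \<le> at t" for x t F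
    by (rule tendsto_mono[OF that(3)], rule isCont_tendsto_compose[OF cont]) (use that in \<open>auto intro!: tendsto_intros\<close>)
  have pows: "0 \<le> C * b powr (-3/2) * isq (x - (a + b))" for x using Cb by simp
  \<comment> \<open>There is no zero to take care of here; 0 fills the places of \<beta> and
    \<gamma> and merely enlarges the majorants.\<close>
  note S = strip_integral_wt[of a X 0 T Q \<phi> "a + b" 0 b M 0 "\<lambda>x. \<phi> (of_real x) * wt_real a b x" "\<lambda>x. weighted a b \<phi> x T"]
  have 1: "a \<le> X" using b X by simp
  have D: "norm (weighted a b \<phi> x y) \<le> M * (isq (x - (a + b)) + isq (x - 0) + 1)"
    if x: "x \<in> {a..X} - {a + b, 0}" and y: "y \<in> {0<..<T}" for x y
  proof -
    have "norm (weighted a b \<phi> x y) \<le> C * b powr (-3/2) * isq (x - (a + b))"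
      using bnd[of x y] x y by auto
    also have "\<dots> \<le> M * isq (x - (a + b))" by (intro mult_right_mono M) auto
    also have "\<dots> \<le> M * (isq (x - (a + b)) + isq (x - 0) + 1)"
      using M(1) Cb by (intro mult_left_mono) auto
    finally show ?thesis .
  qed
  have V: "norm (weighted a b \<phi> x y) \<le> M * (isq (y - 0) + isq (y - 0) + 1)"
    if x: "x \<in> {a, X}" and y: "y \<in> {0<..<T}" for x y
  proof -
    have "norm (weighted a b \<phi> x y) \<le> C * b powr (-3/2) * isq (x - (a + b))"
      using bnd[of x y] x y b X by auto
    also have "\<dots> \<le> M * 1" using x M b X by auto
    also have "\<dots> \<le> M * (isq (y - 0) + isq (y - 0) + 1)"
      using M(1) Cb by (intro mult_left_mono) auto
    finally show ?thesis .
  qed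
  have lims: "((\<lambda>y. weighted a b \<phi> x y) \<longlongrightarrow> \<phi> (of_real x) * wt_real a b x) (at_right 0)"
    if x: "x \<in> {a..X} - {a + b, 0}" for x
    using lim\<phi>[of x 0 "at_right 0"] tendsto_wt_real[OF b, of a x] x T
    by (auto simp: complex_of_real_def at_le intro!: tendsto_mult)
  have limt: "((\<lambda>y. weighted a b \<phi> x y) \<longlongrightarrow> weighted a b \<phi> x T) (at_left T)"
    if x: "x \<in> {a..X} - {a + b, 0}" for x
    using x T by (intro tendsto_mult lim\<phi> tendsto_wt_vertical) (auto simp: at_le)
  have inQ: "Complex x y \<in> Q" if "x \<in> {a..X}" "y \<in> {0<..<T}" for x y using Q(4)[of x y] that by auto
  show ?thesis
    unfolding box_int_def by (rule S[OF 1 order_refl T Q(1-3) inQ D V lims limt]; assumption)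
qed

section \<open>The contribution of a single cut\<close>

lemma LBINT_split_at:
  fixes f :: "real \<Rightarrow> complex"
  assumes "s < m" "m < t" and f: "set_integrable lborel {s<..<m} f" "set_integrable lborel {m<..<t} f"
  shows "set_integrable lborel {s<..<t} f \<and> (LBINT x:{s<..<t}. f x) = (LBINT x:{s<..<m}. f x) + (LBINT x:{m<..<t}. f x)"
proof -
  let ?U = "{s<..<m} \<union> {m<..<t}"
  have U: "set_integrable lborel ?U f" "(LBINT x:?U. f x) = (LBINT x:{s<..<m}. f x) + (LBINT x:{m<..<t}. f x)"
    using f by (auto intro!: set_integrable_Un set_integral_Un)
  have eq: "indicator ?U x *\<^sub>R f x = indicator {s<..<t} x *\<^sub>R f x" if "x \<notin> {m}" for x
    using that assms by (auto simp: indicator_def)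
  have "integrable lborel (\<lambda>x. indicator ?U x *\<^sub>R f x) = integrable lborel (\<lambda>x. indicator {s<..<t} x *\<^sub>R f x)"
    by (rule integrable_discrete_difference[of "{m}"]) (use eq in auto)
  moreover have "integral\<^sup>L lborel (\<lambda>x. indicator ?U x *\<^sub>R f x) = integral\<^sup>L lborel (\<lambda>x. indicator {s<..<t} x *\<^sub>R f x)"
    by (rule integral_discrete_difference[of "{m}"]) (use eq in auto)
  ultimately show ?thesis using U unfolding set_integrable_def set_lebesgue_integral_def by simp
qed

lemma abs_ln_norm_le_Im:
  assumes "Im z \<noteq> 0"
  shows "\<bar>ln (norm z)\<bar> \<le> norm z + 2 * isq (Im z)"
  using abs_ln_norm_le[of "\<i> * z"] assms by (simp add: norm_mult)

lemma norm_Ln_le: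
  assumes "z \<noteq> 0"
  shows "norm (Ln z) \<le> \<bar>ln (norm z)\<bar> + pi"
  using cmod_le[of "Ln z"] Im_Ln_le_pi[OF assms] mpi_less_Im_Ln[OF assms] assms by (simp add: abs_le_iff)

text \<open>The principal logarithm puts the cut on the horizontal ray to the left of \<rho>. The
  subtracted constant makes the function vanish at the branch point p, which integrability against
  the weight requires.\<close>

definition cut_log :: "real \<Rightarrow> complex \<Rightarrow> complex \<Rightarrow> complex" where
  "cut_log p \<rho> z = Ln (z - \<rho>) - Ln (of_real p - \<rho>)"

text \<open>The weighted integral of the lower minus the upper boundary value of the logarithm along
  the cut.\<close>

definition cut_jump :: "real \<Rightarrow> real \<Rightarrow> real \<Rightarrow> complex \<Rightarrow> complex" where
  "cut_jump a b X \<rho> = (LBINT x:{a..X}. (if x < Re \<rho> then - 2 * pi * \<i> else 0) * wt a b (Complex x (Im \<rho>)))"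

text \<open>The height of \<rho> splits the box into two strips on which the logarithm is
  holomorphic. When the strips are added, the two integrals along the common side do not cancel but
  leave the jump.\<close>

lemma box_int_cut_log:
  assumes b: "b > 0" and X: "a + b < X" and \<rho>: "0 < Im \<rho>" "Im \<rho> < T"
  shows "box_int a b X T (cut_log (a + b) \<rho>) (cut_jump a b X \<rho>)"
proof -
  define \<beta> where "\<beta> = Re \<rho>"
  define \<gamma> where "\<gamma> = Im \<rho>"
  define p where "p = a + b"
  define \<phi> where "\<phi> = cut_log p \<rho>"
  define L0 where "L0 = norm (Ln (of_real p - \<rho>))"
  have \<gamma>: "0 < \<gamma>" "\<gamma> < T" using \<rho> by (auto simp: \<gamma>_def)
  have aX: "a \<le> X" "a < p" "p < X" using b X by (auto simp: p_def)
  have not_nonpos: "z - \<rho> \<notin> \<real>\<^sub>\<le>\<^sub>0" if "Im z \<noteq> \<gamma>" for z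
    using that by (auto simp: complex_nonpos_Reals_iff \<gamma>_def)
  have der: "(\<phi> has_field_derivative inverse (z - \<rho>)) (at z)" if "Im z \<noteq> \<gamma>" for z
    unfolding \<phi>_def cut_log_def using not_nonpos[OF that]
    by (auto intro!: derivative_eq_intros simp: field_simps)
  \<comment> \<open>Within \<gamma>/2 of p the derivative is at most 2/\<gamma>, so the logarithm
    vanishes linearly there. Further away the weight is bounded by \<open>W\<close> and only the
    logarithm is singular.\<close>
  have near: "norm (\<phi> z) \<le> 2 / \<gamma> * norm (z - of_real p)" if z: "norm (z - of_real p) < \<gamma> / 2" for z
  proof -
    have Im: "Im w < \<gamma> / 2" if "w \<in> ball (of_real p) (\<gamma> / 2)" for w
      using that abs_Im_le_cmod[of "w - of_real p"] by (simp add: dist_norm norm_minus_commute)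
    have "norm (\<phi> z - \<phi> (of_real p)) \<le> 2 / \<gamma> * norm (z - of_real p)"
    proof (rule field_differentiable_bound[OF convex_ball])
      show "(\<phi> has_field_derivative inverse (w - \<rho>)) (at w within ball (of_real p) (\<gamma> / 2))" if "w \<in> ball (of_real p) (\<gamma> / 2)" for w
        by (rule has_field_derivative_at_within, rule der) (use Im[OF that] \<gamma> in auto)
      show "norm (inverse (w - \<rho>)) \<le> 2 / \<gamma>" if "w \<in> ball (of_real p) (\<gamma> / 2)" for w
      proof -
        have "\<gamma> / 2 \<le> norm (w - \<rho>)"
          using Im[OF that] abs_Im_le_cmod[of "w - \<rho>"] by (simp add: \<gamma>_def)
        thus ?thesis using \<gamma> le_imp_inverse_le[of "\<gamma> / 2" "norm (w - \<rho>)"] by (simp add: norm_inverse)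
      qed
      show "z \<in> ball (of_real p) (\<gamma> / 2)" "of_real p \<in> ball (complex_of_real p) (\<gamma> / 2)"
        using z \<gamma> by (auto simp: dist_norm norm_minus_commute)
    qed
    thus ?thesis by (simp add: \<phi>_def cut_log_def)
  qed
  define B where "B = \<bar>a\<bar> + \<bar>X\<bar> + T + norm \<rho>"
  define W where "W = (\<gamma> / 2) powr (-3/2) * b powr (-3/2)"
  define C1 where "C1 = 2 / \<gamma> * b powr (-3/2)"
  \<comment> \<open>The first group serves points near p, its last two terms on the sides x = a and
    x = X; the second group serves points far from p.\<close>
  define C where "C = C1 * (1 + b powr (-1/2) + (X - p) powr (-1/2)) + W * (B + pi + L0 + 2)"
  have nn: "W \<ge> 0" "B \<ge> 0" "C1 \<ge> 0" "L0 \<ge> 0" using \<gamma> by (auto simp: W_def B_def C1_def L0_def)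
  have C: "C1 \<le> C" "C1 * b powr (-1/2) \<le> C" "C1 * (X - p) powr (-1/2) \<le> C" "W * (B + pi + L0) \<le> C" "W * 2 \<le> C"
  proof -
    have "0 \<le> C1 * b powr (-1/2)" "0 \<le> C1 * (X - p) powr (-1/2)" "0 \<le> W * (B + pi + L0)" "0 \<le> W * 2"
      using nn by (auto intro!: mult_nonneg_nonneg)
    moreover have "C = C1 + C1 * b powr (-1/2) + C1 * (X - p) powr (-1/2) + W * (B + pi + L0) + W * 2"
      by (simp add: C_def algebra_simps)
    ultimately show "C1 \<le> C" "C1 * b powr (-1/2) \<le> C" "C1 * (X - p) powr (-1/2) \<le> C" "W * (B + pi + L0) \<le> C" "W * 2 \<le> C"
      using nn by linarith+
  qed
  let ?w = "\<lambda>x y. \<phi> (Complex x y) * wt a b (Complex x y)"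
  have near_wt: "norm (\<phi> z * wt a b z) \<le> C1 * isq (Re z - p)"
    if "norm (z - of_real p) < \<gamma> / 2" "Im z > 0" "Re z \<ge> a" "Re z \<noteq> p" for z
    using norm_mult_wt_le[OF b that(2,3), of "\<phi> z" "2 / \<gamma>"] near[OF that(1)] that by (simp add: p_def C1_def)
  have far_wt: "norm (\<phi> z * wt a b z) \<le> C + C * k"
    if z: "norm (z - of_real p) \<ge> \<gamma> / 2" "Im z > 0" "Im z < T" "a \<le> Re z" "Re z \<le> X" "z \<noteq> \<rho>"
      and k: "k \<ge> 0" "\<bar>ln (norm (z - \<rho>))\<bar> \<le> norm (z - \<rho>) + 2 * k" for z k
  proof -
    have "norm z \<le> B - norm \<rho>" using cmod_le[of z] z by (auto simp: B_def)
    hence "norm (z - \<rho>) \<le> B" using norm_triangle_ineq4[of z \<rho>] by linarith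
    hence "norm (\<phi> z) \<le> B + 2 * k + pi + L0"
      using norm_triangle_ineq4[of "Ln (z - \<rho>)" "Ln (of_real p - \<rho>)"] norm_Ln_le[of "z - \<rho>"] z(6) k
      by (simp add: \<phi>_def cut_log_def L0_def)
    moreover have "norm (wt a b z) \<le> W"
      unfolding W_def by (rule norm_wt_le) (use z b \<gamma> in \<open>auto simp: p_def\<close>)
    ultimately have "norm (\<phi> z * wt a b z) \<le> (B + 2 * k + pi + L0) * W"
      unfolding norm_mult using nn k by (intro mult_mono) auto
    also have "\<dots> = W * (B + pi + L0) + W * 2 * k" by (simp add: algebra_simps)
    also have "\<dots> \<le> C + C * k" using C k by (intro add_mono mult_right_mono) auto
    finally show ?thesis .
  qed
  have D: "norm (?w x y) \<le> C * (isq (x - p) + isq (x - \<beta>) + 1)"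
    if x: "x \<in> {a..X} - {p, \<beta>}" and y: "y \<in> {0<..<T}" for x y
  proof (cases "norm (Complex x y - of_real p) < \<gamma> / 2")
    case True
    have "norm (?w x y) \<le> C1 * isq (x - p)"
      using near_wt[OF True] x y by auto
    also have "\<dots> \<le> C * isq (x - p)" by (intro mult_right_mono C) auto
    also have "\<dots> \<le> C * (isq (x - p) + isq (x - \<beta>) + 1)"
      using C(1) nn by (intro mult_left_mono) auto
    finally show ?thesis .
  next
    case False
    have "norm (?w x y) \<le> C + C * isq (x - \<beta>)"
      using False x y abs_ln_norm_le[of "Complex x y - \<rho>"] by (intro far_wt) (auto simp: \<beta>_def)
    also have "\<dots> = C * (isq (x - \<beta>) + 1)" by (simp add: algebra_simps)
    also have "\<dots> \<le> C * (isq (x - p) + isq (x - \<beta>) + 1)"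
      using C(1) nn by (intro mult_left_mono) auto
    finally show ?thesis .
  qed
  \<comment> \<open>On the vertical sides the singularity is measured by the height instead of the
    abscissa, which admits a zero lying on the left side itself.\<close>
  have V: "norm (?w x y) \<le> C * (isq (y - \<gamma>) + isq (y - \<gamma>) + 1)"
    if x: "x \<in> {a, X}" and y: "y \<in> {0<..<T} - {\<gamma>}" for x y
  proof (cases "norm (Complex x y - of_real p) < \<gamma> / 2")
    case True
    have "norm (?w x y) \<le> C1 * isq (x - p)"
      using near_wt[OF True] x y aX by auto
    also have "\<dots> \<le> C * 1" using x C aX by (auto simp: p_def)
    also have "\<dots> \<le> C * (isq (y - \<gamma>) + isq (y - \<gamma>) + 1)"
      using C(1) nn by (intro mult_left_mono) auto
    finally show ?thesis .
  next
    case False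
    have "norm (?w x y) \<le> C + C * isq (y - \<gamma>)"
      using False x y aX abs_ln_norm_le_Im[of "Complex x y - \<rho>"] by (intro far_wt) (auto simp: \<gamma>_def)
    also have "\<dots> = C * (isq (y - \<gamma>) + 1)" by (simp add: algebra_simps)
    also have "\<dots> \<le> C * (isq (y - \<gamma>) + isq (y - \<gamma>) + 1)"
      using C(1) nn by (intro mult_left_mono) auto
    finally show ?thesis .
  qed
  define Q1 where "Q1 = {z. Im z < \<gamma>}"
  define Q2 where "Q2 = {z. Im z > \<gamma>}"
  have Q: "open Q1" "convex Q1" "open Q2" "convex Q2"
    unfolding Q1_def Q2_def
    by (simp_all add: open_halfspace_Im_gt open_halfspace_Im_lt convex_halfspace_Im_gt convex_halfspace_Im_lt)
  have hol: "\<phi> holomorphic_on Q1" "\<phi> holomorphic_on Q2"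
    unfolding holomorphic_on_open[OF Q(1)] holomorphic_on_open[OF Q(3)]
    using der by (force simp: Q1_def Q2_def)+
  have cont: "isCont \<phi> z" if "Im z \<noteq> \<gamma>" for z using der[OF that] by (rule DERIV_isCont)
  have lim\<phi>: "((\<lambda>y. \<phi> (Complex x y)) \<longlongrightarrow> \<phi> (Complex x t)) F" if "t \<noteq> \<gamma>" "F \<le> at t" for x t F
    by (rule tendsto_mono[OF that(2)], rule isCont_tendsto_compose[OF cont]) (use that in \<open>auto intro!: tendsto_intros\<close>)
  \<comment> \<open>On the negative axis \<open>Ln\<close> takes its limit from above, so only
    \<open>lo\<close> needs a correction to the left of \<beta>.\<close>
  define up where "up = (\<lambda>x. Ln (of_real (x - \<beta>)) - Ln (of_real p - \<rho>))"
  define lo where "lo = (\<lambda>x. up x - (if x < \<beta> then 2 * pi * \<i> else 0))"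
  have zlim: "((\<lambda>y. Complex x y - \<rho>) \<longlongrightarrow> of_real (x - \<beta>)) F" if "F \<le> at \<gamma>" for x F
  proof -
    have "((\<lambda>y. Complex x y - \<rho>) \<longlongrightarrow> Complex x \<gamma> - \<rho>) (at \<gamma>)" by (intro tendsto_intros)
    moreover have "Complex x \<gamma> - \<rho> = of_real (x - \<beta>)" by (simp add: complex_eq_iff \<beta>_def \<gamma>_def)
    ultimately show ?thesis using tendsto_mono[OF that] by metis
  qed
  have side: "((\<lambda>y. \<phi> (Complex x y)) \<longlongrightarrow> up x) F" if "F \<le> at \<gamma>" "x > \<beta>" for x F
    unfolding \<phi>_def cut_log_def up_def using that(2)
    by (intro tendsto_diff tendsto_const tendsto_Ln zlim that(1)) (simp del: of_real_diff)
  have lim_up: "((\<lambda>y. \<phi> (Complex x y)) \<longlongrightarrow> up x) (at_right \<gamma>)" if "x \<noteq> \<beta>" for x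
  proof (cases "x > \<beta>")
    case False
    hence "x < \<beta>" using that by simp
    have "((\<lambda>y. Ln (Complex x y - \<rho>)) \<longlongrightarrow> of_real (ln (\<beta> - x)) + \<i> * pi) (at_right \<gamma>)"
    proof (rule tendsto_Ln_upper)
      show "((\<lambda>y. Complex x y - \<rho>) \<longlongrightarrow> - of_real (\<beta> - x)) (at_right \<gamma>)" using zlim[of "at_right \<gamma>" x] by (simp add: at_le)
      show "\<forall>\<^sub>F y in at_right \<gamma>. 0 < Im (Complex x y - \<rho>)"
        using eventually_at_right_less[of \<gamma>] by eventually_elim (simp add: \<gamma>_def)
    qed (use \<open>x < \<beta>\<close> in auto)
    moreover have "Ln (of_real (x - \<beta>)) = of_real (ln (\<beta> - x)) + \<i> * pi"
      using \<open>x < \<beta>\<close> by (subst Ln_of_real') auto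
    ultimately show ?thesis unfolding \<phi>_def cut_log_def up_def by (auto intro!: tendsto_intros)
  qed (auto intro!: side simp: at_le)
  have lim_lo: "((\<lambda>y. \<phi> (Complex x y)) \<longlongrightarrow> lo x) (at_left \<gamma>)" if "x \<noteq> \<beta>" for x
  proof (cases "x > \<beta>")
    case True
    thus ?thesis using side[of "at_left \<gamma>" x] by (simp add: lo_def at_le)
  next
    case False
    hence "x < \<beta>" using that by simp
    have "((\<lambda>y. Ln (Complex x y - \<rho>)) \<longlongrightarrow> of_real (ln (\<beta> - x)) - \<i> * pi) (at_left \<gamma>)"
    proof (rule tendsto_Ln_lower)
      show "((\<lambda>y. Complex x y - \<rho>) \<longlongrightarrow> - of_real (\<beta> - x)) (at_left \<gamma>)" using zlim[of "at_left \<gamma>" x] by (simp add: at_le)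
      show "\<forall>\<^sub>F y in at_left \<gamma>. Im (Complex x y - \<rho>) < 0"
        by (simp add: eventually_at_filter \<gamma>_def)
    qed (use \<open>x < \<beta>\<close> in auto)
    moreover have "lo x = (of_real (ln (\<beta> - x)) - \<i> * pi) - Ln (of_real p - \<rho>)"
      unfolding lo_def up_def using \<open>x < \<beta>\<close> by (subst Ln_of_real') (auto simp: algebra_simps)
    ultimately show ?thesis unfolding \<phi>_def cut_log_def by (auto intro!: tendsto_intros)
  qed
  have T: "0 < T" using \<gamma> by simp
  have D1: "norm (?w x y) \<le> C * (isq (x - p) + isq (x - \<beta>) + 1)"
    if "x \<in> {a..X} - {p, \<beta>}" "y \<in> {0<..<\<gamma>}" for x y
    by (rule D[OF that(1)]) (use that(2) \<gamma> in auto)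
  have V1: "norm (?w x y) \<le> C * (isq (y - \<gamma>) + isq (y - \<gamma>) + 1)"
    if "x \<in> {a, X}" "y \<in> {0<..<\<gamma>}" for x y
    by (rule V[OF that(1)]) (use that(2) \<gamma> in auto)
  have inQ1: "Complex x y \<in> Q1" if "x \<in> {a..X}" "y \<in> {0<..<\<gamma>}" for x y
    using that by (simp add: Q1_def)
  have D2: "norm (?w x y) \<le> C * (isq (x - p) + isq (x - \<beta>) + 1)"
    if "x \<in> {a..X} - {p, \<beta>}" "y \<in> {\<gamma><..<T}" for x y
    by (rule D[OF that(1)]) (use that(2) \<gamma> in auto)
  have V2: "norm (?w x y) \<le> C * (isq (y - \<gamma>) + isq (y - \<gamma>) + 1)"
    if "x \<in> {a, X}" "y \<in> {\<gamma><..<T}" for x y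
    by (rule V[OF that(1)]) (use that(2) \<gamma> in auto)
  have inQ2: "Complex x y \<in> Q2" if "x \<in> {a..X}" "y \<in> {\<gamma><..<T}" for x y
    using that by (simp add: Q2_def)
  have lims1: "((\<lambda>y. ?w x y) \<longlongrightarrow> \<phi> (of_real x) * wt_real a b x) (at_right 0)"
    if "x \<in> {a..X} - {p, \<beta>}" for x
    using lim\<phi>[of 0 "at_right 0" x] tendsto_wt_real[OF b, of a x] that \<gamma>
    by (auto simp: complex_of_real_def at_le p_def intro!: tendsto_mult)
  have limt1: "((\<lambda>y. ?w x y) \<longlongrightarrow> lo x * wt a b (Complex x \<gamma>)) (at_left \<gamma>)"
    if "x \<in> {a..X} - {p, \<beta>}" for x
    using that \<gamma> by (intro tendsto_mult lim_lo tendsto_wt_vertical) (auto simp: at_le)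
  have "rect_int {a..X} {0<..<\<gamma>} (\<lambda>x. \<phi> (of_real x) * wt_real a b x) (?w X) (\<lambda>x. lo x * wt a b (Complex x \<gamma>)) (?w a) 0"
    by (rule strip_integral_wt[OF aX(1) order_refl \<gamma>(1) Q(1,2) hol(1) inQ1 D1 V1 lims1 limt1]; assumption)
  note S1 = rect_intD[OF this]
  have lims2: "((\<lambda>y. ?w x y) \<longlongrightarrow> up x * wt a b (Complex x \<gamma>)) (at_right \<gamma>)"
    if "x \<in> {a..X} - {p, \<beta>}" for x
    using that \<gamma> by (intro tendsto_mult lim_up tendsto_wt_vertical) (auto simp: at_le)
  have limt2: "((\<lambda>y. ?w x y) \<longlongrightarrow> ?w x T) (at_left T)"
    if "x \<in> {a..X} - {p, \<beta>}" for x
    using that \<gamma> by (intro tendsto_mult lim\<phi> tendsto_wt_vertical) (auto simp: at_le)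
  have "rect_int {a..X} {\<gamma><..<T} (\<lambda>x. up x * wt a b (Complex x \<gamma>)) (?w X) (\<lambda>x. ?w x T) (?w a) 0"
    by (rule strip_integral_wt[OF aX(1) less_imp_le[OF \<gamma>(1)] \<gamma>(2) Q(3,4) hol(2) inQ2 D2 V2 lims2 limt2]; assumption)
  note S2 = rect_intD[OF this]
  note join_a = LBINT_split_at[OF \<gamma> S1(3) S2(3)] and join_X = LBINT_split_at[OF \<gamma> S1(4) S2(4)]
  have J: "(LBINT x:{a..X}. lo x * wt a b (Complex x \<gamma>)) - (LBINT x:{a..X}. up x * wt a b (Complex x \<gamma>)) = cut_jump a b X \<rho>"
    unfolding cut_jump_def set_integral_diff(2)[OF S1(2) S2(1), symmetric] \<beta>_def[symmetric] \<gamma>_def[symmetric]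
    by (intro set_lebesgue_integral_cong) (auto simp: lo_def algebra_simps)
  have comb: "A + \<i> * (P1 + P2) - E - \<i> * (R1 + R2) = j"
    if "A + \<i> * P1 - L - \<i> * R1 = 0" "U + \<i> * P2 - E - \<i> * R2 = 0" "L - U = j" for A P1 P2 E R1 R2 L U j
  proof -
    have "A + \<i> * (P1 + P2) - E - \<i> * (R1 + R2) = (A + \<i> * P1 - L - \<i> * R1) + (U + \<i> * P2 - E - \<i> * R2) + (L - U)"
      by (simp add: algebra_simps)
    thus ?thesis by (simp only: that add_0)
  qed
  show ?thesis
    unfolding box_int_def rect_int_def p_def[symmetric] \<phi>_def[symmetric] join_a[THEN conjunct2] join_X[THEN conjunct2]
    by (intro conjI S1(1) S2(2) join_a[THEN conjunct1] join_X[THEN conjunct1] comb[OF S1(5) S2(5) J])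
qed

text \<open>Re (-2 pi \<i> w) = 2 pi Im w, and \<open>Im_wt_pos\<close> applies between a and Re
  \<rho>. For strict positivity the integrand is compared with its minimum on the compact middle
  third of that interval.\<close>

lemma Re_cut_jump:
  assumes b: "b > 0" and X: "a + b < X" and \<rho>: "0 < Im \<rho>" "Im \<rho> < T" "Re \<rho> \<le> a + b"
  shows "Re (cut_jump a b X \<rho>) \<ge> 0" "a < Re \<rho> \<Longrightarrow> Re (cut_jump a b X \<rho>) > 0"
proof -
  define g where "g = (\<lambda>x. (if x < Re \<rho> then - 2 * pi * \<i> else 0) * wt a b (Complex x (Im \<rho>)))"
  define f where "f = (\<lambda>x. 2 * pi * Im (wt a b (Complex x (Im \<rho>))))"
  have contw: "continuous_on UNIV (\<lambda>x. wt a b (Complex x (Im \<rho>)))"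
    by (rule continuous_on_compose2[OF holomorphic_on_imp_continuous_on[OF wt_holomorphic]])
       (use \<rho> in \<open>auto intro!: continuous_intros\<close>)
  have contf: "continuous_on UNIV f" unfolding f_def by (intro continuous_intros contw)
  have intg: "set_integrable lborel {a..X} g"
  proof -
    have "set_integrable lborel {a..X} (\<lambda>x. wt a b (Complex x (Im \<rho>)))"
      by (rule borel_integrable_atLeastAtMost') (rule continuous_on_subset[OF contw], simp)
    hence "set_integrable lborel {a..X} (\<lambda>x. - 2 * pi * \<i> * wt a b (Complex x (Im \<rho>)))"
      by (intro set_integrable_mult_right)
    hence "set_integrable lborel ({a..X} \<inter> {..<Re \<rho>}) (\<lambda>x. - 2 * pi * \<i> * wt a b (Complex x (Im \<rho>)))"
      by (rule set_integrable_subset) auto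
    moreover have "indicator ({a..X} \<inter> {..<Re \<rho>}) x *\<^sub>R (- 2 * pi * \<i> * wt a b (Complex x (Im \<rho>))) = indicator {a..X} x *\<^sub>R g x" for x
      by (auto simp: g_def indicator_def)
    ultimately show ?thesis by (simp only: set_integrable_def)
  qed
  have Re: "Re (cut_jump a b X \<rho>) = (LBINT x. indicator {a..X} x * Re (g x))"
    using integral_Re[OF intg[unfolded set_integrable_def]]
    by (simp add: cut_jump_def g_def[symmetric] set_lebesgue_integral_def)
  have intRe: "integrable lborel (\<lambda>x. indicator {a..X} x * Re (g x))"
    using integrable_Re[OF intg[unfolded set_integrable_def]] by simp
  have Reg: "Re (g x) = (if x < Re \<rho> then f x else 0)" for x by (simp add: g_def f_def)
  have fpos: "f x > 0" if "a < x" "x \<le> Re \<rho>" for x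
    unfolding f_def using that \<rho> by (intro mult_pos_pos Im_wt_pos) auto
  have fnn: "indicator {a..X} x * Re (g x) \<ge> 0" if "x \<notin> {a}" for x
    using fpos[of x] that by (auto simp: Reg indicator_def)
  have "(LBINT x. (if x = a then 0 else indicator {a..X} x * Re (g x))) = (LBINT x. indicator {a..X} x * Re (g x))"
    by (rule integral_discrete_difference[of "{a}"]) auto
  moreover have "(LBINT x. (if x = a then 0 else indicator {a..X} x * Re (g x))) \<ge> 0"
    by (rule integral_nonneg_AE) (use fnn in auto)
  ultimately show "Re (cut_jump a b X \<rho>) \<ge> 0" using Re by simp
  assume \<beta>: "a < Re \<rho>"
  define u where "u = (2 * a + Re \<rho>) / 3"
  define v where "v = (a + 2 * Re \<rho>) / 3"
  have uv: "a < u" "u < v" "v < Re \<rho>" using \<beta> by (auto simp: u_def v_def)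
  obtain w where w: "w \<in> {u..v}" "\<And>x. x \<in> {u..v} \<Longrightarrow> f w \<le> f x"
    using continuous_attains_inf[of "{u..v}" f] continuous_on_subset[OF contf] uv by (metis atLeastatMost_empty_iff compact_Icc less_imp_le not_less top_greatest)
  have fw: "f w > 0" using w uv by (intro fpos) auto
  have "0 < f w * (v - u)" using fw uv by simp
  also have "\<dots> = (LBINT x. indicator {u..v} x * f w)" using uv by simp
  also have "\<dots> \<le> (LBINT x. (if x = a then 0 else indicator {a..X} x * Re (g x)))"
  proof (rule integral_mono)
    show "integrable lborel (\<lambda>x. if x = a then 0 else indicator {a..X} x * Re (g x))"
      using intRe by (subst integrable_discrete_difference[of "{a}" _ _ "\<lambda>x. indicator {a..X} x * Re (g x)"]) auto
    show "indicator {u..v} x * f w \<le> (if x = a then 0 else indicator {a..X} x * Re (g x))" for x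
      using uv w(2)[of x] fnn[of x] \<rho> X by (auto simp: indicator_def Reg)
  qed (use uv in \<open>auto intro!: integrable_real_indicator integrable_mult_left\<close>)
  also have "\<dots> = Re (cut_jump a b X \<rho>)" unfolding Re
    by (rule integral_discrete_difference[of "{a}"]) auto
  finally show "Re (cut_jump a b X \<rho>) > 0" .
qed

section \<open>The argument of the zeta function\<close>

text \<open>Two logarithms rather than one of the product: for Re s >= 3 both factors lie in the
  right half-plane, where Ln is continuous, whereas their product may cross the negative
  axis.\<close>

definition zeta_log :: "complex \<Rightarrow> complex" where
  "zeta_log s = Ln (zeta s) + Ln (s - 1)"

lemma norm_zeta_minus_1_le_half:
  assumes "Re s \<ge> 3"
  shows "norm (zeta s - 1) \<le> 1/2"
proof -
  have "2 powr (- Re s) \<le> 2 powr (-3)" using assms by (intro powr_mono) auto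
  also have "2 powr (-3) = (1/8 :: real)" by (simp add: powr_minus powr_numeral)
  finally have "4 * 2 powr (- Re s) \<le> 1/2" by simp
  thus ?thesis using norm_zeta_minus_1_le[of s] assms by simp
qed

lemma zeta_Re_ge:
  assumes "Re s \<ge> 3"
  shows "Re (zeta s) \<ge> 1/2" "zeta s \<noteq> 0" "s \<noteq> 1" "Re (s - 1) > 0"
proof -
  show "Re (zeta s) \<ge> 1/2"
    using norm_zeta_minus_1_le_half[OF assms] abs_Re_le_cmod[of "zeta s - 1"] by simp
  thus "zeta s \<noteq> 0" by auto
  show "s \<noteq> 1" "Re (s - 1) > 0" using assms by auto
qed

lemma exp_zeta_log: "Re s \<ge> 3 \<Longrightarrow> exp (zeta_log s) = zeta_reg s"
  using zeta_Re_ge[of s] by (simp add: zeta_log_def exp_add zeta_reg_def)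

lemma zeta_log_continuous: "continuous_on {s. Re s \<ge> 3} zeta_log"
proof -
  have "continuous_on {s. Re s \<ge> 3} zeta"
    by (rule holomorphic_on_imp_continuous_on, rule holomorphic_on_subset[OF zeta_holomorphic]) auto
  moreover have "zeta s \<notin> \<real>\<^sub>\<le>\<^sub>0" "s - 1 \<notin> \<real>\<^sub>\<le>\<^sub>0" if "s \<in> {s. Re s \<ge> 3}" for s
    using zeta_Re_ge[of s] that by (auto simp: complex_nonpos_Reals_iff)
  ultimately show ?thesis unfolding zeta_log_def by (intro continuous_intros) auto
qed

lemma norm_zeta_log_le:
  assumes s: "Re s \<ge> 3"
  shows "norm (zeta_log s) \<le> 10 + norm s"
proof -
  have z: "norm (zeta s) \<ge> 1/2" "norm (zeta s) \<le> 3/2"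
    using norm_zeta_minus_1_le_half[OF s] norm_triangle_ineq3[of "zeta s" 1] by (auto simp: abs_le_iff)
  have "\<bar>ln (norm (zeta s))\<bar> \<le> 1"
  proof -
    have "ln (norm (zeta s)) \<le> norm (zeta s) - 1" using z by (intro ln_le_minus_one) auto
    moreover have "ln (inverse (norm (zeta s))) \<le> inverse (norm (zeta s)) - 1" using z by (intro ln_le_minus_one) auto
    moreover have "inverse (norm (zeta s)) \<le> 2" using z le_imp_inverse_le[of "1/2" "norm (zeta s)"] by simp
    ultimately show ?thesis using z by (simp add: ln_inverse)
  qed
  hence 1: "norm (Ln (zeta s)) \<le> 1 + pi" using norm_Ln_le[of "zeta s"] zeta_Re_ge[OF s] by simp
  have "1 \<le> norm (s - 1)" using s abs_Re_le_cmod[of "s - 1"] by simp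
  moreover have "norm (s - 1) \<le> norm s + 1" using norm_triangle_ineq4[of s 1] by simp
  moreover have "ln (norm (s - 1)) \<ge> 0" using \<open>1 \<le> norm (s - 1)\<close> by (rule ln_ge_zero)
  moreover have "ln (norm (s - 1)) \<le> norm (s - 1) - 1" using \<open>1 \<le> norm (s - 1)\<close> by (intro ln_le_minus_one) linarith
  ultimately have "\<bar>ln (norm (s - 1))\<bar> \<le> norm s" by linarith
  hence "norm (Ln (s - 1)) \<le> norm s + pi" using norm_Ln_le[of "s - 1"] zeta_Re_ge[OF s] by simp
  moreover have "norm (zeta_log s) \<le> norm (Ln (zeta s)) + norm (Ln (s - 1))"
    unfolding zeta_log_def by (rule norm_triangle_ineq)
  ultimately show ?thesis using 1 pi_less_4 by linarith
qed

lemma Im_zeta_log_le: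
  assumes s: "Re s \<ge> 3"
  shows "\<bar>Im (zeta_log s)\<bar> \<le> 2 * pi"
proof -
  have "\<bar>Im (Ln z)\<bar> \<le> pi" if "z \<noteq> 0" for z
    using Im_Ln_le_pi[OF that] mpi_less_Im_Ln[OF that] by (simp add: abs_le_iff)
  from this[of "zeta s"] this[of "s - 1"] show ?thesis
    using zeta_Re_ge[OF s] by (simp add: zeta_log_def)
qed

text \<open>zeta tends to 1, and so does s - 1 after division by the positive number x - 1, which
  leaves the argument unchanged.\<close>

lemma Im_zeta_log_tendsto: "((\<lambda>x. Im (zeta_log (Complex x t))) \<longlongrightarrow> 0) at_top"
proof -
  have "((\<lambda>x. zeta (Complex x t) - 1) \<longlongrightarrow> 0) at_top"
  proof (rule Lim_null_comparison)
    show "\<forall>\<^sub>F x in at_top. norm (zeta (Complex x t) - 1) \<le> 4 * 2 powr (- x)"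
      using eventually_ge_at_top[of 2]
    proof eventually_elim
      case (elim x)
      thus ?case using norm_zeta_minus_1_le[of "Complex x t"] by simp
    qed
    show "((\<lambda>x. 4 * 2 powr (- x)) \<longlongrightarrow> (0::real)) at_top" by real_asymp
  qed
  hence "((\<lambda>x. zeta (Complex x t)) \<longlongrightarrow> 1) at_top" by (simp add: LIM_zero_iff)
  hence "((\<lambda>x. Im (Ln (zeta (Complex x t)))) \<longlongrightarrow> Im (Ln 1)) at_top"
    by (intro tendsto_intros) auto
  moreover have "((\<lambda>x. Im (Ln (Complex x t - 1))) \<longlongrightarrow> 0) at_top"
  proof -
    have L: "((\<lambda>x. Complex 1 (t / (x - 1))) \<longlongrightarrow> Complex 1 0) at_top"
      by (intro tendsto_intros) real_asymp
    have "((\<lambda>x. Im (Ln (Complex 1 (t / (x - 1))))) \<longlongrightarrow> Im (Ln (Complex 1 0))) at_top"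
      by (intro tendsto_Im tendsto_Ln L) (auto simp: complex_nonpos_Reals_iff)
    moreover have "Ln (Complex 1 0) = 0" by (simp add: one_complex.code[symmetric])
    moreover have "\<forall>\<^sub>F x in at_top. Im (Ln (Complex 1 (t / (x - 1)))) = Im (Ln (Complex x t - 1))"
      using eventually_gt_at_top[of 1]
    proof eventually_elim
      case (elim x)
      have "Complex x t - 1 = of_real (x - 1) * Complex 1 (t / (x - 1))"
        using elim by (simp add: complex_eq_iff)
      moreover have "Complex 1 (t / (x - 1)) \<noteq> 0" by (simp add: complex_eq_iff)
      ultimately show ?case using elim by (simp add: Ln_times_of_real del: of_real_diff)
    qed
    ultimately show ?thesis by (auto intro: Lim_transform_eventually)
  qed
  ultimately show ?thesis unfolding zeta_log_def plus_complex.sel using tendsto_add by fastforce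
qed

text \<open>Prolonged by \<open>zeta_log\<close> beyond X, G becomes an admissible branch on the
  whole half-line. The branch picked by the choice operator differs from it by a constant, whose
  imaginary part is 0 because both arguments tend to 0 at infinity.\<close>

lemma zeta_arg_eq:
  assumes t: "t > 0" and X: "X \<ge> 3" "a \<le> X" and G: "continuous_on {a..X} G"
    "\<And>x. x \<in> {a..X} \<Longrightarrow> exp (G x) = zeta_reg (Complex x t)" "G X = zeta_log (Complex X t)"
  shows "zeta_arg a t = Im (G a)"
proof -
  define g where "g = (\<lambda>x. if x \<le> X then G x else zeta_log (Complex x t))"
  have ne1: "Complex x t \<noteq> 1" for x using t by (auto simp: complex_eq_iff)
  have "continuous_on ({a..X} \<union> {X..}) g"
    unfolding g_def
  proof (rule continuous_on_cases)
    show "continuous_on {X..} (\<lambda>x. zeta_log (Complex x t))"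
      by (rule continuous_on_compose2[OF zeta_log_continuous]) (use X in \<open>auto intro!: continuous_intros\<close>)
  qed (use G in auto)
  moreover have "{a..X} \<union> {X..} = {a..}" using X by auto
  moreover have "exp (g x) = zeta (Complex x t) * (Complex x t - 1)" if "x \<ge> a" for x
    using G(2)[of x] exp_zeta_log[of "Complex x t"] X that ne1[of x] by (auto simp: g_def zeta_reg_def)
  moreover have "((\<lambda>x. Im (g x)) \<longlongrightarrow> 0) at_top"
  proof (rule Lim_transform_eventually[OF Im_zeta_log_tendsto])
    show "\<forall>\<^sub>F x in at_top. Im (zeta_log (Complex x t)) = Im (g x)"
      using eventually_gt_at_top[of X] by eventually_elim (simp add: g_def)
  qed
  ultimately have g: "cont_log_along a t g" unfolding cont_log_along_def by simp
  define g' where "g' = (SOME g. cont_log_along a t g)"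
  have g': "cont_log_along a t g'" unfolding g'_def by (rule someI[where P = "cont_log_along a t", OF g])
  have const: "g' x - g x = g' a - g a" if "x \<ge> a" for x
    by (rule continuous_log_unique[of "{a..}"]) (use g g' that in \<open>auto simp: cont_log_along_def\<close>)
  have "((\<lambda>x. Im (g' x) - Im (g x)) \<longlongrightarrow> 0 - 0) at_top"
    using g g' unfolding cont_log_along_def by (intro tendsto_diff) auto
  moreover have "\<forall>\<^sub>F x in at_top. Im (g' x) - Im (g x) = Im (g' a - g a)"
    using eventually_ge_at_top[of a] by eventually_elim (use const in \<open>metis minus_complex.sel(2)\<close>)
  ultimately have "((\<lambda>x. Im (g' a - g a)) \<longlongrightarrow> 0) (at_top :: real filter)"
    by (auto intro: Lim_transform_eventually)
  hence "Im (g' a - g a) = 0" by (simp add: tendsto_const_iff)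
  thus ?thesis using g X unfolding zeta_arg_def arg_raw_def g'_def[symmetric] by (auto simp: g_def)
qed

text \<open>At all other heights the argument comes from a genuine continuous logarithm along the
  whole path. Zeros of every real part are included, since only countability matters.\<close>

definition zeta_ordinates :: "real set" where
  "zeta_ordinates = Im ` {s. zeta_reg s = 0}"

lemma countable_zeta_ordinates: "countable zeta_ordinates"
proof -
  have "\<not> zeta_reg constant_on UNIV"
  proof
    assume "zeta_reg constant_on UNIV"
    then obtain c where c: "\<And>s. zeta_reg s = c" by (auto simp: constant_on_def)
    have "c = 1" using c[of 1] by (simp add: zeta_reg_def)
    hence "zeta s * (s - 1) = 1" if "s \<noteq> 1" for s using c[of s] that by (simp add: zeta_reg_def)
    \<comment> \<open>The constant could only be 1, the value at the removed pole, and then zeta(5)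
      = 1/4, contrary to Re zeta >= 1/2 for Re s >= 3.\<close>
    from this[of 5] have "zeta 5 = of_real (1/4)" by simp
    hence "Re (zeta 5) = 1/4" by (simp only: Re_complex_of_real)
    thus False using zeta_Re_ge(1)[of 5] by simp
  qed
  hence "countable {s\<in>UNIV. zeta_reg s = 0}"
    by (intro holomorphic_countable_zeros[OF zeta_reg_holomorphic]) auto
  thus ?thesis by (simp add: zeta_ordinates_def)
qed

text \<open>\<open>log_variation_bound\<close> on discs about 3 + it, with radii 3 - a <= 5/2 < 13/5
  < 11/4; the largest still lies in Re s >= 1/4, where the growth bound holds. Polynomial growth
  would even give a logarithm of t, but a multiple of 1 + t is enough.\<close>

lemma zeta_log_variation:
  assumes a: "1/2 \<le> a" "a \<le> 1"
  obtains C where "C > 0" "\<And>t G. \<lbrakk>t > 0; t \<notin> zeta_ordinates; continuous_on {a..3} G;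
      \<And>x. x \<in> {a..3} \<Longrightarrow> exp (G x) = zeta_reg (Complex x t)\<rbrakk> \<Longrightarrow>
      log_variation_le a 3 (C * (1 + t)) G"
proof -
  obtain C0 where C0: "C0 > 0" "\<And>s. Re s \<ge> 1/4 \<Longrightarrow> norm (zeta_reg s) \<le> C0 * (1 + norm s)\<^sup>2"
    by (rule norm_zeta_reg_le) (rule that)
  show ?thesis
  proof (rule log_variation_bound[of "3 - a" "13/5" "11/4"])
  fix C1 :: real
  assume C1: "C1 > 0" "\<And>f M G. \<lbrakk>f holomorphic_on UNIV; \<And>z. norm z \<le> 11/4 \<Longrightarrow> norm (f z) \<le> M;
      \<And>x. -(3 - a) \<le> x \<Longrightarrow> x \<le> 11/4 \<Longrightarrow> f (of_real x) \<noteq> 0;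
      continuous_on {-(3 - a)..0} G; \<And>x. x \<in> {-(3 - a)..0} \<Longrightarrow> exp (G x) = f (of_real x)\<rbrakk> \<Longrightarrow>
      log_variation_le (-(3 - a)) 0 (C1 * (ln (M / norm (f 0)) + 1)) G"
  define C where "C = C1 * (\<bar>ln C0\<bar> + 15)"
  have C: "C > 0" unfolding C_def using C1 by (intro mult_pos_pos) auto
  show ?thesis
  proof (rule that[OF C])
    fix t G assume t: "t > 0" "t \<notin> zeta_ordinates" and G: "continuous_on {a..3} G"
      "\<And>x. x \<in> {a..3} \<Longrightarrow> exp (G x) = zeta_reg (Complex x t)"
    define f where "f = (\<lambda>z. zeta_reg (z + Complex 3 t))"
    define M where "M = C0 * (7 + t)\<^sup>2"
    define G' where "G' = (\<lambda>x. G (x + 3))"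
    define A where "A = ln (M / norm (f 0)) + 1"
    have "(\<lambda>z. z + Complex 3 t) holomorphic_on UNIV" by (intro holomorphic_intros)
    from holomorphic_on_compose_gen[OF this zeta_reg_holomorphic[of UNIV]]
    have fhol: "f holomorphic_on UNIV" by (simp add: f_def o_def)
    have fM: "norm (f z) \<le> M" if z: "norm z \<le> 11/4" for z
    proof -
      have "norm (z + Complex 3 t) \<le> norm z + norm (Complex 3 t)" by (rule norm_triangle_ineq)
      also have "norm (Complex 3 t) \<le> 3 + t" using cmod_le[of "Complex 3 t"] t by simp
      finally have "norm (z + Complex 3 t) \<le> 6 + t" using z by simp
      moreover have "norm (f z) \<le> C0 * (1 + norm (z + Complex 3 t))\<^sup>2"
        unfolding f_def by (rule C0(2)) (use z abs_Re_le_cmod[of z] in auto)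
      moreover have "C0 * (1 + norm (z + Complex 3 t))\<^sup>2 \<le> C0 * (1 + (6 + t))\<^sup>2"
        using C0(1) \<open>norm (z + Complex 3 t) \<le> 6 + t\<close> by (intro mult_left_mono power_mono add_left_mono) auto
      ultimately show ?thesis unfolding M_def by simp
    qed
    have "of_real x + Complex 3 t = Complex (x + 3) t" for x by (simp add: complex_eq_iff)
    hence fx: "f (of_real x) = zeta_reg (Complex (x + 3) t)" for x by (simp only: f_def)
    have fnz: "f (of_real x) \<noteq> 0" for x
      using t(2) unfolding fx zeta_ordinates_def by (metis (mono_tags, lifting) complex.sel(2) imageI mem_Collect_eq)
    have G'c: "continuous_on {-(3 - a)..0} G'"
      unfolding G'_def by (rule continuous_on_compose2[OF G(1)]) (auto intro!: continuous_intros)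
    have G'e: "exp (G' x) = f (of_real x)" if "x \<in> {-(3 - a)..0}" for x
      unfolding fx G'_def by (rule G(2)) (use that in auto)
    \<comment> \<open>A lower bound at the centre, uniform in t, so that ln (M / |f 0|) is
      controlled by ln M.\<close>
    have f0: "norm (f 0) \<ge> 1"
    proof -
      have "Complex 3 t \<noteq> 1" by (simp add: complex_eq_iff)
      hence "norm (f 0) = norm (zeta (Complex 3 t)) * norm (Complex 3 t - 1)"
        by (simp add: f_def zeta_reg_def norm_mult)
      moreover have "norm (zeta (Complex 3 t)) \<ge> 1/2"
        using zeta_Re_ge(1)[of "Complex 3 t"] complex_Re_le_cmod[of "zeta (Complex 3 t)"] by simp
      moreover have "norm (Complex 3 t - 1) \<ge> 2" using complex_Re_le_cmod[of "Complex 3 t - 1"] by simp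
      ultimately show ?thesis using mult_mono[of "1/2" "norm (zeta (Complex 3 t))" 2 "norm (Complex 3 t - 1)"] by simp
    qed
    have A: "C1 * A \<le> C * (1 + t)"
    proof -
      have M0: "M > 0" using C0 t by (simp add: M_def)
      have "M / norm (f 0) \<le> M" using f0 M0 by (simp add: divide_le_eq mult_le_cancel_left1)
      hence "ln (M / norm (f 0)) \<le> ln M" using f0 M0 by (subst ln_le_cancel_iff) (auto intro!: divide_pos_pos)
      also have "ln M = ln C0 + 2 * ln (7 + t)" using C0 t by (simp add: M_def ln_mult ln_realpow)
      also have "ln (7 + t) \<le> 7 + t" using t ln_le_minus_one[of "7 + t"] by simp
      finally have "A \<le> \<bar>ln C0\<bar> + 15 + 2 * t" by (simp add: A_def)
      also have "\<dots> \<le> (\<bar>ln C0\<bar> + 15) * (1 + t)" using t by (simp add: algebra_simps)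
      finally show ?thesis using C1 by (simp add: C_def)
    qed
    note L = C1(2)[of f M G', OF fhol fM fnz G'c G'e, folded A_def, unfolded log_variation_le_def]
    have L1: "\<bar>Im (G' x - G' 0)\<bar> \<le> C1 * A" if "x \<in> {-(3 - a)..0}" for x
      using L that by blast
    obtain bs where bs: "real (length bs) \<le> C1 * A"
        "\<forall>x\<in>{-(3 - a)..0} - set bs. norm (G' x - G' 0) \<le> C1 * A + (\<Sum>\<beta>\<leftarrow>bs. 2 * isq (x - \<beta>))"
      using L by blast
    have "\<bar>Im (G x - G 3)\<bar> \<le> C * (1 + t)" if "x \<in> {a..3}" for x
      using L1[of "x - 3"] A that by (simp add: G'_def)
    moreover have "norm (G x - G 3) \<le> C * (1 + t) + (\<Sum>\<beta>\<leftarrow>map ((+) 3) bs. 2 * isq (x - \<beta>))"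
      if x: "x \<in> {a..3} - set (map ((+) 3) bs)" for x
    proof -
      have "x - 3 \<in> {-(3 - a)..0} - set bs" using x by (force simp: image_iff)
      hence "norm (G' (x - 3) - G' 0) \<le> C1 * A + (\<Sum>\<beta>\<leftarrow>bs. 2 * isq ((x - 3) - \<beta>))"
        using bs(2) by blast
      thus ?thesis using A by (simp add: G'_def o_def diff_diff_eq)
    qed
    moreover have "real (length (map ((+) 3) bs)) \<le> C * (1 + t)" using bs A by simp
    ultimately show "log_variation_le a 3 (C * (1 + t)) G"
      unfolding log_variation_le_def by blast
  qed
  qed (use a in simp_all)
qed

section \<open>The integral over a box\<close>

lemma member_le_sum_list_nonneg:
  fixes xs :: "real list"
  assumes "x \<in> set xs" "\<And>y. y \<in> set xs \<Longrightarrow> 0 \<le> y"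
  shows "x \<le> sum_list xs"
  using assms
proof (induction xs)
  case (Cons y ys)
  have "sum_list ys \<ge> 0" using Cons.prems by (intro sum_list_nonneg) auto
  moreover have "0 \<le> y" using Cons.prems(2)[of y] by simp
  ultimately show ?case using Cons by (cases "x = y") (auto simp: add_increasing)
qed auto

lemma zeta_reg_nonzero_real: "x > 0 \<Longrightarrow> zeta_reg (of_real x) \<noteq> 0"
  using zeta_reg_real_pos[of x] by (metis less_irrefl of_real_eq_0_iff)

lemma zeta_reg_nonzero_Re_gt_1: "Re s > 1 \<Longrightarrow> zeta_reg s \<noteq> 0"
  using zeta_nonzero_Re_gt_1[of s] by (auto simp: zeta_reg_def)

lemma zeta_log_of_real:
  assumes "X \<ge> 3"
  shows "zeta_log (of_real X) = of_real (ln (Re (zeta_reg (of_real X))))"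
proof -
  obtain y where y: "y > 0" "zeta_reg (of_real X) = of_real y" using zeta_reg_real_pos[of X] assms by auto
  have "zeta (of_real X) * (of_real X - 1) = of_real y" using y assms by (auto simp: zeta_reg_def)
  hence "zeta (of_real X) = of_real (y / (X - 1))" using assms by (auto simp: field_simps)
  moreover have "y / (X - 1) > 0" using y assms by simp
  moreover have "complex_of_real X - 1 = of_real (X - 1)" by simp
  ultimately have "zeta_log (of_real X) = of_real (ln (y / (X - 1)) + ln (X - 1))"
    using assms unfolding zeta_log_def by (simp only: Ln_of_real of_real_add)
  also have "ln (y / (X - 1)) + ln (X - 1) = ln y" using y assms by (simp add: ln_div)
  finally show ?thesis using y by simp
qed

text \<open>The logarithm of \<open>zeta_reg\<close> on the box with horizontal cuts running left from the zeros.\<close>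
lemma zeta_box:
  assumes a: "1/2 \<le> a" "a < 1" and T: "T > 0" "T \<notin> zeta_ordinates" and X: "X \<ge> 3"
  obtains \<Lambda> v where "box_int a (1 - a) X T \<Lambda> v"
    "\<And>t. t \<in> {0<..T} \<Longrightarrow> t \<notin> zeta_ordinates \<Longrightarrow> continuous_on {a..X} (\<lambda>x. \<Lambda> (Complex x t)) \<and>
       (\<forall>x\<in>{a..X}. exp (\<Lambda> (Complex x t)) = zeta_reg (Complex x t))"
    "\<And>t. t \<in> {0..T} \<Longrightarrow> \<Lambda> (Complex X t) = zeta_log (Complex X t)"
    "\<And>x. x \<in> {a..X} \<Longrightarrow> \<Lambda> (of_real x) = of_real (ln (Re (zeta_reg (of_real x))))"
    "\<And>\<rho>. zeta_reg \<rho> = 0 \<Longrightarrow> a < Re \<rho> \<Longrightarrow> 0 < Im \<rho> \<Longrightarrow> Im \<rho> < T \<Longrightarrow> Re (cut_jump a (1 - a) X \<rho>) \<le> Re v"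
    "\<forall>\<rho>. zeta_reg \<rho> = 0 \<longrightarrow> Re \<rho> \<le> a \<Longrightarrow> v = 0"
proof -
  define b where "b = 1 - a"
  have b: "b > 0" "a + b = 1" "a + b < X" using a X by (auto simp: b_def)
  define K where "K = cbox (Complex a 0) (Complex X T)"
  have K: "z \<in> K \<longleftrightarrow> Re z \<in> {a..X} \<and> Im z \<in> {0..T}" for z
    by (auto simp: K_def in_cbox_complex_iff)
  obtain zs h where h: "\<And>\<rho>. \<rho> \<in> set zs \<longleftrightarrow> \<rho> \<in> K \<and> zeta_reg \<rho> = 0" "h holomorphic_on UNIV"
    "\<And>z. zeta_reg z = h z * (\<Prod>\<rho>\<leftarrow>zs. z - \<rho>)" "\<And>z. z \<in> K \<Longrightarrow> h z \<noteq> 0"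
  proof (rule factor_out_zeros[of zeta_reg UNIV K])
    show "zeta_reg holomorphic_on UNIV" by (rule zeta_reg_holomorphic)
    show "\<exists>z\<in>UNIV. zeta_reg z \<noteq> 0" by (auto intro!: exI[of _ 1] simp: zeta_reg_def)
  qed (auto simp: K_def)
  \<comment> \<open>Zeros may lie on the left side of the box, but on none of the others: the
    function is positive on the real axis, T is not the height of a zero, and there are no zeros
    beyond Re s = 1.\<close>
  have \<rho>: "a \<le> Re \<rho>" "Re \<rho> \<le> 1" "0 < Im \<rho>" "Im \<rho> < T" "Re \<rho> < X" if "\<rho> \<in> set zs" for \<rho>
  proof -
    have z: "zeta_reg \<rho> = 0" "\<rho> \<in> K" using h(1) that by auto
    show 1: "Re \<rho> \<le> 1" using zeta_reg_nonzero_Re_gt_1[of \<rho>] z by (auto simp: not_less[symmetric])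
    show "a \<le> Re \<rho>" "Re \<rho> < X" using z X 1 by (auto simp: K)
    have "Im \<rho> \<noteq> 0"
    proof
      assume "Im \<rho> = 0"
      hence "\<rho> = of_real (Re \<rho>)" by (simp add: complex_eq_iff)
      moreover have "Re \<rho> > 0" using z a by (auto simp: K)
      ultimately show False using zeta_reg_nonzero_real[of "Re \<rho>"] z by simp
    qed
    moreover have "Im \<rho> \<noteq> T" using T z by (auto simp: zeta_ordinates_def)
    ultimately show "0 < Im \<rho>" "Im \<rho> < T" using z by (auto simp: K)
  qed
  have Im_ne: "Im \<rho> \<noteq> 0" if "\<rho> \<in> set zs" for \<rho> using \<rho>(3)[OF that] by simp
  have cpt: "compact K" "convex K" by (simp_all add: K_def)
  have "open {z. h z \<noteq> 0}"
    using h(2) by (intro open_Collect_neq continuous_intros holomorphic_on_imp_continuous_on) auto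
  then obtain e where e: "e > 0" "(\<Union>z\<in>K. ball z e) \<subseteq> {z. h z \<noteq> 0}"
    using compact_subset_open_imp_ball_epsilon_subset[OF cpt(1), of "{z. h z \<noteq> 0}"] h(4) by blast
  \<comment> \<open>A neighbourhood of the box on which the cofactor has no zero. As the Minkowski
    sum of K and a ball it is convex, so the cofactor has a holomorphic logarithm there.\<close>
  define Q where "Q = (\<Union>z\<in>K. ball z e)"
  have Qop: "open Q" unfolding Q_def by auto
  have "Q = (\<Union>x\<in>K. \<Union>y\<in>ball 0 e. {x + y})"
  proof (intro equalityI subsetI)
    fix w assume "w \<in> Q"
    then obtain z where z: "z \<in> K" "dist z w < e" unfolding Q_def by auto
    hence "w - z \<in> ball 0 e" "w = z + (w - z)" by (auto simp: dist_norm norm_minus_commute)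
    thus "w \<in> (\<Union>x\<in>K. \<Union>y\<in>ball 0 e. {x + y})" using z by blast
  next
    fix w assume "w \<in> (\<Union>x\<in>K. \<Union>y\<in>ball 0 e. {x + y})"
    then obtain x y where "x \<in> K" "norm y < e" "w = x + y" by auto
    moreover from this have "w \<in> ball x e" by (simp add: dist_norm)
    ultimately show "w \<in> Q" unfolding Q_def by blast
  qed
  hence Qcv: "convex Q" using convex_sums[OF cpt(2) convex_ball[of 0 e]] by simp
  have KQ: "K \<subseteq> Q" using e by (auto simp: Q_def)
  have "h holomorphic_on Q" using h(2) by (rule holomorphic_on_subset) auto
  moreover have "h z \<noteq> 0" if "z \<in> Q" for z using that e unfolding Q_def by blast
  ultimately obtain l where l: "l holomorphic_on Q" "\<And>z. z \<in> Q \<Longrightarrow> h z = exp (l z)"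
    using contractible_imp_holomorphic_log[of h Q] convex_imp_contractible[OF Qcv] by metis
  have oneK: "1 \<in> K" using a X T by (simp add: K)
  \<comment> \<open>Each summand vanishes at 1 = a + b, in agreement with
    \<open>zeta_reg 1 = 1\<close>.\<close>
  define \<Lambda> where "\<Lambda> = (\<lambda>z. (\<Sum>\<rho>\<leftarrow>zs. cut_log (a + b) \<rho> z) + (l z - l 1))"
  define v where "v = (\<Sum>\<rho>\<leftarrow>zs. cut_jump a b X \<rho>)"
  have "box_int a b X T (\<lambda>z. l z - l 1) 0"
  proof (rule box_int_holomorphic[OF b(1,3) T(1) Qop Qcv])
    show "(\<lambda>z. l z - l 1) holomorphic_on Q" by (intro holomorphic_intros l)
    show "Complex x y \<in> Q" if "x \<in> {a..X}" "y \<in> {0..T}" for x y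
      using KQ that by (auto simp: K subset_iff)
  qed (simp add: b(2))
  hence "box_int a b X T \<Lambda> ((\<Sum>\<rho>\<leftarrow>zs. cut_jump a b X \<rho>) + 0)"
    unfolding \<Lambda>_def by (intro box_int_sum_list box_int_cut_log b) (use \<rho> in auto)
  hence box: "box_int a (1 - a) X T \<Lambda> v" by (simp add: v_def b_def)
  have l_cont: "continuous_on K l" using holomorphic_on_imp_continuous_on[OF l(1)] KQ by (rule continuous_on_subset)
  have \<Lambda>_cont: "continuous_on S (\<lambda>x. \<Lambda> (g x))"
    if g: "continuous_on S g" "\<And>x. x \<in> S \<Longrightarrow> g x \<in> K" "\<And>x \<rho>. x \<in> S \<Longrightarrow> \<rho> \<in> set zs \<Longrightarrow> g x - \<rho> \<notin> \<real>\<^sub>\<le>\<^sub>0"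
    for S :: "real set" and g
    unfolding \<Lambda>_def cut_log_def
    by (intro continuous_intros continuous_on_sum_list continuous_on_compose2[OF l_cont] g) (use g in auto)
  have \<Lambda>_exp: "exp (\<Lambda> z) = zeta_reg z" if z: "z \<in> K" "zeta_reg z \<noteq> 0" for z
  proof -
    have ne: "1 - \<rho> \<noteq> 0" "z - \<rho> \<noteq> 0" if "\<rho> \<in> set zs" for \<rho>
      using h(1)[of \<rho>] that z by (auto simp: zeta_reg_def)
    have "(\<Prod>\<rho>\<leftarrow>zs. exp (cut_log (a + b) \<rho> z)) * (\<Prod>\<rho>\<leftarrow>zs. 1 - \<rho>) = (\<Prod>\<rho>\<leftarrow>zs. exp (cut_log (a + b) \<rho> z) * (1 - \<rho>))"
      by (simp add: prod_list_mult_distrib)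
    also have "map (\<lambda>\<rho>. exp (cut_log (a + b) \<rho> z) * (1 - \<rho>)) zs = map (\<lambda>\<rho>. z - \<rho>) zs"
      using ne by (intro map_cong refl) (simp add: cut_log_def b exp_diff)
    finally have 1: "(\<Prod>\<rho>\<leftarrow>zs. exp (cut_log (a + b) \<rho> z)) * (\<Prod>\<rho>\<leftarrow>zs. 1 - \<rho>) = (\<Prod>\<rho>\<leftarrow>zs. z - \<rho>)" .
    have h1: "h 1 * (\<Prod>\<rho>\<leftarrow>zs. 1 - \<rho>) = 1" using h(3)[of 1] by (simp add: zeta_reg_def)
    have zQ: "z \<in> Q" "1 \<in> Q" using z oneK KQ by auto
    have "exp (\<Lambda> z) = (\<Prod>\<rho>\<leftarrow>zs. exp (cut_log (a + b) \<rho> z)) * (h z / h 1)"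
      using l(2)[OF zQ(1)] l(2)[OF zQ(2)] by (simp add: \<Lambda>_def exp_add exp_diff exp_sum_list)
    also have "\<dots> = ((\<Prod>\<rho>\<leftarrow>zs. exp (cut_log (a + b) \<rho> z)) * (\<Prod>\<rho>\<leftarrow>zs. 1 - \<rho>)) * h z"
    proof -
      have "h 1 \<noteq> 0" using h(4)[OF oneK] .
      hence "(\<Prod>\<rho>\<leftarrow>zs. 1 - \<rho>) = 1 / h 1" using h1 by (simp add: eq_divide_eq mult.commute)
      thus ?thesis by simp
    qed
    also have "\<dots> = zeta_reg z" unfolding 1 h(3)[of z] by (rule mult.commute)
    finally show ?thesis .
  qed
  have real: "\<Lambda> (of_real x) = of_real (ln (Re (zeta_reg (of_real x))))" if x: "x \<in> {a..X}" for x
  proof -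
    have pos: "Re (zeta_reg (of_real y)) > 0" "of_real (Re (zeta_reg (of_real y))) = zeta_reg (of_real y)" if "y \<in> {a..X}" for y
    proof -
      have "y > 0" using that a by auto
      then obtain u where "u > 0" "zeta_reg (of_real y) = of_real u" by (rule zeta_reg_real_pos)
      thus "Re (zeta_reg (of_real y)) > 0" "of_real (Re (zeta_reg (of_real y))) = zeta_reg (of_real y)" by simp_all
    qed
    have "\<Lambda> (of_real x) - of_real (ln (Re (zeta_reg (of_real x)))) = \<Lambda> (of_real 1) - of_real (ln (Re (zeta_reg (of_real 1))))"
    proof (rule continuous_log_unique[of "{a..X}"])
      show "continuous_on {a..X} (\<lambda>x. \<Lambda> (of_real x))"
        using T X Im_ne by (intro \<Lambda>_cont) (auto intro!: continuous_intros simp: K complex_nonpos_Reals_iff)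
      show "continuous_on {a..X} (\<lambda>x. complex_of_real (ln (Re (zeta_reg (of_real x)))))"
        using pos by (intro continuous_intros) force
      show "exp (\<Lambda> (of_real y)) = exp (complex_of_real (ln (Re (zeta_reg (of_real y)))))" if y: "y \<in> {a..X}" for y
      proof -
        have "exp (complex_of_real (ln (Re (zeta_reg (of_real y))))) = of_real (Re (zeta_reg (of_real y)))"
          using pos(1)[OF y] by (simp only: exp_of_real exp_ln)
        moreover have "zeta_reg (of_real y) \<noteq> 0" using zeta_reg_nonzero_real[of y] y a by simp
        ultimately show ?thesis using pos(2)[OF y] \<Lambda>_exp[of "of_real y"] y T by (simp add: K)
      qed
    qed (use x a X in auto)
    moreover have "\<Lambda> 1 = 0"
    proof -
      have "(\<Sum>\<rho>\<leftarrow>zs. cut_log (a + b) \<rho> 1) = 0" by (simp add: cut_log_def b)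
      thus ?thesis by (simp add: \<Lambda>_def)
    qed
    ultimately show ?thesis by (simp add: zeta_reg_def)
  qed
  \<comment> \<open>The agreement at the real corner X is transported up the right side, which no
    cut reaches because every zero lies to its left.\<close>
  have right: "\<Lambda> (Complex X t) = zeta_log (Complex X t)" if t: "t \<in> {0..T}" for t
  proof -
    have "\<Lambda> (Complex X t) - zeta_log (Complex X t) = \<Lambda> (Complex X 0) - zeta_log (Complex X 0)"
    proof (rule continuous_log_unique[of "{0..T}"])
      show "continuous_on {0..T} (\<lambda>t. \<Lambda> (Complex X t))"
        using X a \<rho>(5) by (intro \<Lambda>_cont) (auto intro!: continuous_intros simp: K complex_nonpos_Reals_iff not_le)
      show "continuous_on {0..T} (\<lambda>t. zeta_log (Complex X t))"
        by (rule continuous_on_compose2[OF zeta_log_continuous]) (use X in \<open>auto intro!: continuous_intros\<close>)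
      show "exp (\<Lambda> (Complex X y)) = exp (zeta_log (Complex X y))" if "y \<in> {0..T}" for y
        using \<Lambda>_exp[of "Complex X y"] exp_zeta_log[of "Complex X y"] zeta_reg_nonzero_Re_gt_1[of "Complex X y"] that X a
        by (auto simp: K)
    qed (use t T in auto)
    moreover have "\<Lambda> (Complex X 0) = zeta_log (Complex X 0)"
      using real[of X] zeta_log_of_real[OF X] X a by (simp add: complex_of_real_def)
    ultimately show ?thesis by simp
  qed
  have horiz: "continuous_on {a..X} (\<lambda>x. \<Lambda> (Complex x t)) \<and> (\<forall>x\<in>{a..X}. exp (\<Lambda> (Complex x t)) = zeta_reg (Complex x t))"
    if t: "t \<in> {0<..T}" "t \<notin> zeta_ordinates" for t
  proof -
    have "Im \<rho> \<noteq> t" if "\<rho> \<in> set zs" for \<rho>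
      using h(1)[of \<rho>] that t by (auto simp: zeta_ordinates_def)
    hence "continuous_on {a..X} (\<lambda>x. \<Lambda> (Complex x t))"
      using t by (intro \<Lambda>_cont) (auto intro!: continuous_intros simp: K complex_nonpos_Reals_iff)
    moreover have "zeta_reg (Complex x t) \<noteq> 0" for x
      using t(2) unfolding zeta_ordinates_def by (metis (mono_tags, lifting) complex.sel(2) imageI mem_Collect_eq)
    ultimately show ?thesis using t \<Lambda>_exp by (auto simp: K)
  qed
  have Re_v: "Re v = (\<Sum>\<rho>\<leftarrow>zs. Re (cut_jump a b X \<rho>))"
    unfolding v_def by (induction zs) auto
  have nonneg: "Re (cut_jump a b X \<rho>) \<ge> 0" if "\<rho> \<in> set zs" for \<rho>
    using Re_cut_jump(1)[OF b(1,3)] \<rho>[OF that] b by auto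
  have lower: "Re (cut_jump a (1 - a) X \<rho>) \<le> Re v"
    if z: "zeta_reg \<rho> = 0" "a < Re \<rho>" "0 < Im \<rho>" "Im \<rho> < T" for \<rho>
  proof -
    have "Re \<rho> \<le> 1" using zeta_reg_nonzero_Re_gt_1[of \<rho>] z by (auto simp: not_less[symmetric])
    hence "\<rho> \<in> set zs" using h(1) z X by (auto simp: K)
    thus ?thesis unfolding Re_v b_def[symmetric]
      by (intro member_le_sum_list_nonneg) (use nonneg in auto)
  qed
  have zero: "v = 0" if left: "\<forall>\<rho>. zeta_reg \<rho> = 0 \<longrightarrow> Re \<rho> \<le> a"
  proof -
    have "cut_jump a b X \<rho> = 0" if "\<rho> \<in> set zs" for \<rho>
    proof -
      have "Re \<rho> \<le> a" using h(1)[of \<rho>] that left by auto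
      hence "cut_jump a b X \<rho> = (LBINT x:{a..X}. 0)"
        unfolding cut_jump_def by (intro set_lebesgue_integral_cong) auto
      thus ?thesis by simp
    qed
    hence "map (cut_jump a b X) zs = map (\<lambda>_. 0) zs" by (intro map_cong refl)
    thus ?thesis unfolding v_def by (simp only: sum_list_0)
  qed
  show ?thesis by (rule that[OF box horiz right real lower zero])
qed

section \<open>Estimates for the sides of the box\<close>

lemma norm_wt_le_far:
  assumes "b > 0" "d > 0" "Re z \<ge> a + b + d" "Im z > 0"
  shows "norm (wt a b z) \<le> d powr (-3)"
proof -
  have "(of_real b)\<^sup>2 - (z - of_real a)\<^sup>2 \<noteq> (0::complex)"
    using wt_base_not_nonpos[OF assms(4), of b a] by (metis nonpos_Reals_zero_I)
  moreover have "d \<le> norm (z - of_real (a + b))" "d \<le> norm (z - of_real (a - b))"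
    using assms complex_Re_le_cmod[of "z - of_real (a + b)"] complex_Re_le_cmod[of "z - of_real (a - b)"] by auto
  ultimately have "norm (wt a b z) \<le> d powr (-3/2) * d powr (-3/2)"
    using assms by (subst norm_wt) (auto intro!: mult_mono powr_mono2' simp del: of_real_add of_real_diff)
  thus ?thesis by (simp add: powr_add[symmetric])
qed

lemma norm_LBINT_le:
  fixes f :: "real \<Rightarrow> complex"
  assumes f: "set_integrable lborel S f" and g: "set_integrable lborel S g" and N: "countable N"
    and le: "\<And>x. x \<in> S - N \<Longrightarrow> norm (f x) \<le> g x"
  shows "norm (LBINT x:S. f x) \<le> (LBINT x:S. g x)"
proof -
  have "AE x in lborel. x \<notin> N" using countable_imp_null_set_lborel[OF N] by (rule AE_not_in)
  hence AE: "AE x in lborel. norm (indicator S x *\<^sub>R f x) \<le> indicator S x *\<^sub>R g x"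
    by (rule eventually_mono) (use le in \<open>auto simp: indicator_def\<close>)
  have "norm (LBINT x:S. f x) \<le> (LBINT x. norm (indicator S x *\<^sub>R f x))"
    unfolding set_lebesgue_integral_def by (rule integral_norm_bound)
  also have "\<dots> \<le> (LBINT x:S. g x)"
    unfolding set_lebesgue_integral_def
    using f g by (intro integral_mono_AE AE integrable_norm) (auto simp: set_integrable_def)
  finally show ?thesis .
qed

lemma LBINT_const:
  fixes u v c :: real
  assumes "u \<le> v"
  shows "set_integrable lborel {u..v} (\<lambda>x. c)" "(LBINT x:{u..v}. c) = c * (v - u)"
  using assms by (auto simp: set_integrable_def set_lebesgue_integral_def intro!: integrable_mult_left integrable_real_indicator)

lemma LBINT_sum_list_powr:
  fixes u v :: real
  assumes "u \<le> v"
  shows "set_integrable lborel {u..v} (\<lambda>x. \<Sum>\<beta>\<leftarrow>bs. 2 * isq (x - \<beta>)) \<and>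
     (LBINT x:{u..v}. \<Sum>\<beta>\<leftarrow>bs. 2 * isq (x - \<beta>)) \<le> real (length bs) * (2 * (4 + (v - u)))"
proof (induction bs)
  case Nil
  show ?case by (simp add: set_integrable_def set_lebesgue_integral_def)
next
  case (Cons \<beta> bs)
  have 1: "set_integrable lborel {u..v} (\<lambda>x. 2 * isq (x - \<beta>))"
    by (intro set_integrable_mult_right abs_powr_neg_half_integrable assms)
  have "(LBINT x:{u..v}. 2 * isq (x - \<beta>)) = 2 * (LBINT x:{u..v}. isq (x - \<beta>))"
    by (rule set_integral_mult_right)
  hence "(LBINT x:{u..v}. 2 * isq (x - \<beta>)) \<le> 2 * (4 + (v - u))"
    using abs_powr_neg_half_integrable(2)[OF assms, of \<beta>] by simp
  thus ?case using Cons 1 by (simp add: set_integral_add algebra_simps)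
qed

lemma integrable_one_over_one_plus_sq: "set_integrable lborel {0..} (\<lambda>x::real. 1 / (1 + x\<^sup>2))"
proof -
  have "(\<integral>\<^sup>+x. ennreal (1 / (1 + x\<^sup>2)) * indicator {0..} x \<partial>lborel) = ennreal (pi / 2 - arctan 0)"
  proof (rule nn_integral_FTC_atLeast)
    show "DERIV arctan x :> 1 / (1 + x\<^sup>2)" for x by (auto intro!: derivative_eq_intros simp: field_simps)
  qed (auto intro!: tendsto_arctan_at_top)
  moreover have "ennreal (1 / (1 + x\<^sup>2)) * indicator {0..} x = ennreal (norm (indicator {0..} x *\<^sub>R (1 / (1 + x\<^sup>2))))" for x :: real
    by (auto simp: indicator_def)
  ultimately have "(\<integral>\<^sup>+x. ennreal (norm (indicator {0..} x *\<^sub>R (1 / (1 + x\<^sup>2 :: real)))) \<partial>lborel) < \<infinity>" by simp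
  thus ?thesis unfolding set_integrable_def by (intro integrableI_bounded) auto
qed

text \<open>The integrand vanishes to the right of \<rho>. A given zero therefore contributes the
  same jump to every box that contains it, however wide, which yields a lower bound independent of
  T.\<close>

lemma cut_jump_cong:
  assumes "Re \<rho> \<le> X" "Re \<rho> \<le> X'"
  shows "cut_jump a b X \<rho> = cut_jump a b X' \<rho>"
  unfolding cut_jump_def set_lebesgue_integral_def
  by (rule Bochner_Integration.integral_cong) (use assms in \<open>auto simp: indicator_def\<close>)

definition zeta_weight_arg :: "real \<Rightarrow> real \<Rightarrow> real" where
  "zeta_weight_arg \<alpha> t = zeta_arg (1/2 + \<alpha>) t / (((1/2 - \<alpha>)\<^sup>2 + t\<^sup>2) powr (3/2))"

definition zeta_real_integral :: "real \<Rightarrow> real" where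
  "zeta_real_integral \<alpha> = (LBINT \<sigma>:{1/2 + \<alpha><..<1}.
     ln (Re (zeta (complex_of_real \<sigma>) * (complex_of_real \<sigma> - 1))) / ((1 - \<sigma>) powr (3/2) * (\<sigma> - 2 * \<alpha>) powr (3/2)))"

lemma real_integrand_eq:
  assumes \<alpha>: "0 \<le> \<alpha>" "\<alpha> < 1/2" and \<sigma>: "1/2 + \<alpha> < \<sigma>" "\<sigma> < 1"
  shows "Re (of_real (ln (Re (zeta_reg (of_real \<sigma>)))) * wt_real (1/2 + \<alpha>) (1/2 - \<alpha>) \<sigma>)
     = ln (Re (zeta (complex_of_real \<sigma>) * (complex_of_real \<sigma> - 1))) / ((1 - \<sigma>) powr (3/2) * (\<sigma> - 2 * \<alpha>) powr (3/2))"
proof -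
  have "(1/2 - \<alpha>)\<^sup>2 - (\<sigma> - (1/2 + \<alpha>))\<^sup>2 = (1 - \<sigma>) * (\<sigma> - 2 * \<alpha>)"
    by (simp add: power2_eq_square algebra_simps)
  hence "((1/2 - \<alpha>)\<^sup>2 - (\<sigma> - (1/2 + \<alpha>))\<^sup>2) powr (-3/2) = 1 / ((1 - \<sigma>) powr (3/2) * (\<sigma> - 2 * \<alpha>) powr (3/2))"
    using \<alpha> \<sigma> by (simp add: powr_mult powr_minus inverse_eq_divide)
  thus ?thesis using \<sigma> by (simp add: wt_real_def zeta_reg_def)
qed

text \<open>\<open>v\<close> is the sum of the jumps across the cuts below height \<open>T\<close>.\<close>
definition zeta_box_approx :: "real \<Rightarrow> real \<Rightarrow> real \<Rightarrow> real \<Rightarrow> bool" where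
  "zeta_box_approx \<alpha> C T v \<longleftrightarrow> set_integrable lborel {0<..<T} (zeta_weight_arg \<alpha>) \<and>
    (\<forall>t\<in>{0<..<T} - zeta_ordinates. \<bar>zeta_weight_arg \<alpha> t\<bar> \<le> C * (1 / (1 + t\<^sup>2))) \<and>
    \<bar>v - (zeta_real_integral \<alpha> + (LBINT t:{0<..<T}. zeta_weight_arg \<alpha> t))\<bar> \<le> C * (1 + T)\<^sup>2 * T powr (-3) \<and>
    (\<forall>\<rho>. zeta_reg \<rho> = 0 \<longrightarrow> 1/2 + \<alpha> < Re \<rho> \<longrightarrow> 0 < Im \<rho> \<longrightarrow> Im \<rho> < T \<longrightarrow> Re (cut_jump (1/2 + \<alpha>) (1/2 - \<alpha>) 3 \<rho>) \<le> v) \<and>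
    ((\<forall>\<rho>. zeta_reg \<rho> = 0 \<longrightarrow> Re \<rho> \<le> 1/2 + \<alpha>) \<longrightarrow> v = 0)"

text \<open>The real part of the box identity for the logarithm from \<open>zeta_box\<close>. The
  constant is uniform in T, so that T may tend to infinity afterwards.\<close>

lemma zeta_box_estimate:
  assumes \<alpha>: "0 \<le> \<alpha>" "\<alpha> < 1/2"
  obtains C where "C > 0" "\<And>T. T > 0 \<Longrightarrow> T \<notin> zeta_ordinates \<Longrightarrow> \<exists>v. zeta_box_approx \<alpha> C T v"
proof -
  define a where "a = 1/2 + \<alpha>"
  define b where "b = 1/2 - \<alpha>"
  have ab: "1/2 \<le> a" "a < 1" "b > 0" "1 - a = b" "a + b = 1" using \<alpha> by (auto simp: a_def b_def)
  show ?thesis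
  proof (rule zeta_log_variation[of a])
    fix C1 :: real
    assume C1: "C1 > 0" and var: "\<And>t G. \<lbrakk>t > 0; t \<notin> zeta_ordinates; continuous_on {a..3} G;
      \<And>x. x \<in> {a..3} \<Longrightarrow> exp (G x) = zeta_reg (Complex x t)\<rbrakk> \<Longrightarrow>
      log_variation_le a 3 (C1 * (1 + t)) G"
    define C2 where "C2 = (C1 + 2 * pi) * 2 * b powr (-3)"
    \<comment> \<open>The coefficient of (1 + T)^2: 13 from the right side, the rest from the top,
      where X - a <= 3 (1 + T) and 2 (4 + (X - a)) <= 14 (1 + T).\<close>
    define C3 where "C3 = 13 + (3 * (13 + C1) + 14 * C1)"
    define C where "C = C2 + C3"
    have C23: "C2 > 0" "C3 > 0" using C1 ab pi_gt_zero by (auto simp: C2_def C3_def intro!: mult_pos_pos add_pos_pos)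
    show ?thesis
    proof (rule that[of C])
      show "C > 0" using C23 by (simp add: C_def)
      fix T :: real assume T: "T > 0" "T \<notin> zeta_ordinates"
      \<comment> \<open>The width grows with the height: the right side is then at distance at least
        T from both branch points, and the weight is at most T^-3 there just as on the top.\<close>
      define X where "X = T + 3"
      have X: "X \<ge> 3" "a \<le> X" "T \<le> X - 1" using T ab by (auto simp: X_def)
      obtain \<Lambda> v where box: "box_int a (1 - a) X T \<Lambda> v"
        and hor: "\<And>t. t \<in> {0<..T} \<Longrightarrow> t \<notin> zeta_ordinates \<Longrightarrow> continuous_on {a..X} (\<lambda>x. \<Lambda> (Complex x t)) \<and>
           (\<forall>x\<in>{a..X}. exp (\<Lambda> (Complex x t)) = zeta_reg (Complex x t))"
        and right: "\<And>t. t \<in> {0..T} \<Longrightarrow> \<Lambda> (Complex X t) = zeta_log (Complex X t)"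
        and real: "\<And>x. x \<in> {a..X} \<Longrightarrow> \<Lambda> (of_real x) = of_real (ln (Re (zeta_reg (of_real x))))"
        and lower: "\<And>\<rho>. zeta_reg \<rho> = 0 \<Longrightarrow> a < Re \<rho> \<Longrightarrow> 0 < Im \<rho> \<Longrightarrow> Im \<rho> < T \<Longrightarrow> Re (cut_jump a (1 - a) X \<rho>) \<le> Re v"
        and zero: "\<forall>\<rho>. zeta_reg \<rho> = 0 \<longrightarrow> Re \<rho> \<le> a \<Longrightarrow> v = 0"
        by (rule zeta_box[OF ab(1,2) T X(1)]) (rule that, assumption+)
      have far: "\<Lambda> (Complex x t) = zeta_log (Complex x t)" if "t \<in> {0<..T}" "t \<notin> zeta_ordinates" "x \<in> {3..X}" for t x
      proof -
        have "\<Lambda> (Complex x t) - zeta_log (Complex x t) = \<Lambda> (Complex X t) - zeta_log (Complex X t)"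
        proof (rule continuous_log_unique[of "{3..X}"])
          show "continuous_on {3..X} (\<lambda>x. \<Lambda> (Complex x t))"
            using hor[OF that(1,2)] ab by (auto intro: continuous_on_subset)
          show "continuous_on {3..X} (\<lambda>x. zeta_log (Complex x t))"
            by (rule continuous_on_compose2[OF zeta_log_continuous]) (auto intro!: continuous_intros)
          show "exp (\<Lambda> (Complex y t)) = exp (zeta_log (Complex y t))" if "y \<in> {3..X}" for y
            using hor[OF \<open>t \<in> {0<..T}\<close> \<open>t \<notin> zeta_ordinates\<close>] exp_zeta_log[of "Complex y t"] that ab by auto
        qed (use that in auto)
        thus ?thesis using right[of t] that by simp
      qed
      have var\<Lambda>: "log_variation_le a 3 (C1 * (1 + t)) (\<lambda>x. \<Lambda> (Complex x t))"
        if t: "t \<in> {0<..T}" "t \<notin> zeta_ordinates" for t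
        by (rule var) (use t hor[OF t] X in \<open>auto intro: continuous_on_subset\<close>)
      have arg: "zeta_arg a t = Im (\<Lambda> (Complex a t))" if "t \<in> {0<..T}" "t \<notin> zeta_ordinates" for t
        by (rule zeta_arg_eq[OF _ X(1,2)]) (use that hor right in auto)
      have argle: "\<bar>zeta_arg a t\<bar> \<le> (C1 + 2 * pi) * (1 + t)" if t: "t \<in> {0<..T}" "t \<notin> zeta_ordinates" for t
      proof -
        have "\<bar>Im (\<Lambda> (Complex a t) - \<Lambda> (Complex 3 t))\<bar> \<le> C1 * (1 + t)" using var\<Lambda>[OF t] ab by (auto simp: log_variation_le_def)
        moreover have "\<bar>Im (\<Lambda> (Complex 3 t))\<bar> \<le> 2 * pi"
          using far[OF t, of 3] X Im_zeta_log_le[of "Complex 3 t"] by simp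
        moreover have "2 * pi \<le> 2 * pi * (1 + t)" using t pi_gt_zero by (simp add: algebra_simps)
        moreover have "(C1 + 2 * pi) * (1 + t) = C1 * (1 + t) + 2 * pi * (1 + t)" by (simp add: algebra_simps)
        ultimately show ?thesis unfolding arg[OF t] minus_complex.sel by linarith
      qed
      have weight: "\<bar>zeta_weight_arg \<alpha> t\<bar> \<le> C2 * (1 / (1 + t\<^sup>2))" if t: "t \<in> {0<..T}" "t \<notin> zeta_ordinates" for t
      proof -
        \<comment> \<open>In terms of u, the numerator satisfies 1 + t <= 2 u, and b <= 1 gives (b^2
          + t^2)^(-3/2) <= (b u)^(-3). The quotient is of order u^-2 = 1 / (1 + t^2), an integrable
          majorant.\<close>
        define u where "u = sqrt (1 + t\<^sup>2)"
        have u: "u > 0" "u\<^sup>2 = 1 + t\<^sup>2" by (auto simp: u_def add_pos_nonneg)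
        have "1 + t \<le> 2 * u"
        proof -
          have "1 \<le> u" "t \<le> u" by (auto simp: u_def intro!: real_le_rsqrt)
          thus ?thesis by simp
        qed
        have b1: "b\<^sup>2 \<le> 1" using ab by (simp add: power_le_one b_def a_def)
        have "(b * u)\<^sup>2 \<le> b\<^sup>2 + t\<^sup>2"
          using mult_right_mono[OF b1, of "t\<^sup>2"] by (simp add: power_mult_distrib u(2) algebra_simps)
        hence "(b\<^sup>2 + t\<^sup>2) powr (-3/2) \<le> ((b * u)\<^sup>2) powr (-3/2)"
          using ab u by (intro powr_mono2') auto
        also have "(b * u)\<^sup>2 = (b * u) powr 2" using ab u by simp
        also have "((b * u) powr 2) powr (-3/2) = (b * u) powr (-3)" by (simp only: powr_powr) simp
        also have "(b * u) powr (-3) = b powr (-3) * u powr (-3)" using ab u by (simp add: powr_mult)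
        finally have r: "(b\<^sup>2 + t\<^sup>2) powr (-3/2) \<le> b powr (-3) * u powr (-3)" .
        have "\<bar>zeta_weight_arg \<alpha> t\<bar> = \<bar>zeta_arg a t\<bar> * (b\<^sup>2 + t\<^sup>2) powr (-3/2)"
          by (simp add: zeta_weight_arg_def a_def b_def powr_minus field_simps abs_mult)
        also have "\<dots> \<le> ((C1 + 2 * pi) * (1 + t)) * (b powr (-3) * u powr (-3))"
          using argle[OF t] r C1 t by (intro mult_mono) auto
        also have "\<dots> \<le> ((C1 + 2 * pi) * (2 * u)) * (b powr (-3) * u powr (-3))"
          using \<open>1 + t \<le> 2 * u\<close> C1 by (intro mult_right_mono mult_left_mono) auto
        also have "\<dots> = C2 * (u powr 1 * u powr (-3))" using u by (simp add: C2_def)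
        also have "u powr 1 * u powr (-3) = u powr (-2)" by (simp only: powr_add[symmetric]) simp
        also have "u powr (-2) = 1 / (1 + t\<^sup>2)" using u by (simp add: powr_minus powr_numeral inverse_eq_divide)
        finally show ?thesis .
      qed
      let ?w = "\<lambda>x y. \<Lambda> (Complex x y) * wt a b (Complex x y)"
      note box' = rect_intD[OF box[unfolded box_int_def ab(4)]]
      \<comment> \<open>At the heights of zeros no formula for the argument is available; being
        countable, they affect neither integrability nor the integral.\<close>
      have left_eq: "Im (indicator {0<..<T} t *\<^sub>R (?w a t)) = indicator {0<..<T} t *\<^sub>R zeta_weight_arg \<alpha> t"
        if "t \<notin> zeta_ordinates" for t
        using arg[of t] that by (auto simp: indicator_def wt_left zeta_weight_arg_def a_def b_def powr_minus field_simps)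
      have "integrable lborel (\<lambda>t. indicator {0<..<T} t *\<^sub>R zeta_weight_arg \<alpha> t) \<longleftrightarrow>
         integrable lborel (\<lambda>t. Im (indicator {0<..<T} t *\<^sub>R (?w a t)))"
        by (rule integrable_discrete_difference[OF countable_zeta_ordinates]) (rule left_eq[symmetric] | simp)+
      hence left_int: "set_integrable lborel {0<..<T} (zeta_weight_arg \<alpha>)"
        using integrable_Im[OF box'(3)[unfolded set_integrable_def]] by (simp add: set_integrable_def)
      have "(LBINT t. Im (indicator {0<..<T} t *\<^sub>R (?w a t))) = (LBINT t. indicator {0<..<T} t *\<^sub>R zeta_weight_arg \<alpha> t)"
        by (rule integral_discrete_difference[OF countable_zeta_ordinates]) (rule left_eq | simp)+
      hence left: "Im (LBINT t:{0<..<T}. ?w a t) = (LBINT t:{0<..<T}. zeta_weight_arg \<alpha> t)"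
        using integral_Im[OF box'(3)[unfolded set_integrable_def]] by (simp only: set_lebesgue_integral_def)
      have bot_eq: "Re (indicator {a..X} x *\<^sub>R (\<Lambda> (of_real x) * wt_real a b x)) = indicator {1/2 + \<alpha><..<1} x *\<^sub>R
         (ln (Re (zeta (complex_of_real x) * (complex_of_real x - 1))) / ((1 - x) powr (3/2) * (x - 2 * \<alpha>) powr (3/2)))"
        if "x \<notin> {a}" for x
      proof (cases "x \<in> {a<..<1}")
        case True
        thus ?thesis using real[of x] real_integrand_eq[OF \<alpha>, of x] X by (simp add: a_def b_def)
      next
        case False
        have "Re (\<Lambda> (of_real x) * wt_real a b x) = 0" if "x \<in> {a..X}"
          using real[OF that] that False \<open>x \<notin> {a}\<close> ab by (auto simp: wt_real_def)
        thus ?thesis using False by (auto simp: indicator_def a_def)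
      qed
      have "(LBINT x. Re (indicator {a..X} x *\<^sub>R (\<Lambda> (of_real x) * wt_real a b x))) = zeta_real_integral \<alpha>"
        unfolding zeta_real_integral_def set_lebesgue_integral_def
        by (rule integral_discrete_difference[of "{a}"]) (rule bot_eq | simp)+
      hence bottom: "Re (LBINT x:{a..X}. \<Lambda> (of_real x) * wt_real a b x) = zeta_real_integral \<alpha>"
        using integral_Re[OF box'(1)[unfolded set_integrable_def]] by (simp only: set_lebesgue_integral_def)
      have cm: "norm (zeta_log (Complex x t)) \<le> 13 * (1 + T)" if "x \<in> {3..X}" "t \<in> {0..T}" for x t
        using norm_zeta_log_le[of "Complex x t"] cmod_le[of "Complex x t"] that by (auto simp: X_def)
      let ?R = "LBINT t:{0<..<T}. ?w X t"
      let ?P = "LBINT x:{a..X}. ?w x T"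
      have right_le: "norm ?R \<le> 13 * (1 + T) * T powr (-3) * T"
      proof -
        have const: "set_integrable lborel {0<..<T} (\<lambda>t. 13 * (1 + T) * T powr (-3))"
          by (rule set_integrable_subset[OF LBINT_const(1)[of 0 T]]) (use T in auto)
        have "norm ?R \<le> (LBINT t:{0<..<T}. 13 * (1 + T) * T powr (-3))"
        proof (rule norm_LBINT_le[OF box'(4) const countable_empty])
          fix t assume t: "t \<in> {0<..<T} - {}"
          have "norm (wt a b (Complex X t)) \<le> T powr (-3)"
            using t T ab by (intro norm_wt_le_far) (auto simp: X_def)
          thus "norm (?w X t) \<le> 13 * (1 + T) * T powr (-3)"
            using right[of t] cm[of X t] t X T unfolding norm_mult by (intro mult_mono) auto
        qed
        also have "\<dots> = 13 * (1 + T) * T powr (-3) * T"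
          using T by (simp add: set_lebesgue_integral_def)
        finally show ?thesis .
      qed
      have T': "T \<in> {0<..T}" using T by simp
      obtain bs where bs: "real (length bs) \<le> C1 * (1 + T)"
          "\<forall>x\<in>{a..3} - set bs. norm (\<Lambda> (Complex x T) - \<Lambda> (Complex 3 T)) \<le> C1 * (1 + T) + (\<Sum>\<beta>\<leftarrow>bs. 2 * isq (x - \<beta>))"
        using var\<Lambda>[OF T' T(2), unfolded log_variation_le_def] by blast
      \<comment> \<open>Zeros close to height T make the logarithm large near their abscissae. Each
        costs an integral of at most 2 (4 + (X - a)) wherever it sits, and their number is at most
        C1 (1 + T).\<close>
      have top_le: "norm ?P \<le>
        T powr (-3) * ((13 + C1) * (1 + T) * (X - a) + real (length bs) * (2 * (4 + (X - a))))"
      proof -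
        note L = LBINT_sum_list_powr[OF X(2), of bs]
        let ?g = "\<lambda>x. T powr (-3) * ((13 + C1) * (1 + T) + (\<Sum>\<beta>\<leftarrow>bs. 2 * isq (x - \<beta>)))"
        have g: "set_integrable lborel {a..X} ?g"
          by (intro set_integrable_mult_right set_integral_add(1) LBINT_const X L[THEN conjunct1])
        have "norm ?P \<le> (LBINT x:{a..X}. ?g x)"
        proof (rule norm_LBINT_le[OF box'(2) g, of "set bs"])
          fix x assume x: "x \<in> {a..X} - set bs"
          have S0: "0 \<le> (\<Sum>\<beta>\<leftarrow>bs. 2 * isq (x - \<beta>))" by (intro sum_list_nonneg) auto
          have "norm (\<Lambda> (Complex x T)) \<le> (13 + C1) * (1 + T) + (\<Sum>\<beta>\<leftarrow>bs. 2 * isq (x - \<beta>))"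
          proof (cases "x \<ge> 3")
            case True
            hence "norm (\<Lambda> (Complex x T)) \<le> 13 * (1 + T)" using far[OF T' T(2), of x] cm[of x T] x T by simp
            moreover have "0 \<le> C1 * (1 + T)" using C1 T by simp
            ultimately show ?thesis using S0 by (simp add: distrib_right)
          next
            case False
            have "norm (\<Lambda> (Complex x T)) \<le> norm (\<Lambda> (Complex x T) - \<Lambda> (Complex 3 T)) + norm (\<Lambda> (Complex 3 T))"
              using norm_triangle_ineq[of "\<Lambda> (Complex x T) - \<Lambda> (Complex 3 T)" "\<Lambda> (Complex 3 T)"] by simp
            moreover have "norm (\<Lambda> (Complex 3 T)) \<le> 13 * (1 + T)" using far[OF T' T(2), of 3] cm[of 3 T] T X by simp
            moreover have "norm (\<Lambda> (Complex x T) - \<Lambda> (Complex 3 T)) \<le> C1 * (1 + T) + (\<Sum>\<beta>\<leftarrow>bs. 2 * isq (x - \<beta>))"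
              using bs(2) x False by auto
            ultimately show ?thesis by (simp add: distrib_right)
          qed
          moreover have "norm (wt a b (Complex x T)) \<le> T powr (-3)" using norm_wt_le_Im[of "Complex x T" a b] T by simp
          ultimately show "norm (?w x T) \<le> ?g x"
            unfolding norm_mult by (subst mult.commute) (intro mult_mono, auto)
        qed (intro countable_finite finite_set)
        also have "(LBINT x:{a..X}. ?g x) = T powr (-3) * ((LBINT x:{a..X}. (13 + C1) * (1 + T)) + (LBINT x:{a..X}. (\<Sum>\<beta>\<leftarrow>bs. 2 * isq (x - \<beta>))))"
          by (subst set_integral_mult_right, subst set_integral_add(2)) (use LBINT_const X L in auto)
        also have "\<dots> \<le> T powr (-3) * ((13 + C1) * (1 + T) * (X - a) + real (length bs) * (2 * (4 + (X - a))))"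
          unfolding LBINT_const(2)[OF X(2)] by (intro mult_left_mono add_left_mono L[THEN conjunct2]) simp
        finally show ?thesis .
      qed
      have err: "norm ?R + norm ?P
          \<le> C3 * (1 + T)\<^sup>2 * T powr (-3)"
      proof -
        have Xa: "X - a \<le> 3 * (1 + T)" "2 * (4 + (X - a)) \<le> 14 * (1 + T)" "X - a \<ge> 0" using ab T X by (auto simp: X_def)
        have "13 * (1 + T) * T + ((13 + C1) * (1 + T) * (X - a) + real (length bs) * (2 * (4 + (X - a))))
          \<le> 13 * (1 + T) * (1 + T) + ((13 + C1) * (1 + T) * (3 * (1 + T)) + (C1 * (1 + T)) * (14 * (1 + T)))"
        proof (intro add_mono)
          show "13 * (1 + T) * T \<le> 13 * (1 + T) * (1 + T)" using T by (intro mult_left_mono) auto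
          show "(13 + C1) * (1 + T) * (X - a) \<le> (13 + C1) * (1 + T) * (3 * (1 + T))"
            using T C1 by (intro mult_left_mono Xa) auto
          show "real (length bs) * (2 * (4 + (X - a))) \<le> (C1 * (1 + T)) * (14 * (1 + T))"
            by (rule mult_mono[OF bs(1) Xa(2)]) (use T C1 Xa in auto)
        qed
        also have "\<dots> = C3 * (1 + T)\<^sup>2" by (simp add: C3_def power2_eq_square algebra_simps)
        finally have "T powr (-3) * (13 * (1 + T) * T + ((13 + C1) * (1 + T) * (X - a) + real (length bs) * (2 * (4 + (X - a)))))
          \<le> T powr (-3) * (C3 * (1 + T)\<^sup>2)" by (rule mult_left_mono) auto
        thus ?thesis using right_le top_le by (simp add: algebra_simps)
      qed
      have "\<bar>Re v - (zeta_real_integral \<alpha> + (LBINT t:{0<..<T}. zeta_weight_arg \<alpha> t))\<bar> \<le> C3 * (1 + T)\<^sup>2 * T powr (-3)"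
      proof -
        \<comment> \<open>The factor \<i> of the vertical sides turns real parts into negative
          imaginary parts, so the left side contributes the integral of the argument.\<close>
        have e1: "Re v - (zeta_real_integral \<alpha> + (LBINT t:{0<..<T}. zeta_weight_arg \<alpha> t))
          = - Im ?R - Re ?P"
        proof -
          have *: "Re w - (Re A + Im L) = - Im R - Re E" if "A + \<i> * R - E - \<i> * L = w" for A R E L w
            unfolding that[symmetric] by simp
          show ?thesis using *[OF box'(5)] unfolding bottom left .
        qed
        have e2: "\<bar>- Im ?R - Re ?P\<bar>
          \<le> norm ?R + norm ?P"
        proof -
          have *: "\<bar>- p - q\<bar> \<le> P + Q" if "\<bar>p\<bar> \<le> P" "\<bar>q\<bar> \<le> Q" for p q P Q :: real
            using that by (simp add: abs_le_iff)
          show ?thesis by (rule *[OF abs_Im_le_cmod abs_Re_le_cmod])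
        qed
        show ?thesis unfolding e1 by (rule order_trans[OF e2 err])
      qed
      moreover have "C3 * (1 + T)\<^sup>2 * T powr (-3) \<le> C * (1 + T)\<^sup>2 * T powr (-3)"
        using C23 by (intro mult_right_mono) (auto simp: C_def)
      moreover have "\<bar>zeta_weight_arg \<alpha> t\<bar> \<le> C * (1 / (1 + t\<^sup>2))" if "t \<in> {0<..<T} - zeta_ordinates" for t
      proof -
        have "C2 * (1 / (1 + t\<^sup>2)) \<le> C * (1 / (1 + t\<^sup>2))" using C23 by (intro mult_right_mono) (auto simp: C_def)
        thus ?thesis using weight[of t] that by auto
      qed
      moreover have "Re (cut_jump a b 3 \<rho>) \<le> Re v" if "zeta_reg \<rho> = 0" "a < Re \<rho>" "0 < Im \<rho>" "Im \<rho> < T" for \<rho>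
      proof -
        have "Re \<rho> \<le> 1" using zeta_reg_nonzero_Re_gt_1[of \<rho>] that by (auto simp: not_less[symmetric])
        hence "cut_jump a b 3 \<rho> = cut_jump a b X \<rho>" using X by (intro cut_jump_cong) auto
        thus ?thesis using lower[OF that] by (simp add: ab(4))
      qed
      ultimately show "\<exists>v. zeta_box_approx \<alpha> C T v"
        using left_int zero unfolding zeta_box_approx_def a_def[symmetric] b_def[symmetric]
        by (intro exI[of _ "Re v"]) (auto intro: order_trans)
    qed
  qed (use ab in auto)
qed

section \<open>The limit of large height\<close>

lemma zeta_zero_upper_half:
  assumes "zeta_reg s = 0" "a < Re s" "a \<ge> 0"
  obtains \<rho> where "zeta_reg \<rho> = 0" "a < Re \<rho>" "0 < Im \<rho>"
proof (cases "Im s = 0")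
  case True
  hence "s = of_real (Re s)" by (simp add: complex_eq_iff)
  thus ?thesis using zeta_reg_nonzero_real[of "Re s"] assms by simp
next
  case False
  show ?thesis
  proof (cases "Im s > 0")
    case True
    thus ?thesis using assms that by blast
  next
    case neg: False
    have "zeta_reg (cnj s) = 0" using zeta_reg_cnj[of s] assms by simp
    thus ?thesis using False neg assms by (intro that[of "cnj s"]) auto
  qed
qed

text \<open>Along heights tending to infinity off the ordinates of zeros the error vanishes, so the
  sums of jumps \<open>v n\<close> converge to the left-hand side. A zero to the right, reflected
  into the upper half-plane if necessary, keeps every \<open>v n\<close> with \<open>T n\<close>
  above it at or over a fixed positive jump, and hence also the limit.\<close>

lemma zeta_integral_identity:
  assumes \<alpha>: "0 \<le> \<alpha>" "\<alpha> < 1/2"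
  shows "(LBINT t:{0<..}. zeta_weight_arg \<alpha> t) + zeta_real_integral \<alpha> = 0 \<longleftrightarrow>
    (\<forall>\<rho>. zeta_reg \<rho> = 0 \<longrightarrow> Re \<rho> \<le> 1/2 + \<alpha>)"
proof (rule zeta_box_estimate[OF \<alpha>])
  fix C :: real
  assume C: "C > 0" and est: "\<And>T. T > 0 \<Longrightarrow> T \<notin> zeta_ordinates \<Longrightarrow> \<exists>v. zeta_box_approx \<alpha> C T v"
  have "\<exists>T. real n < T \<and> T \<notin> zeta_ordinates" for n
  proof -
    have "\<not> {real n<..<real n + 1} \<subseteq> zeta_ordinates"
      using countable_subset[OF _ countable_zeta_ordinates] uncountable_open_interval[of "real n" "real n + 1"] by auto
    thus ?thesis by auto
  qed
  then obtain T where T: "\<And>n. real n < T n" "\<And>n. T n \<notin> zeta_ordinates" by metis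
  have T0: "T n > 0" for n using T(1)[of n] by (rule order_le_less_trans[rotated]) simp
  have Tlim: "filterlim T at_top sequentially"
    by (rule filterlim_at_top_mono[OF filterlim_real_sequentially]) (intro always_eventually allI less_imp_le T(1))
  from est[OF T0 T(2)] obtain v where v:
    "\<And>n. set_integrable lborel {0<..<T n} (zeta_weight_arg \<alpha>)"
    "\<And>n t. t \<in> {0<..<T n} - zeta_ordinates \<Longrightarrow> \<bar>zeta_weight_arg \<alpha> t\<bar> \<le> C * (1 / (1 + t\<^sup>2))"
    "\<And>n. \<bar>v n - (zeta_real_integral \<alpha> + (LBINT t:{0<..<T n}. zeta_weight_arg \<alpha> t))\<bar> \<le> C * (1 + T n)\<^sup>2 * T n powr (-3)"
    "\<And>n \<rho>. zeta_reg \<rho> = 0 \<Longrightarrow> 1/2 + \<alpha> < Re \<rho> \<Longrightarrow> 0 < Im \<rho> \<Longrightarrow> Im \<rho> < T n \<Longrightarrow> Re (cut_jump (1/2 + \<alpha>) (1/2 - \<alpha>) 3 \<rho>) \<le> v n"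
    "\<And>n. \<forall>\<rho>. zeta_reg \<rho> = 0 \<longrightarrow> Re \<rho> \<le> 1/2 + \<alpha> \<Longrightarrow> v n = 0"
    unfolding zeta_box_approx_def by metis
  have bnd: "\<bar>zeta_weight_arg \<alpha> t\<bar> \<le> C * (1 / (1 + t\<^sup>2))" if "t > 0" "t \<notin> zeta_ordinates" for t
  proof -
    obtain n where "t < real n" using reals_Archimedean2 by blast
    thus ?thesis using v(2)[of t n] T(1)[of n] that by auto
  qed
  have "(\<lambda>n. LBINT t:{0<..<T n}. zeta_weight_arg \<alpha> t) \<longlonglongrightarrow> (LBINT t:{0<..}. zeta_weight_arg \<alpha> t)"
    unfolding set_lebesgue_integral_def
  proof (rule integral_limit_off_countable[THEN conjunct2])
    show "countable zeta_ordinates" by (rule countable_zeta_ordinates)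
    show "(\<lambda>t. indicator {0<..<T n} t *\<^sub>R zeta_weight_arg \<alpha> t) \<in> borel_measurable borel" for n
      using borel_measurable_integrable[OF v(1)[of n, unfolded set_integrable_def]] by simp
    show "integrable lborel (\<lambda>t. C * (indicator {0..} t *\<^sub>R (1 / (1 + t\<^sup>2))))"
      using integrable_one_over_one_plus_sq unfolding set_integrable_def by (rule integrable_mult_right)
    show "norm (indicator {0<..<T n} t *\<^sub>R zeta_weight_arg \<alpha> t) \<le> C * (indicator {0..} t *\<^sub>R (1 / (1 + t\<^sup>2)))"
      if "t \<notin> zeta_ordinates" for n t
      using bnd[of t] that C by (auto simp: indicator_def)
    show "(\<lambda>n. indicator {0<..<T n} t *\<^sub>R zeta_weight_arg \<alpha> t) \<longlonglongrightarrow> indicator {0<..} t *\<^sub>R zeta_weight_arg \<alpha> t" for t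
    proof -
      have "\<forall>\<^sub>F n in sequentially. indicator {0<..} t *\<^sub>R zeta_weight_arg \<alpha> t = indicator {0<..<T n} t *\<^sub>R zeta_weight_arg \<alpha> t"
        using filterlim_at_top_dense[THEN iffD1, OF Tlim, rule_format, of t]
        by eventually_elim (auto simp: indicator_def)
      thus ?thesis by (rule Lim_transform_eventually[OF tendsto_const])
    qed
  qed
  moreover have "(\<lambda>n. v n - (zeta_real_integral \<alpha> + (LBINT t:{0<..<T n}. zeta_weight_arg \<alpha> t))) \<longlonglongrightarrow> 0"
  proof (rule Lim_null_comparison)
    show "\<forall>\<^sub>F n in sequentially. norm (v n - (zeta_real_integral \<alpha> + (LBINT t:{0<..<T n}. zeta_weight_arg \<alpha> t))) \<le> C * (1 + T n)\<^sup>2 * T n powr (-3)"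
      using v(3) by simp
    have "((\<lambda>x::real. (1 + x)\<^sup>2 * x powr (-3)) \<longlongrightarrow> 0) at_top" by real_asymp
    from tendsto_mult_right_zero[OF filterlim_compose[OF this Tlim], of C]
    show "(\<lambda>n. C * (1 + T n)\<^sup>2 * T n powr (-3)) \<longlonglongrightarrow> 0" by (simp add: mult.assoc)
  qed
  ultimately have "(\<lambda>n. (v n - (zeta_real_integral \<alpha> + (LBINT t:{0<..<T n}. zeta_weight_arg \<alpha> t))) + (zeta_real_integral \<alpha> + (LBINT t:{0<..<T n}. zeta_weight_arg \<alpha> t)))
    \<longlonglongrightarrow> 0 + (zeta_real_integral \<alpha> + (LBINT t:{0<..}. zeta_weight_arg \<alpha> t))"
    by (intro tendsto_intros)
  hence lim: "v \<longlonglongrightarrow> (LBINT t:{0<..}. zeta_weight_arg \<alpha> t) + zeta_real_integral \<alpha>" by (simp add: add.commute)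
  show ?thesis
  proof
    assume "\<forall>\<rho>. zeta_reg \<rho> = 0 \<longrightarrow> Re \<rho> \<le> 1/2 + \<alpha>"
    hence "v = (\<lambda>n. 0)" using v(5) by auto
    thus "(LBINT t:{0<..}. zeta_weight_arg \<alpha> t) + zeta_real_integral \<alpha> = 0"
      using lim by (simp add: LIMSEQ_const_iff)
  next
    assume eq: "(LBINT t:{0<..}. zeta_weight_arg \<alpha> t) + zeta_real_integral \<alpha> = 0"
    show "\<forall>\<rho>. zeta_reg \<rho> = 0 \<longrightarrow> Re \<rho> \<le> 1/2 + \<alpha>"
    proof (rule ccontr)
      assume "\<not> ?thesis"
      then obtain s where s: "zeta_reg s = 0" "1/2 + \<alpha> < Re s" by (auto simp: not_le)
      obtain \<rho> where \<rho>: "zeta_reg \<rho> = 0" "1/2 + \<alpha> < Re \<rho>" "0 < Im \<rho>"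
        by (rule zeta_zero_upper_half[OF s]) (use \<alpha> in simp, rule that)
      define c where "c = Re (cut_jump (1/2 + \<alpha>) (1/2 - \<alpha>) 3 \<rho>)"
      have "Re \<rho> \<le> 1" using zeta_reg_nonzero_Re_gt_1[of \<rho>] \<rho> by (auto simp: not_less[symmetric])
      hence "c > 0" unfolding c_def using \<alpha> \<rho> by (intro Re_cut_jump(2)[of _ _ _ _ "Im \<rho> + 1"]) auto
      moreover have "c \<le> 0"
      proof (rule tendsto_lowerbound[OF lim[unfolded eq]])
        show "\<forall>\<^sub>F n in sequentially. c \<le> v n"
          using filterlim_at_top_dense[THEN iffD1, OF Tlim, rule_format, of "Im \<rho>"]
          by eventually_elim (use v(4)[OF \<rho>] in \<open>simp add: c_def\<close>)
      qed simp
      ultimately show False by simp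
    qed
  qed
qed

theorem theorem7:
  fixes \<alpha> :: real
  assumes "0 \<le> \<alpha>" and "\<alpha> < 1/2"
  shows "((LBINT t:{0<..}. zeta_arg (1/2 + \<alpha>) t / (((1/2 - \<alpha>)\<^sup>2 + t\<^sup>2) powr (3/2)))
          + (LBINT \<sigma>:{1/2 + \<alpha><..<1}.
               ln (Re (zeta (complex_of_real \<sigma>) * (complex_of_real \<sigma> - 1)))
               / ((1 - \<sigma>) powr (3/2) * (\<sigma> - 2 * \<alpha>) powr (3/2))) = 0)
         \<longleftrightarrow> (\<forall>s. s \<noteq> 1 \<and> Re s > 1/2 + \<alpha> \<longrightarrow> zeta s \<noteq> 0)"
proof -
  \<comment> \<open>Away from 1 the factor s - 1 adds no zeros, and at 1 the value
    \<open>zeta_reg 1 = 1\<close> matches the exclusion of the pole.\<close>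
  have "(\<forall>\<rho>. zeta_reg \<rho> = 0 \<longrightarrow> Re \<rho> \<le> 1/2 + \<alpha>) \<longleftrightarrow> (\<forall>s. s \<noteq> 1 \<and> Re s > 1/2 + \<alpha> \<longrightarrow> zeta s \<noteq> 0)"
    unfolding not_less[symmetric] zeta_reg_def by auto
  thus ?thesis
    using zeta_integral_identity[OF assms] unfolding zeta_weight_arg_def zeta_real_integral_def by (rule trans[rotated])
qed

end
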